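(* For ${\rm APP}=\{{\rm APP}_d\}_{d\in\mathbb N}$ in the average case setting with the absolute error criterion, ${\rm APP}$ is ALG-WT for $\Lambda^{\rm all}$ if and only if it is ALG-WT for $\Lambda^{\rm std}$.
   Context: Setting (average case approximation). For each $d\in\mathbb N$: $D_d\subset\mathbb R^d$ is a Borel set of positive Lebesgue measure, $\rho_d$ is a probability density on $D_d$, and $G_d=L_2(D_d,\rho_d(x)\,dx)$. $F_d$ is a separable Banach space of real-valued functions on $D_d$, continuously embedded in $G_d$, such that every point evaluation $f\mapsto f(x)$, $x\in D_d$, is a continuous linear functional on $F_d$; $F_d$ carries a zero-mean Gaussian measure $\mu_d$. ${\rm APP}_d:F_d\to G_d$, ${\rm APP}_d f=f$. $\Lambda^{\rm all}$ is the class of all continuous linear functionals on $F_d$, $\Lambda^{\rm std}$ the class of point evaluations. For $\Lambda\in\{\Lambda^{\rm all},\Lambda^{\rm std}\}$, an algorithm is $A_{n,d}f=\phi_{n,d}(L_1(f),\dots,L_n(f))$ with $L_i\in\Lambda$ and $\phi_{n,d}:\mathbb R^n\to G_d$ measurable; its average case error is $e^{\rm avg}(A_{n,d})=\big(\int_{F_d}\|f-A_{n,d}f\|_{G_d}^2\,\mu_d(df)\big)^{1/2}$, and $e^{\rm avg}(n,d;\Lambda)$ is the infimum of $e^{\rm avg}(A_{n,d})$ over all such algorithms using $n$ functionals from $\Lambda$ (for $n=0$, $A_{0,d}=0$). Absolute-error information complexity: $n^{\rm ABS}(\varepsilon,d;\Lambda)=\min\{n\ge0:\ e^{\rm avg}(n,d;\Lambda)\le\varepsilon\}$.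 ALG-WT for $\Lambda$: $\lim_{\varepsilon^{-1}+d\to\infty}\frac{\ln n^{\rm ABS}(\varepsilon,d;\Lambda)}{\varepsilon^{-1}+d}=0$, where the limit means: for every $\eta>0$ there is $M$ such that the quotient is $<\eta$ for all $d\in\mathbb N$, $\varepsilon\in(0,1)$ with $\varepsilon^{-1}+d>M$ (with the convention $\ln 0:=-\infty$ or $0$). *)

theory Defs
  imports "HOL-Probability.Probability"
begin

(* Points of R^d are represented as extensional functions nat => real on {..<d};
   functions on D_d are represented as functions (nat => real) => real that vanish
   outside D_d.  F_d is given by its carrier F d (a set of such functions) and its
   norm nF d. *)

type_synonym pt = "nat \<Rightarrow> real"
type_synonym fn = "pt \<Rightarrow> real"

definition borelR :: "nat \<Rightarrow> pt measure" where
  "borelR d = (\<Pi>\<^sub>M i\<in>{..<d}. (borel :: real measure))"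

definition lborelR :: "nat \<Rightarrow> pt measure" where
  "lborelR d = (\<Pi>\<^sub>M i\<in>{..<d}. lborel)"

definition lebR :: "nat \<Rightarrow> pt measure" where
  "lebR d = completion (lborelR d)"

definition Gnorm2 :: "(nat \<Rightarrow> pt set) \<Rightarrow> (nat \<Rightarrow> pt \<Rightarrow> real) \<Rightarrow> nat \<Rightarrow> fn \<Rightarrow> ennreal" where
  "Gnorm2 D \<rho> d g = (\<integral>\<^sup>+ x \<in> D d. ennreal ((g x)\<^sup>2 * \<rho> d x) \<partial>lebR d)"

definition Gspace :: "(nat \<Rightarrow> pt set) \<Rightarrow> (nat \<Rightarrow> pt \<Rightarrow> real) \<Rightarrow> nat \<Rightarrow> fn set" where
  "Gspace D \<rho> d = {g. g \<in> borel_measurable (lebR d) \<and> Gnorm2 D \<rho> d g < \<infinity>}"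

definition Fopen :: "(nat \<Rightarrow> fn set) \<Rightarrow> (nat \<Rightarrow> fn \<Rightarrow> real) \<Rightarrow> nat \<Rightarrow> fn set \<Rightarrow> bool" where
  "Fopen F nF d U \<longleftrightarrow> U \<subseteq> F d \<and>
     (\<forall>f\<in>U. \<exists>e>0. \<forall>g\<in>F d. nF d (\<lambda>x. g x - f x) < e \<longrightarrow> g \<in> U)"

definition Lall :: "(nat \<Rightarrow> fn set) \<Rightarrow> (nat \<Rightarrow> fn \<Rightarrow> real) \<Rightarrow> nat \<Rightarrow> (fn \<Rightarrow> real) set" where
  "Lall F nF d = {L. (\<forall>f\<in>F d. \<forall>g\<in>F d. \<forall>a b. L (\<lambda>x. a * f x + b * g x) = a * L f + b * L g)
                   \<and> (\<exists>C. \<forall>f\<in>F d. \<bar>L f\<bar> \<le> C * nF d f)}"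

definition Lstd :: "(nat \<Rightarrow> pt set) \<Rightarrow> nat \<Rightarrow> (fn \<Rightarrow> real) set" where
  "Lstd D d = {L. \<exists>x\<in>D d. L = (\<lambda>f. f x)}"

definition avg_setting_d ::
  "(nat \<Rightarrow> pt set) \<Rightarrow> (nat \<Rightarrow> pt \<Rightarrow> real) \<Rightarrow> (nat \<Rightarrow> fn set) \<Rightarrow> (nat \<Rightarrow> fn \<Rightarrow> real)
   \<Rightarrow> (nat \<Rightarrow> fn measure) \<Rightarrow> nat \<Rightarrow> bool" where
  "avg_setting_d D \<rho> F nF \<mu> d \<longleftrightarrow>
    \<comment> \<open>D_d: Borel subset of R^d of positive Lebesgue measure\<close>
    D d \<in> sets (borelR d) \<and> emeasure (lborelR d) (D d) > 0 \<and>
    \<comment> \<open>rho_d: probability density on D_d\<close>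
    \<rho> d \<in> borel_measurable (lebR d) \<and> (\<forall>x\<in>D d. \<rho> d x \<ge> 0) \<and>
    (\<integral>\<^sup>+ x \<in> D d. ennreal (\<rho> d x) \<partial>lebR d) = 1 \<and>
    \<comment> \<open>F_d: real vector space of functions on D_d\<close>
    (\<forall>f\<in>F d. \<forall>x. x \<notin> D d \<longrightarrow> f x = 0) \<and>
    (\<lambda>x. 0) \<in> F d \<and>
    (\<forall>f\<in>F d. \<forall>g\<in>F d. \<forall>a b. (\<lambda>x. a * f x + b * g x) \<in> F d) \<and>
    \<comment> \<open>nF d is a norm on F_d\<close>
    (\<forall>f\<in>F d. nF d f \<ge> 0 \<and> (nF d f = 0 \<longleftrightarrow> f = (\<lambda>x. 0))) \<and>
    (\<forall>f\<in>F d. \<forall>a. nF d (\<lambda>x. a * f x) = \<bar>a\<bar> * nF d f) \<and>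
    (\<forall>f\<in>F d. \<forall>g\<in>F d. nF d (\<lambda>x. f x + g x) \<le> nF d f + nF d g) \<and>
    \<comment> \<open>complete (Banach)\<close>
    (\<forall>s::nat \<Rightarrow> fn. (\<forall>k. s k \<in> F d) \<longrightarrow>
        (\<forall>e>0. \<exists>N. \<forall>m\<ge>N. \<forall>k\<ge>N. nF d (\<lambda>x. s m x - s k x) < e) \<longrightarrow>
        (\<exists>f\<in>F d. \<forall>e>0. \<exists>N. \<forall>k\<ge>N. nF d (\<lambda>x. s k x - f x) < e)) \<and>
    \<comment> \<open>separable\<close>
    (\<exists>S. countable S \<and> S \<subseteq> F d \<and> (\<forall>f\<in>F d. \<forall>e>0. \<exists>s\<in>S. nF d (\<lambda>x. f x - s x) < e)) \<and>
    \<comment> \<open>continuously embedded in G_d\<close>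
    F d \<subseteq> Gspace D \<rho> d \<and>
    (\<exists>C::real. \<forall>f\<in>F d. Gnorm2 D \<rho> d f \<le> ennreal ((C * nF d f)\<^sup>2)) \<and>
    \<comment> \<open>point evaluations are continuous\<close>
    (\<forall>x\<in>D d. \<exists>C. \<forall>f\<in>F d. \<bar>f x\<bar> \<le> C * nF d f) \<and>
    \<comment> \<open>mu_d: zero-mean Gaussian (Borel probability) measure on F_d\<close>
    prob_space (\<mu> d) \<and> space (\<mu> d) = F d \<and>
    sets (\<mu> d) = sets (sigma (F d) {U. Fopen F nF d U}) \<and>
    (\<forall>L\<in>Lall F nF d. distr (\<mu> d) borel L = return borel 0 \<or>
        (\<exists>\<sigma>>0. distr (\<mu> d) borel L = density lborel (normal_density 0 \<sigma>)))"

definition avg_setting where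
  "avg_setting D \<rho> F nF \<mu> \<longleftrightarrow> (\<forall>d\<ge>1. avg_setting_d D \<rho> F nF \<mu> d)"

definition err2 ::
  "(nat \<Rightarrow> pt set) \<Rightarrow> (nat \<Rightarrow> pt \<Rightarrow> real) \<Rightarrow> (nat \<Rightarrow> fn measure) \<Rightarrow> nat \<Rightarrow> nat
   \<Rightarrow> (nat \<Rightarrow> fn \<Rightarrow> real) \<Rightarrow> (pt \<Rightarrow> fn) \<Rightarrow> ennreal" where
  "err2 D \<rho> \<mu> d n L \<phi> =
     (\<integral>\<^sup>+ f. Gnorm2 D \<rho> d (\<lambda>x. f x - \<phi> (restrict (\<lambda>i. L i f) {..<n}) x) \<partial>\<mu> d)"

text \<open>Admissible algorithms using n functionals from the class Lam d; phi is a
  Borel measurable map from R^n into G_d (G_d is separable, so measurability is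
  equivalent to measurability of preimages of open balls). For n = 0 only A = 0.\<close>
definition algs ::
  "(nat \<Rightarrow> pt set) \<Rightarrow> (nat \<Rightarrow> pt \<Rightarrow> real) \<Rightarrow> (nat \<Rightarrow> (fn \<Rightarrow> real) set) \<Rightarrow> nat \<Rightarrow> nat
   \<Rightarrow> ((nat \<Rightarrow> fn \<Rightarrow> real) \<times> (pt \<Rightarrow> fn)) set" where
  "algs D \<rho> Lam d n = {(L, \<phi>).
      (\<forall>i<n. L i \<in> Lam d) \<and>
      (\<forall>y. \<phi> y \<in> Gspace D \<rho> d) \<and>
      (\<forall>g\<in>Gspace D \<rho> d. \<forall>r. {y \<in> space (borelR n). Gnorm2 D \<rho> d (\<lambda>x. \<phi> y x - g x) < r}
           \<in> sets (borelR n)) \<and>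
      (n = 0 \<longrightarrow> (\<forall>y. \<phi> y = (\<lambda>x. 0)))}"

definition eavg2 where
  "eavg2 D \<rho> \<mu> Lam n d = (INF A \<in> algs D \<rho> Lam d n. err2 D \<rho> \<mu> d n (fst A) (snd A))"

text \<open>Information complexity (infinity if no n achieves error eps).
  e <= eps is expressed as e^2 <= eps^2 (both nonnegative).\<close>
definition nABS where
  "nABS D \<rho> \<mu> Lam \<epsilon> d = (Inf {n::enat. \<exists>m. n = enat m \<and> eavg2 D \<rho> \<mu> Lam m d \<le> ennreal (\<epsilon>\<^sup>2)})"

definition ALG_WT where
  "ALG_WT D \<rho> \<mu> Lam \<longleftrightarrow>
     (\<forall>\<eta>>0. \<exists>M. \<forall>d\<ge>1. \<forall>\<epsilon>::real. 0 < \<epsilon> \<and> \<epsilon> < 1 \<and> 1/\<epsilon> + real d > M \<longrightarrow>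
        nABS D \<rho> \<mu> Lam \<epsilon> d \<noteq> \<infinity> \<and>
        ln (real (the_enat (nABS D \<rho> \<mu> Lam \<epsilon> d))) / (1/\<epsilon> + real d) < \<eta>)"

end

theory Submission
  imports Defs
begin

text \<open>
  Only the implication from \<open>\<Lambda>\<^sup>a\<^sup>l\<^sup>l\<close> to \<open>\<Lambda>\<^sup>s\<^sup>t\<^sup>d\<close> needs work; it follows from a comparison that loses
  a polynomial factor in \<open>n\<close> and a constant factor in \<open>\<epsilon>\<close>, namely
  \<open>n\<^sup>s\<^sup>t\<^sup>d(\<epsilon>, d) \<le> 8 * (n\<^sup>a\<^sup>l\<^sup>l(\<epsilon>/4, d))\<^sup>2\<close>.

  Since \<open>\<mu>\<close> is Gaussian, conditional expectations given \<open>L\<^sub>1(f), \<dots>, L\<^sub>n(f)\<close> are linear in these values. An algorithm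
  with error \<open>e\<close> therefore yields, for every \<open>\<delta> > 0\<close>, a subspace \<open>W\<close> of \<open>G\<close> of dimension \<open>m \<le> n\<close> with mean
  squared distance of \<open>f\<close> to \<open>W\<close> at most \<open>e\<^sup>2 + \<delta>\<close>. The mean of \<open>\<parallel>f\<parallel>\<^sup>2\<close> is finite by a Paley--Zygmund
  argument, so it suffices to test against finitely many functionals \<open>f \<mapsto> \<langle>f, u\<^sub>k\<rangle>\<close> at a time.

  Weighted least squares onto \<open>W\<close> from \<open>N \<ge> 8m\<^sup>2\<close> function values has mean squared error at most
  five times that of the orthogonal projection, for suitable points. With sampling density
  \<open>\<omega> = (w\<^sub>1\<^sup>2 + \<dots> + w\<^sub>m\<^sup>2)/m\<close> relative to \<open>\<rho> dx\<close>, the squared Frobenius distance of the empirical Gram matrix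
  to the identity has expectation at most \<open>m\<^sup>2/N\<close>, so no matrix concentration inequality is needed.
\<close>

text \<open>The sample points must satisfy two demands at once: a well conditioned Gram matrix, and
  residuals that are small at the points for the average \<open>f\<close>. Averaging over
  \<open>f\<close> first turns the second demand into one on a function \<open>\<Gamma>\<close> of
  the point alone. Both demands then form a single functional of the points, which a greedy choice
  keeps below \<open>2 * N\<close>. The constants follow. The squared Gram deviation is at most
  \<open>m^2 * 2 * N\<close> and must not exceed \<open>(N/2)^2\<close>, hence
  \<open>N \<ge> 8 * m^2\<close>. Least squares amplifies squared data errors by at most
  \<open>2/N\<close>, and the weighted squared residuals at the points average to a total of at most
  \<open>2 * N * B\<close>, so a projection error \<open>B\<close> becomes at most
  \<open>B + 4 * B\<close>.

  The setting gives the law of each single functional, but no joint laws and no moment of the norm.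
  Everything joint is therefore extracted from the laws of linear combinations.

  The losses vanish in the limit: squaring \<open>n\<close> doubles its logarithm, and passing to a
  quarter of \<epsilon> multiplies the denominator by at most 4.\<close>

section \<open>Square integrable functions\<close>

text \<open>Functions, not classes modulo null sets. Hence \<open>ip\<close> is only positive
  semidefinite, and a function of norm zero need not be zero.\<close>

definition sq_int :: "'a measure \<Rightarrow> ('a \<Rightarrow> real) set" where
  "sq_int M = {f \<in> borel_measurable M. integrable M (\<lambda>x. (f x)\<^sup>2)}"

definition ip :: "'a measure \<Rightarrow> ('a \<Rightarrow> real) \<Rightarrow> ('a \<Rightarrow> real) \<Rightarrow> real" where
  "ip M f g = (\<integral>x. f x * g x \<partial>M)"

text \<open>One predicate covers spaces of functions on \<open>D d\<close> and spaces of functionals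
  on \<open>F d\<close>, since both consist of real functions; orthonormalization is applied to both
  kinds.\<close>

definition lin_closed :: "('a \<Rightarrow> real) set \<Rightarrow> bool" where
  "lin_closed H \<longleftrightarrow> (\<lambda>x. 0) \<in> H \<and> (\<forall>f\<in>H. \<forall>g\<in>H. \<forall>a b. (\<lambda>x. a * f x + b * g x) \<in> H)"

definition orthonormal :: "'a measure \<Rightarrow> (nat \<Rightarrow> 'a \<Rightarrow> real) \<Rightarrow> nat \<Rightarrow> bool" where
  "orthonormal M u m \<longleftrightarrow> (\<forall>j<m. u j \<in> sq_int M) \<and>
     (\<forall>j<m. \<forall>k<m. ip M (u j) (u k) = (if j = k then 1 else 0))"

lemma sq_int_measurable: "f \<in> sq_int M \<Longrightarrow> f \<in> borel_measurable M"
  by (simp add: sq_int_def)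

lemma sq_int_square: "f \<in> sq_int M \<Longrightarrow> integrable M (\<lambda>x. (f x)\<^sup>2)"
  by (simp add: sq_int_def)

lemma lin_closed_scale: "lin_closed H \<Longrightarrow> f \<in> H \<Longrightarrow> (\<lambda>x. a * f x) \<in> H"
  unfolding lin_closed_def by (drule conjunct2) (drule (1) bspec, drule (1) bspec, drule spec[of _ a], drule spec[of _ 0], simp)

lemma lin_closed_add: "lin_closed H \<Longrightarrow> f \<in> H \<Longrightarrow> g \<in> H \<Longrightarrow> (\<lambda>x. f x + g x) \<in> H"
  unfolding lin_closed_def by (drule conjunct2) (drule bspec[of _ _ f], assumption, drule bspec[of _ _ g], assumption, drule spec[of _ 1], drule spec[of _ 1], simp)

lemma lin_closed_diff: "lin_closed H \<Longrightarrow> f \<in> H \<Longrightarrow> g \<in> H \<Longrightarrow> (\<lambda>x. f x - g x) \<in> H"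
  unfolding lin_closed_def by (drule conjunct2) (drule bspec[of _ _ f], assumption, drule bspec[of _ _ g], assumption, drule spec[of _ 1], drule spec[of _ "-1"], simp)

lemma lin_closed_sum:
  assumes "lin_closed H" "finite I" "\<And>i. i \<in> I \<Longrightarrow> u i \<in> H"
  shows "(\<lambda>x. \<Sum>i\<in>I. c i * u i x) \<in> H"
  using assms(2,3)
proof (induction I rule: finite_induct)
  case empty
  then show ?case using assms(1) by (simp add: lin_closed_def)
next
  case (insert i I)
  have "(\<lambda>x. c i * u i x + (\<Sum>i\<in>I. c i * u i x)) \<in> H"
    by (intro lin_closed_add lin_closed_scale assms(1)) (use insert in auto)
  then show ?case using insert by simp
qed

lemma sq_int_mult:
  assumes "f \<in> sq_int M" "g \<in> sq_int M"
  shows "integrable M (\<lambda>x. f x * g x)"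
proof (rule Bochner_Integration.integrable_bound)
  show "integrable M (\<lambda>x. (f x)\<^sup>2 + (g x)\<^sup>2)"
    using assms by (auto simp: sq_int_def)
  show "(\<lambda>x. f x * g x) \<in> borel_measurable M"
    using assms by (auto simp: sq_int_def)
  have "\<bar>a * b\<bar> \<le> a\<^sup>2 + b\<^sup>2" for a b :: real
  proof -
    have "2 * (\<bar>a\<bar> * \<bar>b\<bar>) \<le> a\<^sup>2 + b\<^sup>2"
      using sum_squares_bound[of "\<bar>a\<bar>" "\<bar>b\<bar>"] by (simp add: mult.assoc)
    moreover have "0 \<le> \<bar>a\<bar> * \<bar>b\<bar>" by simp
    ultimately show ?thesis unfolding abs_mult by linarith
  qed
  then show "AE x in M. norm (f x * g x) \<le> norm ((f x)\<^sup>2 + (g x)\<^sup>2)"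
    by simp
qed

lemma lin_closed_sq_int: "lin_closed (sq_int M)"
  unfolding lin_closed_def
proof (intro conjI ballI allI)
  show "(\<lambda>x. 0) \<in> sq_int M" by (simp add: sq_int_def)
  fix f g :: "'a \<Rightarrow> real" and a b :: real
  assume f: "f \<in> sq_int M" and g: "g \<in> sq_int M"
  have *: "(a * f x + b * g x)\<^sup>2 = a\<^sup>2 * (f x)\<^sup>2 + 2 * a * b * (f x * g x) + b\<^sup>2 * (g x)\<^sup>2" for x
    by (simp add: power2_eq_square algebra_simps)
  show "(\<lambda>x. a * f x + b * g x) \<in> sq_int M"
    using sq_int_mult[OF f g] f g unfolding sq_int_def mem_Collect_eq *
    by (intro conjI borel_measurable_add borel_measurable_times Bochner_Integration.integrable_add
          integrable_mult_right) auto
qed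

lemmas sq_int_sum = lin_closed_sum[OF lin_closed_sq_int]
lemmas sq_int_diff = lin_closed_diff[OF lin_closed_sq_int]
lemmas sq_int_scale = lin_closed_scale[OF lin_closed_sq_int]

lemma ip_commute: "ip M f g = ip M g f"
  by (simp add: ip_def mult.commute)

lemma ip_self: "ip M f f = (\<integral>x. (f x)\<^sup>2 \<partial>M)"
  by (simp add: ip_def power2_eq_square)

lemma ip_nonneg: "0 \<le> ip M f f"
  by (simp add: ip_self)

lemma ip_lin:
  assumes "f \<in> sq_int M" "g \<in> sq_int M" "h \<in> sq_int M"
  shows "ip M (\<lambda>x. a * f x + b * g x) h = a * ip M f h + b * ip M g h"
proof -
  have "ip M (\<lambda>x. a * f x + b * g x) h = (\<integral>x. a * (f x * h x) + b * (g x * h x) \<partial>M)"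
    by (simp add: ip_def algebra_simps)
  also have "\<dots> = a * ip M f h + b * ip M g h"
    using sq_int_mult[OF assms(1,3)] sq_int_mult[OF assms(2,3)]
    by (simp add: ip_def)
  finally show ?thesis .
qed

lemma ip_diff:
  assumes "f \<in> sq_int M" "g \<in> sq_int M" "h \<in> sq_int M"
  shows "ip M (\<lambda>x. f x - g x) h = ip M f h - ip M g h"
  using ip_lin[OF assms, of 1 "-1"] by simp

lemma ip_scale: "ip M (\<lambda>x. a * f x) h = a * ip M f h"
  by (simp add: ip_def mult.assoc)

lemma ip_sum:
  assumes "\<And>i. i \<in> I \<Longrightarrow> u i \<in> sq_int M" "h \<in> sq_int M"
  shows "ip M (\<lambda>x. \<Sum>i\<in>I. c i * u i x) h = (\<Sum>i\<in>I. c i * ip M (u i) h)"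
proof -
  have "ip M (\<lambda>x. \<Sum>i\<in>I. c i * u i x) h = (\<integral>x. (\<Sum>i\<in>I. c i * (u i x * h x)) \<partial>M)"
    by (simp add: ip_def sum_distrib_right mult.assoc)
  also have "\<dots> = (\<Sum>i\<in>I. (\<integral>x. c i * (u i x * h x) \<partial>M))"
    by (rule Bochner_Integration.integral_sum)
      (use sq_int_mult[OF assms(1) assms(2)] in auto)
  finally show ?thesis by (simp add: ip_def)
qed

lemma ip_Cauchy_Schwarz:
  assumes f: "f \<in> sq_int M" and g: "g \<in> sq_int M"
  shows "(ip M f g)\<^sup>2 \<le> ip M f f * ip M g g"
proof -
  have q: "0 \<le> t\<^sup>2 * ip M f f + 2 * t * s * ip M f g + s\<^sup>2 * ip M g g" for t s
  proof -
    have S: "(\<lambda>x. t * f x + s * g x) \<in> sq_int M"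
      using lin_closed_sq_int f g unfolding lin_closed_def by blast
    have "0 \<le> ip M (\<lambda>x. t * f x + s * g x) (\<lambda>x. t * f x + s * g x)"
      by (rule ip_nonneg)
    also have "\<dots> = t * ip M (\<lambda>x. t * f x + s * g x) f + s * ip M (\<lambda>x. t * f x + s * g x) g"
      by (subst ip_lin[OF f g S]) (simp add: ip_commute)
    also have "\<dots> = t\<^sup>2 * ip M f f + 2 * t * s * ip M f g + s\<^sup>2 * ip M g g"
      unfolding ip_lin[OF f g f] ip_lin[OF f g g] ip_commute[of M g f]
      by (simp add: power2_eq_square algebra_simps)
    finally show ?thesis .
  qed
  show ?thesis
  proof (cases "ip M g g = 0")
    case True
    have "ip M f g = 0"
    proof (rule ccontr)
      assume n: "ip M f g \<noteq> 0"
      \<comment> \<open>When \<open>ip M g g = 0\<close> the quadratic form at \<open>t = 1\<close>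
        is affine in \<open>s\<close>; this \<open>s\<close> gives it the value -1.\<close>
      define s where "s = - (ip M f f + 1) / (2 * ip M f g)"
      have "2 * s * ip M f g = - (ip M f f + 1)" using n by (simp add: s_def)
      moreover have "0 \<le> ip M f f + 2 * s * ip M f g" using q[of 1 s] True by simp
      ultimately show False by linarith
    qed
    then show ?thesis using True by simp
  next
    case False
    then have p: "ip M g g > 0" using ip_nonneg[of M g] by linarith
    \<comment> \<open>Up to scaling, this is the minimizer of the quadratic form.\<close>
    from q[of "ip M g g" "- ip M f g"]
    have "0 \<le> ip M g g * (ip M f f * ip M g g - (ip M f g)\<^sup>2)"
      by (simp add: power2_eq_square algebra_simps)
    then show ?thesis using p by (simp add: zero_le_mult_iff)
  qed
qed

text \<open>Pythagoras for arbitrary coefficients: the error splits into the squared distance to the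
  span and the squared error of the coefficients. The exact coefficients
  \<open>c k = ip M f (u k)\<close> yield Bessel's inequality; in \<open>sampling\<close> the
  \<open>c k\<close> are computed from function values.\<close>

lemma orthonormal_dist:
  assumes u: "orthonormal M u m" and f: "f \<in> sq_int M"
  shows "ip M (\<lambda>x. f x - (\<Sum>k<m. c k * u k x)) (\<lambda>x. f x - (\<Sum>k<m. c k * u k x))
     = ip M f f - (\<Sum>k<m. (ip M f (u k))\<^sup>2) + (\<Sum>k<m. (ip M f (u k) - c k)\<^sup>2)"
proof -
  let ?s = "\<lambda>x. \<Sum>k<m. c k * u k x"
  have uk: "\<And>k. k < m \<Longrightarrow> u k \<in> sq_int M" using u by (simp add: orthonormal_def)
  have s: "?s \<in> sq_int M" by (rule sq_int_sum) (use uk in auto)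
  have fs: "ip M f ?s = (\<Sum>k<m. c k * ip M f (u k))"
    by (subst ip_commute, subst ip_sum) (use uk f in \<open>auto simp: ip_commute\<close>)
  have us: "ip M (u k) ?s = c k" if "k < m" for k
  proof -
    have "ip M (u k) ?s = (\<Sum>j<m. c j * ip M (u j) (u k))"
      by (subst ip_commute, subst ip_sum) (use uk that in auto)
    also have "\<dots> = (\<Sum>j<m. if j = k then c j else 0)"
      using u that by (intro sum.cong) (auto simp: orthonormal_def)
    finally show ?thesis using that by simp
  qed
  have ss: "ip M ?s ?s = (\<Sum>k<m. (c k)\<^sup>2)"
    by (subst ip_sum) (use uk s us in \<open>auto simp: power2_eq_square\<close>)
  have "ip M (\<lambda>x. f x - ?s x) (\<lambda>x. f x - ?s x) = ip M f f - 2 * ip M f ?s + ip M ?s ?s"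
    using ip_diff[OF f s sq_int_diff[OF f s]] ip_diff[OF f s f] ip_diff[OF f s s]
    by (simp add: ip_commute)
  also have "\<dots> = ip M f f - (\<Sum>k<m. (ip M f (u k))\<^sup>2) + (\<Sum>k<m. (ip M f (u k) - c k)\<^sup>2)"
    by (simp add: fs ss power2_diff sum.distrib sum_subtractf sum_distrib_left algebra_simps)
  finally show ?thesis .
qed

lemma orthonormal_Bessel:
  assumes "orthonormal M u m" "f \<in> sq_int M"
  shows "(\<Sum>k<m. (ip M f (u k))\<^sup>2) \<le> ip M f f"
  using orthonormal_dist[OF assms, of "\<lambda>k. ip M f (u k)"]
    ip_nonneg[of M "\<lambda>x. f x - (\<Sum>k<m. ip M f (u k) * u k x)"] by simp

lemma orthonormal_residual:
  assumes u: "orthonormal M u m" and f: "f \<in> sq_int M" and k: "k < m"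
  shows "ip M (\<lambda>x. f x - (\<Sum>k<m. ip M f (u k) * u k x)) (u k) = 0"
proof -
  have uk: "\<And>k. k < m \<Longrightarrow> u k \<in> sq_int M" using u by (simp add: orthonormal_def)
  have "ip M (\<lambda>x. \<Sum>k<m. ip M f (u k) * u k x) (u k) = (\<Sum>j<m. ip M f (u j) * ip M (u j) (u k))"
    by (subst ip_sum) (use uk k in auto)
  also have "\<dots> = (\<Sum>j<m. if j = k then ip M f (u j) else 0)"
    using u k by (intro sum.cong) (auto simp: orthonormal_def)
  also have "\<dots> = ip M f (u k)" using k by simp
  finally show ?thesis
    by (subst ip_diff) (use uk k f in \<open>auto intro!: sq_int_sum\<close>)
qed

text \<open>Gram-Schmidt, dropping vectors whose residual has norm zero. That the \<open>u k\<close>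
  span the \<open>v i\<close> is expressed by duality, because a dropped \<open>v i\<close> equals a
  combination of the \<open>u k\<close> only up to a function of norm zero.\<close>

lemma orthonormalize:
  assumes H: "lin_closed H" "H \<subseteq> sq_int M" and v: "\<And>i. i < n \<Longrightarrow> v i \<in> H"
  obtains m u where "m \<le> n" "orthonormal M u m" "\<And>k. k < m \<Longrightarrow> u k \<in> H"
    "\<And>g i. g \<in> sq_int M \<Longrightarrow> (\<And>k. k < m \<Longrightarrow> ip M g (u k) = 0) \<Longrightarrow> i < n \<Longrightarrow> ip M g (v i) = 0"
proof -
  have "\<exists>m u. m \<le> n \<and> orthonormal M u m \<and> (\<forall>k<m. u k \<in> H) \<and>
    (\<forall>g\<in>sq_int M. (\<forall>k<m. ip M g (u k) = 0) \<longrightarrow> (\<forall>i<n. ip M g (v i) = 0))"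
    using v
  proof (induction n)
    case 0
    show ?case by (rule exI[of _ 0]) (simp add: orthonormal_def)
  next
    case (Suc n)
    from Suc.IH Suc.prems obtain m u where m: "m \<le> n" and u: "orthonormal M u m"
      and uH: "\<forall>k<m. u k \<in> H"
      and sp: "\<forall>g\<in>sq_int M. (\<forall>k<m. ip M g (u k) = 0) \<longrightarrow> (\<forall>i<n. ip M g (v i) = 0)"
      by (metis less_SucI)
    have vn: "v n \<in> H" using Suc.prems by simp
    then have vn2: "v n \<in> sq_int M" using H by auto
    define q where "q = (\<lambda>x. \<Sum>k<m. ip M (v n) (u k) * u k x)"
    define p where "p = (\<lambda>x. v n x - q x)"
    have qH: "q \<in> H" unfolding q_def by (rule lin_closed_sum[OF H(1)]) (use uH in auto)
    have pH: "p \<in> H" unfolding p_def by (rule lin_closed_diff[OF H(1) vn qH])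
    have p2: "p \<in> sq_int M" and q2: "q \<in> sq_int M" using pH qH H by auto
    have gv: "ip M g (v n) = ip M g p" if g: "g \<in> sq_int M" "\<forall>k<m. ip M g (u k) = 0" for g
    proof -
      have "ip M q g = 0" unfolding q_def
        by (subst ip_sum) (use u g in \<open>auto simp: orthonormal_def ip_commute\<close>)
      then show ?thesis using ip_diff[OF vn2 q2 g(1)] by (simp add: p_def ip_commute)
    qed
    show ?case
    proof (cases "ip M p p = 0")
      \<comment> \<open>A residual of norm zero is orthogonal to everything by Cauchy-Schwarz, so
        the old system still serves.\<close>
      case True
      have "ip M g (v i) = 0" if g: "g \<in> sq_int M" "\<forall>k<m. ip M g (u k) = 0" "i < Suc n" for g i
      proof (cases "i = n")
        case True
        have "ip M g p = 0"
          using ip_Cauchy_Schwarz[OF g(1) p2] \<open>ip M p p = 0\<close> by simp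
        then show ?thesis using gv g True by simp
      next
        case False
        then show ?thesis using sp g by simp
      qed
      then show ?thesis using m u uH by (intro exI[of _ m] exI[of _ u]) auto
    next
      case False
      define c where "c = sqrt (ip M p p)"
      have c: "c > 0" "c * c = ip M p p"
        using False ip_nonneg[of M p] by (auto simp: c_def)
      define u' where "u' = u(m := (\<lambda>x. inverse c * p x))"
      have pu: "ip M p (u k) = 0" if "k < m" for k
        unfolding p_def q_def by (rule orthonormal_residual[OF u vn2 that])
      have u'H: "u' k \<in> H" if "k < Suc m" for k
        using that uH lin_closed_scale[OF H(1) pH] by (auto simp: u'_def less_Suc_eq)
      have "ip M (u' m) (u' m) = 1"
        using c by (simp add: u'_def ip_scale ip_commute[of M p "\<lambda>x. inverse c * p x"])
          (use c False in \<open>simp add: field_simps\<close>)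
      moreover have "ip M (u' m) (u' k) = 0" if "k < m" for k
        using that pu by (simp add: u'_def ip_scale)
      moreover have "ip M (u' k) (u' m) = 0" if "k < m" for k
        using calculation(2)[OF that] by (simp add: ip_commute)
      moreover have "u' k = u k" if "k < m" for k using that by (simp add: u'_def)
      ultimately have on: "orthonormal M u' (Suc m)"
        using u u'H H(2) unfolding orthonormal_def less_Suc_eq by auto
      have "ip M g (v i) = 0" if g: "g \<in> sq_int M" "\<forall>k<Suc m. ip M g (u' k) = 0" "i < Suc n" for g i
      proof -
        have gu: "\<forall>k<m. ip M g (u k) = 0"
        proof (intro allI impI)
          fix k assume "k < m"
          then show "ip M g (u k) = 0" using g(2)[rule_format, of k] by (simp add: u'_def)
        qed
        have "ip M g (u' m) = 0" using g(2) by simp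
        then have "ip M g p = 0"
          using c(1) by (simp add: u'_def ip_commute[of M g] ip_scale)
        then show ?thesis using gv[OF g(1) gu] sp g gu by (cases "i = n") auto
      qed
      then show ?thesis using m on u'H by (intro exI[of _ "Suc m"] exI[of _ u']) auto
    qed
  qed
  then show ?thesis using that by blast
qed

text \<open>The residual \<open>p\<close> of the projection onto the \<open>u k\<close> is
  orthogonal to the \<open>u k\<close> and, by \<open>sp\<close>, to the \<open>v i\<close>. Any
  competitor \<open>w\<close> therefore has error \<open>p + r\<close> with \<open>r\<close>
  orthogonal to \<open>p\<close>.\<close>

lemma orthonormal_best_approx:
  assumes u: "orthonormal M u m" and f: "f \<in> sq_int M"
    and v: "\<And>i. i \<in> I \<Longrightarrow> v i \<in> sq_int M" "finite I"
    and sp: "\<And>g i. g \<in> sq_int M \<Longrightarrow> (\<And>k. k < m \<Longrightarrow> ip M g (u k) = 0) \<Longrightarrow> i \<in> I \<Longrightarrow> ip M g (v i) = 0"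
  shows "ip M f f - (\<Sum>k<m. (ip M f (u k))\<^sup>2)
    \<le> ip M (\<lambda>x. f x - (\<Sum>i\<in>I. c i * v i x)) (\<lambda>x. f x - (\<Sum>i\<in>I. c i * v i x))"
proof -
  have uk: "\<And>k. k < m \<Longrightarrow> u k \<in> sq_int M" using u by (simp add: orthonormal_def)
  define q where "q = (\<lambda>x. \<Sum>k<m. ip M f (u k) * u k x)"
  define p where "p = (\<lambda>x. f x - q x)"
  define w where "w = (\<lambda>x. \<Sum>i\<in>I. c i * v i x)"
  have q2: "q \<in> sq_int M" unfolding q_def by (rule sq_int_sum) (use uk in auto)
  have p2: "p \<in> sq_int M" unfolding p_def by (rule sq_int_diff[OF f q2])
  have w2: "w \<in> sq_int M" unfolding w_def by (rule sq_int_sum) (use v in auto)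
  have pu: "ip M p (u k) = 0" if "k < m" for k
    unfolding p_def q_def by (rule orthonormal_residual[OF u f that])
  have pw: "ip M w p = 0" unfolding w_def
    by (subst ip_sum) (use v p2 sp[OF p2 pu] in \<open>auto simp: ip_commute\<close>)
  have pq: "ip M q p = 0" unfolding q_def
    by (subst ip_sum) (use uk p2 pu in \<open>auto simp: ip_commute\<close>)
  define r where "r = (\<lambda>x. q x - w x)"
  have r2: "r \<in> sq_int M" unfolding r_def by (rule sq_int_diff[OF q2 w2])
  have pr: "ip M r p = 0" unfolding r_def using ip_diff[OF q2 w2 p2] pq pw by simp
  have s2: "(\<lambda>x. 1 * p x + 1 * r x) \<in> sq_int M"
    using lin_closed_sq_int p2 r2 unfolding lin_closed_def by blast
  have "ip M (\<lambda>x. f x - w x) (\<lambda>x. f x - w x) = ip M (\<lambda>x. 1 * p x + 1 * r x) (\<lambda>x. 1 * p x + 1 * r x)"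
    by (simp add: p_def r_def)
  also have "\<dots> = ip M p p + ip M r r"
    by (subst ip_lin[OF p2 r2 s2])
      (simp only: ip_commute[of M _ "\<lambda>x. 1 * p x + 1 * r x"] ip_lin[OF p2 r2 p2] ip_lin[OF p2 r2 r2] pr ip_commute[of M p r], simp)
  finally show ?thesis
    using orthonormal_dist[OF u f, of "\<lambda>k. ip M f (u k)"] ip_nonneg[of M r]
    by (simp add: p_def q_def w_def)
qed

text \<open>The measurability condition in \<open>algs\<close> speaks about distances only. This
  recovers inner products from the distances to \<open>q\<close> and to \<open>- q\<close>, hence
  the shape of the first term.\<close>

lemma ip_polarization:
  assumes p: "p \<in> sq_int M" and q: "q \<in> sq_int M"
  shows "ip M p q = (ip M (\<lambda>x. p x - (- q x)) (\<lambda>x. p x - (- q x)) - ip M (\<lambda>x. p x - q x) (\<lambda>x. p x - q x)) / 4"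
proof -
  have pq: "integrable M (\<lambda>x. p x * q x)" by (rule sq_int_mult[OF p q])
  have "ip M (\<lambda>x. p x - (- q x)) (\<lambda>x. p x - (- q x)) = (\<integral>x. (p x)\<^sup>2 + 2 * (p x * q x) + (q x)\<^sup>2 \<partial>M)"
    unfolding ip_self by (intro Bochner_Integration.integral_cong) (auto simp: power2_eq_square algebra_simps)
  moreover have "ip M (\<lambda>x. p x - q x) (\<lambda>x. p x - q x) = (\<integral>x. (p x)\<^sup>2 - 2 * (p x * q x) + (q x)\<^sup>2 \<partial>M)"
    unfolding ip_self by (intro Bochner_Integration.integral_cong) (auto simp: power2_eq_square algebra_simps)
  ultimately show ?thesis
    using pq sq_int_square[OF p] sq_int_square[OF q] by (simp add: ip_def)
qed

section \<open>Uniqueness of Fourier transforms\<close>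

text \<open>The positive and negative parts of \<open>W\<close> have equal mass \<open>c\<close>, by
  the hypothesis at \<open>t = 0\<close>. Normalized and pushed forward under \<open>X\<close>, they
  are probability measures with the same characteristic function, so Levy's uniqueness theorem
  applies.\<close>

lemma integral_trig_zero_imp_1d:
  fixes X W :: "'a \<Rightarrow> real"
  assumes X: "X \<in> borel_measurable M" and W: "integrable M W"
    and hyp: "\<And>t \<theta>. (\<integral>\<omega>. cos (t * X \<omega> + \<theta>) * W \<omega> \<partial>M) = 0"
    and B: "B \<in> sets borel"
  shows "(\<integral>\<omega>. indicator B (X \<omega>) * W \<omega> \<partial>M) = 0"
proof -
  note [measurable] = X borel_measurable_integrable[OF W] B
  define Wp where "Wp = (\<lambda>\<omega>. max 0 (W \<omega>))"
  define Wn where "Wn = (\<lambda>\<omega>. max 0 (- W \<omega>))"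
  have Wp: "integrable M Wp" unfolding Wp_def by (rule integrable_max) (use W in auto)
  have Wn: "integrable M Wn" unfolding Wn_def by (rule integrable_max) (use W in auto)
  note [measurable] = borel_measurable_integrable[OF Wp] borel_measurable_integrable[OF Wn]
  have WW: "W \<omega> = Wp \<omega> - Wn \<omega>" for \<omega> by (auto simp: Wp_def Wn_def)
  have Wp0: "0 \<le> Wp \<omega>" and Wn0: "0 \<le> Wn \<omega>" for \<omega> by (auto simp: Wp_def Wn_def)
  have bi: "integrable M (\<lambda>\<omega>. h (X \<omega>) * V \<omega>)"
    if h[measurable]: "h \<in> borel_measurable borel" and hb: "\<And>x. \<bar>h x\<bar> \<le> 1" and V: "integrable M V"
    for h :: "real \<Rightarrow> real" and V
  proof (rule Bochner_Integration.integrable_bound[OF V])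
    note [measurable] = borel_measurable_integrable[OF V]
    show "(\<lambda>\<omega>. h (X \<omega>) * V \<omega>) \<in> borel_measurable M" by measurable
    show "AE x in M. norm (h (X x) * V x) \<le> norm (V x)"
      using hb by (auto simp: abs_mult intro!: mult_left_le_one_le)
  qed
  have split: "(\<integral>\<omega>. h (X \<omega>) * W \<omega> \<partial>M) = (\<integral>\<omega>. h (X \<omega>) * Wp \<omega> \<partial>M) - (\<integral>\<omega>. h (X \<omega>) * Wn \<omega> \<partial>M)"
    if h: "h \<in> borel_measurable borel" and hb: "\<And>x. \<bar>h x\<bar> \<le> 1" for h :: "real \<Rightarrow> real"
    unfolding WW right_diff_distrib
    by (rule Bochner_Integration.integral_diff) (intro bi h hb Wp Wn)+
  define c where "c = (\<integral>\<omega>. Wp \<omega> \<partial>M)"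
  have cn: "(\<integral>\<omega>. Wn \<omega> \<partial>M) = c"
    using split[of "\<lambda>_. 1"] hyp[of 0 0] by (simp add: c_def)
  have c0: "c \<ge> 0" unfolding c_def using Wp0 by simp
  show ?thesis
  proof (cases "c = 0")
    case True
    have "AE \<omega> in M. Wp \<omega> = 0" "AE \<omega> in M. Wn \<omega> = 0"
      using integral_nonneg_eq_0_iff_AE[OF Wp] integral_nonneg_eq_0_iff_AE[OF Wn] Wp0 Wn0 True cn
      by (auto simp: c_def)
    then have "AE \<omega> in M. indicator B (X \<omega>) * W \<omega> = 0"
      by eventually_elim (simp add: WW)
    then show ?thesis by (simp add: integral_eq_zero_AE)
  next
    case False
    then have c: "c > 0" using c0 by simp
    define D where "D = (\<lambda>V. distr (density M (\<lambda>\<omega>. ennreal (V \<omega> / c))) borel X)"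
    have D_int: "(\<integral>x. h x \<partial>D V) = (\<integral>\<omega>. h (X \<omega>) * V \<omega> \<partial>M) / c"
      if h[measurable]: "h \<in> borel_measurable borel" and V[measurable]: "V \<in> borel_measurable M"
        and V0: "\<And>\<omega>. 0 \<le> V \<omega>"
      for h :: "real \<Rightarrow> real" and V
    proof -
      have "(\<integral>x. h x \<partial>D V) = (\<integral>\<omega>. h (X \<omega>) \<partial>density M (\<lambda>\<omega>. ennreal (V \<omega> / c)))"
        unfolding D_def by (rule integral_distr) auto
      also have "\<dots> = (\<integral>\<omega>. (V \<omega> / c) * h (X \<omega>) \<partial>M)"
        by (subst integral_density) (use V0 c in auto)
      also have "\<dots> = (\<integral>\<omega>. (h (X \<omega>) * V \<omega>) / c \<partial>M)" by (simp add: mult.commute)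
      finally show ?thesis by simp
    qed
    have rd: "real_distribution (D V)"
      if V: "integrable M V" and V0: "\<And>\<omega>. 0 \<le> V \<omega>" and Vc: "(\<integral>\<omega>. V \<omega> \<partial>M) = c" for V
    proof -
      note [measurable] = borel_measurable_integrable[OF V]
      have "(\<integral>\<^sup>+ \<omega>. ennreal (V \<omega> / c) \<partial>M) = ennreal (\<integral>\<omega>. V \<omega> / c \<partial>M)"
        by (rule nn_integral_eq_integral) (use V V0 c in auto)
      also have "\<dots> = 1" using Vc c by simp
      finally have "prob_space (density M (\<lambda>\<omega>. ennreal (V \<omega> / c)))"
        by (intro prob_spaceI) (simp add: emeasure_density cong: nn_integral_cong)
      then have "prob_space (D V)" unfolding D_def
        by (rule prob_space.prob_space_distr) simp
      then show ?thesis
        by (simp add: real_distribution_def real_distribution_axioms_def D_def)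
    qed
    have rp: "real_distribution (D Wp)" by (rule rd) (use Wp Wp0 in \<open>auto simp: c_def\<close>)
    have rn: "real_distribution (D Wn)" by (rule rd) (use Wn Wn0 cn in auto)
    have eq: "(\<integral>x. h x \<partial>D Wp) = (\<integral>x. h x \<partial>D Wn)"
      if "h \<in> borel_measurable borel" "\<And>x. \<bar>h x\<bar> \<le> 1" "(\<integral>\<omega>. h (X \<omega>) * W \<omega> \<partial>M) = 0"
      for h :: "real \<Rightarrow> real"
      using split[OF that(1,2)] that(3) by (simp add: D_int[OF that(1)] Wp0 Wn0)
    have "char (D Wp) = char (D Wn)"
    proof
      fix t
      have i: "integrable (D V) (\<lambda>x. iexp (t * x))" if "real_distribution (D V)" for V
      proof -
        interpret real_distribution "D V" by fact
        show ?thesis by (rule integrable_const_bound[where B=1]) auto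
      qed
      have iexp_eq: "Re (iexp (t * x)) = cos (t * x)" "Im (iexp (t * x)) = sin (t * x)" for x
        using cis_conv_exp[of "t * x"] by (metis cis.sel(1), metis cis.sel(2))
      \<comment> \<open>The phase in the hypothesis turns cosine into sine, which supplies the
        imaginary part.\<close>
      have cos_sin: "cos (t * x + - (pi / 2)) = sin (t * x)" for x
        using cos_diff[of "t * x" "pi / 2"] by simp
      have "Re (char (D Wp) t) = Re (char (D Wn) t)"
        unfolding char_def integral_Re[OF i[OF rp], symmetric] integral_Re[OF i[OF rn], symmetric] iexp_eq
        using hyp[of t 0] by (intro eq) auto
      moreover have "Im (char (D Wp) t) = Im (char (D Wn) t)"
        unfolding char_def integral_Im[OF i[OF rp], symmetric] integral_Im[OF i[OF rn], symmetric] iexp_eq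
        using hyp[of t "- (pi / 2)"] unfolding cos_sin by (intro eq) auto
      ultimately show "char (D Wp) t = char (D Wn) t" by (simp add: complex_eq_iff)
    qed
    then have DD: "D Wp = D Wn" by (rule Levy_uniqueness[OF rp rn])
    have ind: "\<bar>indicator B x :: real\<bar> \<le> 1" for x :: real by (simp add: indicator_def)
    have "(\<integral>\<omega>. indicator B (X \<omega>) * Wp \<omega> \<partial>M) = (\<integral>\<omega>. indicator B (X \<omega>) * Wn \<omega> \<partial>M)"
      using D_int[of "indicator B" Wp] D_int[of "indicator B" Wn] c DD Wp0 Wn0 by simp
    then show ?thesis using split[of "indicator B"] ind by simp
  qed
qed

text \<open>Induction over the coordinates with \<open>W\<close> arbitrary: the indicator for the
  new coordinate is absorbed into the weight. That the new weight satisfies the hypothesis follows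
  from the one-dimensional case, applied with the weight
  \<open>cos (R \<omega>) * W \<omega>\<close>.\<close>

lemma integral_trig_zero_imp_rect:
  fixes L :: "'i \<Rightarrow> 'a \<Rightarrow> real" and W :: "'a \<Rightarrow> real"
  assumes "finite I" "\<And>i. i \<in> I \<Longrightarrow> L i \<in> borel_measurable M" "integrable M W"
    and "\<And>t \<theta>. (\<integral>\<omega>. cos ((\<Sum>i\<in>I. t i * L i \<omega>) + \<theta>) * W \<omega> \<partial>M) = 0"
    and "\<And>i. i \<in> I \<Longrightarrow> B i \<in> sets borel"
  shows "(\<integral>\<omega>. (\<Prod>i\<in>I. indicator (B i) (L i \<omega>)) * W \<omega> \<partial>M) = 0"
  using assms
proof (induction I arbitrary: W rule: finite_induct)
  case empty
  from empty.prems(3)[of _ 0] show ?case by simp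
next
  case (insert i I)
  note [measurable] = insert.prems(1)[OF insertI1] insert.prems(1)[OF insertI2]
    borel_measurable_integrable[OF insert.prems(2)] insert.prems(4)[OF insertI1]
  have int: "integrable M (\<lambda>\<omega>. h \<omega> * W \<omega>)"
    if [measurable]: "h \<in> borel_measurable M" and "\<And>x. \<bar>h x\<bar> \<le> 1" for h
  proof (rule Bochner_Integration.integrable_bound[OF insert.prems(2)])
    show "(\<lambda>\<omega>. h \<omega> * W \<omega>) \<in> borel_measurable M" by measurable
    show "AE x in M. norm (h x * W x) \<le> norm (W x)"
      using that(2) by (auto simp: abs_mult intro!: mult_left_le_one_le)
  qed
  have iW: "integrable M (\<lambda>\<omega>. indicator (B i) (L i \<omega>) * W \<omega>)"
    by (rule int) (auto simp: indicator_def)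
  have z: "(\<integral>\<omega>. cos ((\<Sum>i\<in>I. t i * L i \<omega>) + \<theta>) * (indicator (B i) (L i \<omega>) * W \<omega>) \<partial>M) = 0" for t \<theta>
  proof -
    define R where "R = (\<lambda>\<omega>. (\<Sum>i\<in>I. t i * L i \<omega>) + \<theta>)"
    have R[measurable]: "R \<in> borel_measurable M" unfolding R_def by measurable
    have iR: "integrable M (\<lambda>\<omega>. cos (R \<omega>) * W \<omega>)" by (rule int) auto
    have "(\<integral>\<omega>. indicator (B i) (L i \<omega>) * (cos (R \<omega>) * W \<omega>) \<partial>M) = 0"
    proof (rule integral_trig_zero_imp_1d[OF _ iR])
      fix s \<phi>
      have sum: "(\<Sum>j\<in>insert i I. (t'(i := s)) j * L j \<omega>) = s * L i \<omega> + (\<Sum>j\<in>I. t' j * L j \<omega>)"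
        for t' :: "'i \<Rightarrow> real" and s \<omega>
        using insert.hyps by (auto intro!: sum.cong)
      have c1: "(\<integral>\<omega>. cos ((s * L i \<omega> + (\<Sum>j\<in>I. t j * L j \<omega>)) + (\<theta> + \<phi>)) * W \<omega> \<partial>M) = 0"
        using insert.prems(3)[of "t(i := s)" "\<theta> + \<phi>"] unfolding sum .
      have c2: "(\<integral>\<omega>. cos ((- s * L i \<omega> + (\<Sum>j\<in>I. t j * L j \<omega>)) + (\<theta> - \<phi>)) * W \<omega> \<partial>M) = 0"
        using insert.prems(3)[of "t(i := - s)" "\<theta> - \<phi>"] unfolding sum .
      \<comment> \<open>Product-to-sum formula; both terms on the right are instances of the
        hypothesis, with coefficient \<open>s\<close> or \<open>- s\<close> at the index
        \<open>i\<close>.\<close>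
      have "cos (s * L i \<omega> + \<phi>) * (cos (R \<omega>) * W \<omega>) =
         (1/2) * (cos ((s * L i \<omega> + (\<Sum>j\<in>I. t j * L j \<omega>)) + (\<theta> + \<phi>)) * W \<omega>) +
         (1/2) * (cos ((- s * L i \<omega> + (\<Sum>j\<in>I. t j * L j \<omega>)) + (\<theta> - \<phi>)) * W \<omega>)" for \<omega>
      proof -
        have "(s * L i \<omega> + (\<Sum>j\<in>I. t j * L j \<omega>)) + (\<theta> + \<phi>) = R \<omega> + (s * L i \<omega> + \<phi>)"
          "(- s * L i \<omega> + (\<Sum>j\<in>I. t j * L j \<omega>)) + (\<theta> - \<phi>) = R \<omega> - (s * L i \<omega> + \<phi>)"
          by (simp_all add: R_def)
        then show ?thesis by (simp only: cos_add cos_diff) (simp add: algebra_simps)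
      qed
      moreover have "integrable M (\<lambda>\<omega>. cos ((s * L i \<omega> + (\<Sum>j\<in>I. t j * L j \<omega>)) + (\<theta> + \<phi>)) * W \<omega>)"
        "integrable M (\<lambda>\<omega>. cos ((- s * L i \<omega> + (\<Sum>j\<in>I. t j * L j \<omega>)) + (\<theta> - \<phi>)) * W \<omega>)"
        by (rule int; auto)+
      ultimately show "(\<integral>\<omega>. cos (s * L i \<omega> + \<phi>) * (cos (R \<omega>) * W \<omega>) \<partial>M) = 0"
        using c1 c2 by simp
    qed auto
    then show ?thesis by (simp add: R_def mult_ac)
  qed
  have "(\<integral>\<omega>. (\<Prod>i\<in>I. indicator (B i) (L i \<omega>)) * (indicator (B i) (L i \<omega>) * W \<omega>) \<partial>M) = 0"
    by (rule insert.IH[OF _ iW z]) (use insert.prems in auto)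
  then show ?case using insert.hyps by (simp add: mult_ac)
qed

text \<open>The two finite measures given by the positive and negative parts of \<open>W\<close>
  agree on rectangles, hence on the whole product algebra. Only the product of \<psi> with
  \<open>W\<close> is assumed integrable, so \<psi> may be unbounded.\<close>

lemma integral_trig_zero_imp_orthogonal:
  fixes L :: "'i \<Rightarrow> 'a \<Rightarrow> real" and W :: "'a \<Rightarrow> real"
  assumes I: "finite I" and L: "\<And>i. i \<in> I \<Longrightarrow> L i \<in> borel_measurable M" and W: "integrable M W"
    and hyp: "\<And>t \<theta>. (\<integral>\<omega>. cos ((\<Sum>i\<in>I. t i * L i \<omega>) + \<theta>) * W \<omega> \<partial>M) = 0"
    and \<psi>: "\<psi> \<in> borel_measurable (PiM I (\<lambda>_. borel))"
    and int: "integrable M (\<lambda>\<omega>. \<psi> (restrict (\<lambda>i. L i \<omega>) I) * W \<omega>)"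
  shows "(\<integral>\<omega>. \<psi> (restrict (\<lambda>i. L i \<omega>) I) * W \<omega> \<partial>M) = 0"
proof -
  note [measurable] = borel_measurable_integrable[OF W] \<psi>
  define T where "T = (\<lambda>\<omega>. restrict (\<lambda>i. L i \<omega>) I)"
  have T[measurable]: "T \<in> measurable M (PiM I (\<lambda>_. borel))"
    unfolding T_def by (rule measurable_restrict) (use L in auto)
  define Wp where "Wp = (\<lambda>\<omega>. max 0 (W \<omega>))"
  define Wn where "Wn = (\<lambda>\<omega>. max 0 (- W \<omega>))"
  have Wp: "integrable M Wp" unfolding Wp_def by (rule integrable_max) (use W in auto)
  have Wn: "integrable M Wn" unfolding Wn_def by (rule integrable_max) (use W in auto)
  note [measurable] = borel_measurable_integrable[OF Wp] borel_measurable_integrable[OF Wn]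
  have WW: "W \<omega> = Wp \<omega> - Wn \<omega>" for \<omega> by (auto simp: Wp_def Wn_def)
  have Wp0: "0 \<le> Wp \<omega>" and Wn0: "0 \<le> Wn \<omega>" for \<omega> by (auto simp: Wp_def Wn_def)
  have le: "Wp \<omega> \<le> \<bar>W \<omega>\<bar>" "Wn \<omega> \<le> \<bar>W \<omega>\<bar>" for \<omega> by (auto simp: Wp_def Wn_def)
  define D where "D = (\<lambda>V. distr (density M (\<lambda>\<omega>. ennreal (V \<omega>))) (PiM I (\<lambda>_. borel :: real measure)) T)"
  have em: "emeasure (D V) A = ennreal (\<integral>\<omega>. indicator A (T \<omega>) * V \<omega> \<partial>M)"
    if V: "integrable M V" and V0: "\<And>\<omega>. 0 \<le> V \<omega>" and A[measurable]: "A \<in> sets (PiM I (\<lambda>_. borel))" for V A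
  proof -
    note [measurable] = borel_measurable_integrable[OF V]
    have "emeasure (D V) A = emeasure (density M (\<lambda>\<omega>. ennreal (V \<omega>))) (T -` A \<inter> space M)"
      unfolding D_def by (subst emeasure_distr) auto
    also have "\<dots> = (\<integral>\<^sup>+\<omega>. ennreal (V \<omega>) * indicator (T -` A \<inter> space M) \<omega> \<partial>M)"
      by (rule emeasure_density) auto
    also have "\<dots> = (\<integral>\<^sup>+\<omega>. ennreal (indicator A (T \<omega>) * V \<omega>) \<partial>M)"
      by (rule nn_integral_cong) (auto simp: indicator_def)
    also have "\<dots> = ennreal (\<integral>\<omega>. indicator A (T \<omega>) * V \<omega> \<partial>M)"
    proof (rule nn_integral_eq_integral)
      show "integrable M (\<lambda>\<omega>. indicator A (T \<omega>) * V \<omega>)"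
        by (rule Bochner_Integration.integrable_bound[OF V]) (auto simp: indicator_def)
      show "AE x in M. 0 \<le> indicator A (T x) * V x" using V0 by auto
    qed
    finally show ?thesis .
  qed
  have DD: "D Wp = D Wn"
  proof (rule measure_eqI_PiM_finite[where M = "\<lambda>_. borel" and A = "\<lambda>_. PiE I (\<lambda>_. UNIV)", OF I])
    show "sets (D Wp) = sets (Pi\<^sub>M I (\<lambda>_. borel))" "sets (D Wn) = sets (Pi\<^sub>M I (\<lambda>_. borel))"
      by (auto simp: D_def)
    fix B assume B: "\<And>i. i \<in> I \<Longrightarrow> B i \<in> sets (borel :: real measure)"
    have A: "PiE I B \<in> sets (PiM I (\<lambda>_. borel))"
      by (rule sets_PiM_I_finite[OF I]) (use B in auto)
    have ind: "indicator (PiE I B) (T \<omega>) = (\<Prod>i\<in>I. indicator (B i) (L i \<omega>) :: real)" for \<omega>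
    proof (cases "\<forall>i\<in>I. L i \<omega> \<in> B i")
      case True
      then show ?thesis by (auto simp: indicator_def T_def)
    next
      case False
      then have "(\<Prod>i\<in>I. indicator (B i) (L i \<omega>) :: real) = 0" using I by (auto simp: indicator_def)
      moreover have "T \<omega> \<notin> PiE I B" using False by (auto simp: T_def)
      ultimately show ?thesis by simp
    qed
    have i: "integrable M (\<lambda>\<omega>. indicator (PiE I B) (T \<omega>) * V \<omega>)" if V: "integrable M V" for V :: "'a \<Rightarrow> real"
    proof -
      note [measurable] = borel_measurable_integrable[OF V] A
      show ?thesis by (rule Bochner_Integration.integrable_bound[OF V]) (auto simp: indicator_def)
    qed
    have "(\<integral>\<omega>. indicator (PiE I B) (T \<omega>) * Wp \<omega> \<partial>M) - (\<integral>\<omega>. indicator (PiE I B) (T \<omega>) * Wn \<omega> \<partial>M)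
        = (\<integral>\<omega>. indicator (PiE I B) (T \<omega>) * W \<omega> \<partial>M)"
      unfolding WW right_diff_distrib by (rule Bochner_Integration.integral_diff[symmetric]) (intro i Wp Wn)+
    also have "\<dots> = 0" unfolding ind
      by (rule integral_trig_zero_imp_rect[OF I L W hyp]) (use B in auto)
    finally show "emeasure (D Wp) (PiE I B) = emeasure (D Wn) (PiE I B)"
      using em[OF Wp Wp0 A] em[OF Wn Wn0 A] by simp
  next
    have s: "PiE I (\<lambda>_. UNIV) \<in> sets (PiM I (\<lambda>_. borel :: real measure))"
      by (rule sets_PiM_I_finite[OF I]) auto
    show "range (\<lambda>_. PiE I (\<lambda>_. UNIV)) \<subseteq> prod_algebra I (\<lambda>_. borel :: real measure)"
      using I by (auto intro!: prod_algebraI_finite)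
    show "(\<Union>i::nat. PiE I (\<lambda>_. UNIV)) = space (PiM I (\<lambda>_. borel :: real measure))"
      by (auto simp: space_PiM)
    show "emeasure (D Wp) (PiE I (\<lambda>_. UNIV)) \<noteq> \<infinity>" for i :: nat
      using em[OF Wp Wp0 s] by simp
  qed
  have D_int: "(\<integral>x. \<psi> x \<partial>D V) = (\<integral>\<omega>. \<psi> (T \<omega>) * V \<omega> \<partial>M)"
    if V: "integrable M V" and V0: "\<And>\<omega>. 0 \<le> V \<omega>" for V
  proof -
    note [measurable] = borel_measurable_integrable[OF V]
    have "(\<integral>x. \<psi> x \<partial>D V) = (\<integral>\<omega>. \<psi> (T \<omega>) \<partial>density M (\<lambda>\<omega>. ennreal (V \<omega>)))"
      unfolding D_def by (rule integral_distr) auto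
    also have "\<dots> = (\<integral>\<omega>. V \<omega> * \<psi> (T \<omega>) \<partial>M)"
      by (subst integral_density) (use V0 in auto)
    finally show ?thesis by (simp add: mult.commute)
  qed
  have int': "integrable M (\<lambda>\<omega>. \<psi> (T \<omega>) * W \<omega>)" using int by (simp add: T_def)
  have i: "integrable M (\<lambda>\<omega>. \<psi> (T \<omega>) * V \<omega>)"
    if [measurable]: "V \<in> borel_measurable M" and "\<And>\<omega>. 0 \<le> V \<omega>" "\<And>\<omega>. V \<omega> \<le> \<bar>W \<omega>\<bar>" for V
  proof (rule Bochner_Integration.integrable_bound[OF int'])
    show "AE \<omega> in M. norm (\<psi> (T \<omega>) * V \<omega>) \<le> norm (\<psi> (T \<omega>) * W \<omega>)"
      using that(2,3) by (auto simp: abs_mult intro!: mult_left_mono)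
  qed measurable
  have "(\<integral>\<omega>. \<psi> (T \<omega>) * W \<omega> \<partial>M) = (\<integral>\<omega>. \<psi> (T \<omega>) * Wp \<omega> \<partial>M) - (\<integral>\<omega>. \<psi> (T \<omega>) * Wn \<omega> \<partial>M)"
    unfolding WW right_diff_distrib by (rule Bochner_Integration.integral_diff) (rule i; use Wp0 Wn0 le in auto)+
  also have "\<dots> = 0" using D_int[OF Wp Wp0] D_int[OF Wn Wn0] DD by simp
  finally show ?thesis by (simp add: T_def)
qed

section \<open>Gaussian random variables\<close>

text \<open>Treating the point mass at 0 as the case \<sigma> = 0 makes the law a function of the
  second moment alone; \<open>Lall_distr_eq\<close> relies on this.\<close>

lemma centered_gaussian_moments:
  fixes X :: "'a \<Rightarrow> real"
  assumes [measurable]: "X \<in> borel_measurable M" and M: "prob_space M"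
    and g: "distr M borel X = return borel 0 \<or>
        (\<exists>\<sigma>>0. distr M borel X = density lborel (normal_density 0 \<sigma>))"
  obtains \<sigma> where "\<sigma> \<ge> 0" "has_bochner_integral M (\<lambda>\<omega>. (X \<omega>)\<^sup>2) (\<sigma>\<^sup>2)"
    "has_bochner_integral M (\<lambda>\<omega>. (X \<omega>) ^ 4) (3 * \<sigma> ^ 4)"
    "distr M borel X = (if \<sigma> = 0 then return borel 0 else density lborel (normal_density 0 \<sigma>))"
proof -
  interpret prob_space M by fact
  have d: "has_bochner_integral M (\<lambda>\<omega>. h (X \<omega>)) v \<longleftrightarrow> has_bochner_integral (distr M borel X) h v"
    if [measurable]: "h \<in> borel_measurable borel" for h :: "real \<Rightarrow> real" and v
    by (simp add: has_bochner_integral_iff integrable_distr_eq integral_distr)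
  from g show ?thesis
  proof
    assume r: "distr M borel X = return borel 0"
    have "has_bochner_integral (return borel 0) h (h 0)"
      if [measurable]: "h \<in> borel_measurable borel" for h :: "real \<Rightarrow> real"
    proof -
      interpret R: prob_space "return borel (0 :: real)" by (rule prob_space_return) simp
      have "AE x in return borel (0::real). h x = h 0" by (simp add: AE_return)
      then show ?thesis
        using R.prob_space by (subst has_bochner_integral_cong_AE[where g = "\<lambda>_. h 0"]) (auto simp: has_bochner_integral_iff)
    qed
    from this[of "\<lambda>x. x\<^sup>2"] this[of "\<lambda>x. x ^ 4"]
    show thesis using d[of "\<lambda>x. x\<^sup>2"] d[of "\<lambda>x. x ^ 4"] by (intro that[of 0]) (auto simp: r)
  next
    assume "\<exists>\<sigma>>0. distr M borel X = density lborel (normal_density 0 \<sigma>)"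
    then obtain \<sigma> where \<sigma>: "\<sigma> > 0" and r: "distr M borel X = density lborel (normal_density 0 \<sigma>)" by auto
    have "has_bochner_integral (density lborel (normal_density 0 \<sigma>)) h v"
      if [measurable]: "h \<in> borel_measurable borel"
        and h: "has_bochner_integral lborel (\<lambda>x. normal_density 0 \<sigma> x * h x) v" for h :: "real \<Rightarrow> real" and v
      using h by (intro has_bochner_integral_density) auto
    from this[of "\<lambda>x. x\<^sup>2" "\<sigma>\<^sup>2"] this[of "\<lambda>x. x ^ 4" "3 * \<sigma> ^ 4"]
      normal_moment_even[OF \<sigma>, of 0 1] normal_moment_even[OF \<sigma>, of 0 2]
    show thesis using \<sigma> by (intro that[of \<sigma>]) (auto simp: r d[of "\<lambda>x. x\<^sup>2"] d[of "\<lambda>x. x ^ 4"] fact_numeral power_divide)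
  qed
qed

section \<open>Continuous functionals as Gaussian random variables, for one fixed dimension\<close>

locale avg_approx =
  fixes D :: "nat \<Rightarrow> pt set" and \<rho> :: "nat \<Rightarrow> pt \<Rightarrow> real" and F :: "nat \<Rightarrow> fn set"
    and nF :: "nat \<Rightarrow> fn \<Rightarrow> real" and \<mu> :: "nat \<Rightarrow> fn measure" and d :: nat
  assumes setting: "avg_setting_d D \<rho> F nF \<mu> d"
begin

lemma setting_conjuncts:
  shows D_sets: "D d \<in> sets (borelR d)"
    and \<rho>_measurable: "\<rho> d \<in> borel_measurable (lebR d)"
    and \<rho>_nonneg: "\<forall>x\<in>D d. \<rho> d x \<ge> 0"
    and \<rho>_integral: "(\<integral>\<^sup>+ x \<in> D d. ennreal (\<rho> d x) \<partial>lebR d) = 1"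
    and F_outside_all: "\<forall>f\<in>F d. \<forall>x. x \<notin> D d \<longrightarrow> f x = 0"
    and F_zero: "(\<lambda>x. 0) \<in> F d"
    and F_lin_all: "\<forall>f\<in>F d. \<forall>g\<in>F d. \<forall>a b. (\<lambda>x. a * f x + b * g x) \<in> F d"
    and nF_norm: "\<forall>f\<in>F d. nF d f \<ge> 0 \<and> (nF d f = 0 \<longleftrightarrow> f = (\<lambda>x. 0))"
    and nF_triangle_all: "\<forall>f\<in>F d. \<forall>g\<in>F d. nF d (\<lambda>x. f x + g x) \<le> nF d f + nF d g"
    and separable: "\<exists>S. countable S \<and> S \<subseteq> F d \<and> (\<forall>f\<in>F d. \<forall>e>0. \<exists>s\<in>S. nF d (\<lambda>x. f x - s x) < e)"
    and F_Gspace: "F d \<subseteq> Gspace D \<rho> d"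
    and embedded: "\<exists>C::real. \<forall>f\<in>F d. Gnorm2 D \<rho> d f \<le> ennreal ((C * nF d f)\<^sup>2)"
    and point_bounded_D: "\<forall>x\<in>D d. \<exists>C. \<forall>f\<in>F d. \<bar>f x\<bar> \<le> C * nF d f"
    and prob_\<mu>: "prob_space (\<mu> d)"
    and space_\<mu>: "space (\<mu> d) = F d"
    and sets_\<mu>_eq: "sets (\<mu> d) = sets (sigma (F d) {U. Fopen F nF d U})"
    and gaussian_all: "\<forall>L\<in>Lall F nF d. distr (\<mu> d) borel L = return borel 0 \<or>
        (\<exists>\<sigma>>0. distr (\<mu> d) borel L = density lborel (normal_density 0 \<sigma>))"
  by (insert setting[unfolded avg_setting_d_def], (elim conjE, assumption)+)

lemma F_lin: "lin_closed (F d)"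
  using F_zero F_lin_all by (simp add: lin_closed_def)

lemma nF_nonneg: "f \<in> F d \<Longrightarrow> 0 \<le> nF d f"
  using nF_norm by blast

lemma nF_triangle: "f \<in> F d \<Longrightarrow> g \<in> F d \<Longrightarrow> nF d (\<lambda>x. f x + g x) \<le> nF d f + nF d g"
  using nF_triangle_all by blast

lemma F_outside: "f \<in> F d \<Longrightarrow> x \<notin> D d \<Longrightarrow> f x = 0"
  using F_outside_all by blast

text \<open>Outside \<open>D d\<close> all members of \<open>F d\<close> vanish, so evaluation there
  is the zero functional. Integrals over the whole of R^d then need no case distinction.\<close>

lemma point_bounded: "\<exists>C. \<forall>f\<in>F d. \<bar>f x\<bar> \<le> C * nF d f"
proof (cases "x \<in> D d")
  case True
  then show ?thesis using point_bounded_D by blast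
next
  case False
  then show ?thesis by (intro exI[of _ 0]) (simp add: F_outside)
qed

lemma sets_\<mu>: "Fopen F nF d U \<Longrightarrow> U \<in> sets (\<mu> d)"
proof -
  assume U: "Fopen F nF d U"
  have "U \<in> sets (sigma (F d) {U. Fopen F nF d U})"
    using U by (subst sets_measure_of) (auto simp: Fopen_def)
  then show ?thesis by (simp add: sets_\<mu>_eq)
qed

sublocale \<mu>: prob_space "\<mu> d"
  by (rule prob_\<mu>)

lemma F_diff: "f \<in> F d \<Longrightarrow> g \<in> F d \<Longrightarrow> (\<lambda>x. f x - g x) \<in> F d"
  by (rule lin_closed_diff[OF F_lin])

lemma ball_measurable:
  assumes s: "s \<in> F d"
  shows "{f \<in> F d. nF d (\<lambda>x. f x - s x) < e} \<in> sets (\<mu> d)"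
proof (rule sets_\<mu>, unfold Fopen_def, intro conjI ballI)
  fix f assume "f \<in> {f \<in> F d. nF d (\<lambda>x. f x - s x) < e}"
  then have f: "f \<in> F d" "nF d (\<lambda>x. f x - s x) < e" by auto
  have "nF d (\<lambda>x. g x - s x) < e" if g: "g \<in> F d" "nF d (\<lambda>x. g x - f x) < e - nF d (\<lambda>x. f x - s x)" for g
    using nF_triangle[OF F_diff[OF g(1) f(1)] F_diff[OF f(1) s]] g by simp
  then show "\<exists>e'>0. \<forall>g\<in>F d. nF d (\<lambda>x. g x - f x) < e' \<longrightarrow> g \<in> {f \<in> F d. nF d (\<lambda>x. f x - s x) < e}"
    using f by (intro exI[of _ "e - nF d (\<lambda>x. f x - s x)"]) auto
qed auto

lemma Lall_diff:
  assumes L: "L \<in> Lall F nF d" and f: "f \<in> F d" and g: "g \<in> F d"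
  shows "L (\<lambda>x. f x - g x) = L f - L g"
proof -
  have "L (\<lambda>x. 1 * f x + (-1) * g x) = 1 * L f + (-1) * L g"
    using L f g unfolding Lall_def by blast
  then show ?thesis by simp
qed

lemma Lall_measurable:
  assumes L: "L \<in> Lall F nF d"
  shows "L \<in> borel_measurable (\<mu> d)"
proof (rule borel_measurableI)
  fix S :: "real set" assume S: "open S"
  obtain C where C: "\<forall>f\<in>F d. \<bar>L f\<bar> \<le> C * nF d f" using L by (auto simp: Lall_def)
  show "L -` S \<inter> space (\<mu> d) \<in> sets (\<mu> d)"
  proof (rule sets_\<mu>, unfold Fopen_def space_\<mu>, intro conjI ballI)
    fix f assume "f \<in> L -` S \<inter> F d"
    then have f: "f \<in> F d" "L f \<in> S" by auto
    then obtain e where e: "e > 0" "\<And>y. dist y (L f) < e \<Longrightarrow> y \<in> S"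
      using S unfolding open_dist by blast
    have "g \<in> L -` S \<inter> F d" if g: "g \<in> F d" "nF d (\<lambda>x. g x - f x) < e / (\<bar>C\<bar> + 1)" for g
    proof -
      have h: "(\<lambda>x. g x - f x) \<in> F d" using F_diff g f by auto
      have "\<bar>L g - L f\<bar> \<le> C * nF d (\<lambda>x. g x - f x)"
        using bspec[OF C h] Lall_diff[OF L g(1) f(1)] by simp
      also have "\<dots> \<le> (\<bar>C\<bar> + 1) * nF d (\<lambda>x. g x - f x)"
        using nF_nonneg[OF h] by (intro mult_right_mono) auto
      also have "\<dots> < e" using g(2) by (simp add: field_simps pos_less_divide_eq)
      finally show ?thesis using e(2)[of "L g"] g by (auto simp: dist_real_def)
    qed
    then show "\<exists>e>0. \<forall>g\<in>F d. nF d (\<lambda>x. g x - f x) < e \<longrightarrow> g \<in> L -` S \<inter> F d"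
      using e(1) by (intro exI[of _ "e / (\<bar>C\<bar> + 1)"]) auto
  qed auto
qed

lemma Lall_lin: "lin_closed (Lall F nF d)"
  unfolding lin_closed_def
proof (intro conjI ballI allI)
  show "(\<lambda>x. 0) \<in> Lall F nF d" by (auto simp: Lall_def intro!: exI[of _ 0])
  fix L K :: "fn \<Rightarrow> real" and a b :: real
  assume L: "L \<in> Lall F nF d" and K: "K \<in> Lall F nF d"
  obtain C where C: "\<forall>f\<in>F d. \<bar>L f\<bar> \<le> C * nF d f" using L by (auto simp: Lall_def)
  obtain C' where C': "\<forall>f\<in>F d. \<bar>K f\<bar> \<le> C' * nF d f" using K by (auto simp: Lall_def)
  have "\<bar>a * L f + b * K f\<bar> \<le> (\<bar>a\<bar> * C + \<bar>b\<bar> * C') * nF d f" if f: "f \<in> F d" for f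
  proof -
    have "\<bar>a * L f + b * K f\<bar> \<le> \<bar>a\<bar> * \<bar>L f\<bar> + \<bar>b\<bar> * \<bar>K f\<bar>"
      by (metis abs_mult abs_triangle_ineq)
    also have "\<dots> \<le> \<bar>a\<bar> * (C * nF d f) + \<bar>b\<bar> * (C' * nF d f)"
      using C C' f by (intro add_mono mult_left_mono) auto
    finally show ?thesis by (simp add: algebra_simps)
  qed
  moreover have "L (\<lambda>x. s * f x + t * g x) = s * L f + t * L g"
    "K (\<lambda>x. s * f x + t * g x) = s * K f + t * K g" if "f \<in> F d" "g \<in> F d" for f g s t
    using L K that unfolding Lall_def by blast+
  ultimately show "(\<lambda>f. a * L f + b * K f) \<in> Lall F nF d"
    unfolding Lall_def mem_Collect_eq
    by (intro conjI ballI allI exI[of _ "\<bar>a\<bar> * C + \<bar>b\<bar> * C'"]) (auto simp: distrib_left mult.left_commute)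
qed

lemma Lall_point: "(\<lambda>f. f x) \<in> Lall F nF d"
  using point_bounded[of x] by (simp add: Lall_def)

lemma Lall_moments:
  assumes L: "L \<in> Lall F nF d"
  shows "integrable (\<mu> d) (\<lambda>f. (L f)\<^sup>2)" "integrable (\<mu> d) (\<lambda>f. (L f) ^ 4)"
    "(\<integral>f. (L f) ^ 4 \<partial>\<mu> d) = 3 * (\<integral>f. (L f)\<^sup>2 \<partial>\<mu> d)\<^sup>2"
proof -
  obtain \<sigma> where s: "has_bochner_integral (\<mu> d) (\<lambda>\<omega>. (L \<omega>)\<^sup>2) (\<sigma>\<^sup>2)"
    "has_bochner_integral (\<mu> d) (\<lambda>\<omega>. (L \<omega>) ^ 4) (3 * \<sigma> ^ 4)"
    by (rule centered_gaussian_moments[OF Lall_measurable[OF L] prob_\<mu> bspec[OF gaussian_all L]]) blast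
  then show "integrable (\<mu> d) (\<lambda>f. (L f)\<^sup>2)" "integrable (\<mu> d) (\<lambda>f. (L f) ^ 4)"
    "(\<integral>f. (L f) ^ 4 \<partial>\<mu> d) = 3 * (\<integral>f. (L f)\<^sup>2 \<partial>\<mu> d)\<^sup>2"
    by (auto simp: has_bochner_integral_iff power_mult[symmetric])
qed

text \<open>Functionals are themselves vectors in the space of square integrable random variables,
  so projections and orthonormal systems are available for them too.\<close>

lemma Lall_sq_int: "Lall F nF d \<subseteq> sq_int (\<mu> d)"
  by (auto simp: sq_int_def Lall_moments Lall_measurable)

lemma Lall_distr_eq:
  assumes L: "L \<in> Lall F nF d" and K: "K \<in> Lall F nF d" and eq: "ip (\<mu> d) L L = ip (\<mu> d) K K"
  shows "distr (\<mu> d) borel L = distr (\<mu> d) borel K"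
proof -
  have *: "\<exists>\<sigma>\<ge>0. ip (\<mu> d) L L = \<sigma>\<^sup>2 \<and>
     distr (\<mu> d) borel L = (if \<sigma> = 0 then return borel 0 else density lborel (normal_density 0 \<sigma>))"
    if "L \<in> Lall F nF d" for L
    by (rule centered_gaussian_moments[OF Lall_measurable[OF that] prob_\<mu> bspec[OF gaussian_all that]])
      (auto simp: ip_self has_bochner_integral_iff)
  from *[OF L] *[OF K] eq show ?thesis
    by (metis power2_eq_iff_nonneg)
qed

text \<open>A replacement for "uncorrelated implies independent". The variance of
  \<open>s * X + Y\<close> does not change when \<open>s\<close> becomes \<open>- s\<close>, hence
  neither does its law. Thus the mean of \<open>cos (Y + \<theta>) * sin (s * X)\<close> vanishes
  for every \<open>s\<close>, and dividing by \<open>s\<close> and letting \<open>s\<close> tend to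
  0 gives the claim.\<close>

lemma uncorrelated_cos:
  assumes X: "X \<in> Lall F nF d" and Y: "Y \<in> Lall F nF d" and XY: "ip (\<mu> d) X Y = 0"
  shows "(\<integral>f. cos (Y f + \<theta>) * X f \<partial>\<mu> d) = 0"
proof -
  note [measurable] = Lall_measurable[OF X] Lall_measurable[OF Y]
  have X2: "X \<in> sq_int (\<mu> d)" and Y2: "Y \<in> sq_int (\<mu> d)" using X Y Lall_sq_int by auto
  have bd: "integrable (\<mu> d) g" if "g \<in> borel_measurable (\<mu> d)" "\<And>f. \<bar>g f\<bar> \<le> 1" for g :: "fn \<Rightarrow> real"
    by (rule \<mu>.integrable_const_bound[where B=1]) (use that in simp_all)
  have sym: "(\<integral>f. cos (s * X f + Y f + \<theta>) \<partial>\<mu> d) = (\<integral>f. cos (- s * X f + Y f + \<theta>) \<partial>\<mu> d)" for s \<theta>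
  proof -
    have in_Lall: "(\<lambda>f. t * X f + 1 * Y f) \<in> Lall F nF d" for t
      using Lall_lin X Y unfolding lin_closed_def by blast
    have in2: "(\<lambda>f. t * X f + 1 * Y f) \<in> sq_int (\<mu> d)" for t using in_Lall Lall_sq_int by blast
    have "ip (\<mu> d) (\<lambda>f. t * X f + 1 * Y f) (\<lambda>f. t * X f + 1 * Y f)
        = t\<^sup>2 * ip (\<mu> d) X X + ip (\<mu> d) Y Y" for t
      using ip_lin[OF X2 Y2 in2, of t 1 t] ip_lin[OF X2 Y2 X2, of t 1] ip_lin[OF X2 Y2 Y2, of t 1] XY
      by (simp add: ip_commute[of _ Y X] ip_commute[of _ X "\<lambda>f. t * X f + Y f"]
          ip_commute[of _ Y "\<lambda>f. t * X f + Y f"] power2_eq_square)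
    note var = this
    have "distr (\<mu> d) borel (\<lambda>f. s * X f + 1 * Y f) = distr (\<mu> d) borel (\<lambda>f. - s * X f + 1 * Y f)"
      by (intro Lall_distr_eq in_Lall) (simp only: var power2_minus)
    then have "(\<integral>x. cos (x + \<theta>) \<partial>distr (\<mu> d) borel (\<lambda>f. s * X f + 1 * Y f))
       = (\<integral>x. cos (x + \<theta>) \<partial>distr (\<mu> d) borel (\<lambda>f. - s * X f + 1 * Y f))" by simp
    then show ?thesis by (simp add: integral_distr)
  qed
  have z: "(\<integral>f. cos (Y f + \<theta>) * sin (s * X f) \<partial>\<mu> d) = 0" for s
  proof -
    \<comment> \<open>Shifting the phase turns the symmetry of cosine means into that of sine means,
      whose difference is the product needed.\<close>
    have cs: "cos (a + (\<theta> + - (pi / 2))) = sin (a + \<theta>)" for a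
      using cos_diff[of "a + \<theta>" "pi / 2"] by (simp add: algebra_simps)
    have "cos (Y f + \<theta>) * sin (s * X f) = (1/2) * cos (s * X f + Y f + (\<theta> + - (pi/2)))
        - (1/2) * cos (- s * X f + Y f + (\<theta> + - (pi/2)))" for f
    proof -
      have "s * X f + Y f + \<theta> = (Y f + \<theta>) + s * X f" "- s * X f + Y f + \<theta> = (Y f + \<theta>) - s * X f"
        by simp_all
      then show ?thesis unfolding cs by (simp only: sin_add sin_diff) (simp add: algebra_simps)
    qed
    then show ?thesis using sym[of s "\<theta> + - (pi/2)"] by (simp add: bd)
  qed
  \<comment> \<open>Difference quotients at 0 with step \<open>1 / (n + 1)\<close>; they are
    dominated by the absolute value of \<open>X\<close>.\<close>
  have lim: "(\<lambda>n. \<integral>f. cos (Y f + \<theta>) * (real (Suc n) * sin (inverse (real (Suc n)) * X f)) \<partial>\<mu> d)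
     \<longlonglongrightarrow> (\<integral>f. cos (Y f + \<theta>) * X f \<partial>\<mu> d)"
  proof (rule integral_dominated_convergence[where w = "\<lambda>f. \<bar>X f\<bar>"])
    have "integrable (\<mu> d) (\<lambda>f. X f * 1)"
      by (rule sq_int_mult[OF X2]) (simp add: sq_int_def)
    then show "integrable (\<mu> d) (\<lambda>f. \<bar>X f\<bar>)" by simp
    have "(\<lambda>n. cos (Y f + \<theta>) * (real (Suc n) * sin (inverse (real (Suc n)) * X f))) \<longlonglongrightarrow> cos (Y f + \<theta>) * X f" for f
    proof (intro tendsto_mult tendsto_const)
      have "((\<lambda>h. sin (h * X f)) has_field_derivative X f) (at 0)"
        by (auto intro!: derivative_eq_intros)
      then have "((\<lambda>h. sin (h * X f) / h) \<longlongrightarrow> X f) (at 0)"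
        by (simp add: has_field_derivative_iff)
      moreover have "filterlim (\<lambda>n. inverse (real (Suc n))) (at 0) sequentially"
        by (intro filterlim_atI LIMSEQ_inverse_real_of_nat) auto
      ultimately have "(\<lambda>n. sin (inverse (real (Suc n)) * X f) / inverse (real (Suc n))) \<longlonglongrightarrow> X f"
        by (rule filterlim_compose)
      then show "(\<lambda>n. real (Suc n) * sin (inverse (real (Suc n)) * X f)) \<longlonglongrightarrow> X f"
        by (simp add: field_simps)
    qed
    then show "AE f in \<mu> d. (\<lambda>n. cos (Y f + \<theta>) * (real (Suc n) * sin (inverse (real (Suc n)) * X f)))
        \<longlonglongrightarrow> cos (Y f + \<theta>) * X f" by simp
    have "norm (cos (Y f + \<theta>) * (real (Suc n) * sin (inverse (real (Suc n)) * X f))) \<le> \<bar>X f\<bar>" for n f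
    proof -
      have "\<bar>real (Suc n) * sin (inverse (real (Suc n)) * X f)\<bar>
          \<le> real (Suc n) * \<bar>inverse (real (Suc n)) * X f\<bar>"
        using abs_sin_x_le_abs_x[of "inverse (real (Suc n)) * X f"]
        by (subst abs_mult) (simp only: abs_of_nat mult_left_mono of_nat_0_le_iff)
      also have "\<dots> = \<bar>X f\<bar>" by (simp add: abs_mult field_simps)
      finally have "\<bar>cos (Y f + \<theta>)\<bar> * \<bar>real (Suc n) * sin (inverse (real (Suc n)) * X f)\<bar> \<le> 1 * \<bar>X f\<bar>"
        by (intro mult_mono) auto
      then show ?thesis by (simp add: abs_mult)
    qed
    then show "AE f in \<mu> d. norm (cos (Y f + \<theta>) * (real (Suc n) * sin (inverse (real (Suc n)) * X f))) \<le> \<bar>X f\<bar>" for n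
      by simp
  qed measurable
  have "(\<integral>f. cos (Y f + \<theta>) * (real (Suc n) * sin (inverse (real (Suc n)) * X f)) \<partial>\<mu> d) = 0" for n
  proof -
    have "(\<integral>f. cos (Y f + \<theta>) * (real (Suc n) * sin (inverse (real (Suc n)) * X f)) \<partial>\<mu> d)
      = (\<integral>f. real (Suc n) * (cos (Y f + \<theta>) * sin (inverse (real (Suc n)) * X f)) \<partial>\<mu> d)"
      by (simp only: mult.left_commute)
    then show ?thesis by (simp only: Bochner_Integration.integral_mult_right_zero z mult_zero_right)
  qed
  then show ?thesis using lim by (simp add: LIMSEQ_const_iff)
qed

text \<open>The optimal approximation of \<open>X\<close> by a function of the Gaussian vector \<open>(L 0, \<dots>, L (n - 1))\<close>
  is linear: the residual of linear regression is uncorrelated with every linear combination of the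
  \<open>L i\<close>, hence orthogonal to every square integrable function of them.\<close>

lemma regression_lower_bound:
  fixes n :: nat
  assumes L: "\<And>i. i < n \<Longrightarrow> L i \<in> Lall F nF d"
    and U: "orthonormal (\<mu> d) U r" "\<And>k. k < r \<Longrightarrow> U k \<in> Lall F nF d"
    and sp: "\<And>g i. g \<in> sq_int (\<mu> d) \<Longrightarrow> (\<And>k. k < r \<Longrightarrow> ip (\<mu> d) g (U k) = 0) \<Longrightarrow> i < n \<Longrightarrow> ip (\<mu> d) g (L i) = 0"
    and X: "X \<in> Lall F nF d" and \<psi>[measurable]: "\<psi> \<in> borel_measurable (PiM {..<n} (\<lambda>_. borel))"
  shows "ennreal (ip (\<mu> d) X X - (\<Sum>k<r. (ip (\<mu> d) X (U k))\<^sup>2))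
    \<le> (\<integral>\<^sup>+f. ennreal ((X f - \<psi> (restrict (\<lambda>i. L i f) {..<n}))\<^sup>2) \<partial>\<mu> d)"
proof -
  let ?M = "\<mu> d"
  define T where "T = (\<lambda>f. restrict (\<lambda>i. L i f) {..<n})"
  have T[measurable]: "T \<in> measurable ?M (PiM {..<n} (\<lambda>_. borel))"
    unfolding T_def by (rule measurable_restrict) (use L Lall_measurable in auto)
  have X2: "X \<in> sq_int ?M" using X Lall_sq_int by auto
  have U2: "\<And>k. k < r \<Longrightarrow> U k \<in> sq_int ?M" using U Lall_sq_int by auto
  note [measurable] = Lall_measurable[OF X]
  show ?thesis
  \<comment> \<open>An infinite error makes the bound trivial. A finite one makes the estimator
    square integrable, since it differs from \<open>X\<close> by a square integrable
    function.\<close>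
  proof (cases "(\<integral>\<^sup>+f. ennreal ((X f - \<psi> (T f))\<^sup>2) \<partial>?M) = \<infinity>")
    case True
    then show ?thesis by (simp add: T_def)
  next
    case False
    then have i: "integrable ?M (\<lambda>f. (X f - \<psi> (T f))\<^sup>2)"
      by (intro integrableI_nonneg) (simp_all add: top.not_eq_extremum)
    then have e2: "(\<lambda>f. X f - \<psi> (T f)) \<in> sq_int ?M" by (simp add: sq_int_def)
    from sq_int_diff[OF X2 e2] have \<psi>2: "(\<lambda>f. \<psi> (T f)) \<in> sq_int ?M" by simp
    define R where "R = (\<lambda>f. \<Sum>k<r. ip ?M X (U k) * U k f)"
    define P where "P = (\<lambda>f. X f - R f)"
    have RL: "R \<in> Lall F nF d" unfolding R_def by (rule lin_closed_sum[OF Lall_lin]) (use U in auto)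
    have PL: "P \<in> Lall F nF d" unfolding P_def by (rule lin_closed_diff[OF Lall_lin X RL])
    have R2: "R \<in> sq_int ?M" and P2: "P \<in> sq_int ?M" using RL PL Lall_sq_int by auto
    have PU: "ip ?M P (U k) = 0" if "k < r" for k
      unfolding P_def R_def by (rule orthonormal_residual[OF U(1) X2 that])
    have PR: "ip ?M P R = 0" unfolding R_def
      by (subst ip_commute, subst ip_sum) (use U2 P2 PU in \<open>auto simp: ip_commute\<close>)
    have P\<psi>: "ip ?M P (\<lambda>f. \<psi> (T f)) = 0"
      unfolding ip_def T_def
    proof (subst mult.commute, rule integral_trig_zero_imp_orthogonal)
      show "integrable ?M P"
        using sq_int_mult[OF P2, of "\<lambda>_. 1"] by (simp add: sq_int_def)
      show "integrable ?M (\<lambda>f. \<psi> (restrict (\<lambda>i. L i f) {..<n}) * P f)"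
        using sq_int_mult[OF P2 \<psi>2] by (simp add: T_def mult.commute)
      fix t \<theta>
      have Y: "(\<lambda>f. \<Sum>i<n. t i * L i f) \<in> Lall F nF d"
        by (rule lin_closed_sum[OF Lall_lin]) (use L in auto)
      have "ip ?M P (\<lambda>f. \<Sum>i<n. t i * L i f) = 0"
        by (subst ip_commute, subst ip_sum)
          (use L Lall_sq_int P2 sp[OF P2 PU] in \<open>auto simp: ip_commute\<close>)
      from uncorrelated_cos[OF PL Y this]
      show "(\<integral>f. cos ((\<Sum>i<n. t i * L i f) + \<theta>) * P f \<partial>?M) = 0" .
    qed (use L \<psi> in \<open>auto intro: Lall_measurable\<close>)
    \<comment> \<open>The error of the estimator is \<open>P + Q\<close> with \<open>Q\<close>
      orthogonal to \<open>P\<close>, so its mean square is at least that of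
      \<open>P\<close>.\<close>
    define Q where "Q = (\<lambda>f. R f - \<psi> (T f))"
    have Q2: "Q \<in> sq_int ?M" unfolding Q_def by (rule sq_int_diff[OF R2 \<psi>2])
    have PQ: "ip ?M P Q = 0"
      using ip_diff[OF R2 \<psi>2 P2] PR P\<psi> unfolding Q_def by (metis ip_commute diff_zero)
    have "ip ?M P P = ip ?M X X - (\<Sum>k<r. (ip ?M X (U k))\<^sup>2)"
      unfolding P_def R_def orthonormal_dist[OF U(1) X2] by simp
    then have "ennreal (ip ?M X X - (\<Sum>k<r. (ip ?M X (U k))\<^sup>2)) \<le> ennreal (ip ?M P P + ip ?M Q Q)"
      using ip_nonneg[of ?M Q] by (intro ennreal_leI) linarith
    also have "ip ?M P P + ip ?M Q Q = ip ?M P P + ip ?M Q Q + 2 * ip ?M P Q"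
      unfolding PQ by simp
    also have "\<dots> = (\<integral>f. (P f)\<^sup>2 + (Q f)\<^sup>2 + 2 * (P f * Q f) \<partial>?M)"
      unfolding ip_self unfolding ip_def
      using sq_int_mult[OF P2 Q2] sq_int_square[OF P2] sq_int_square[OF Q2]
      by (subst Bochner_Integration.integral_add; simp)+
    also have "\<dots> = (\<integral>f. (X f - \<psi> (T f))\<^sup>2 \<partial>?M)"
      by (intro Bochner_Integration.integral_cong) (auto simp: P_def Q_def power2_eq_square algebra_simps)
    also have "ennreal \<dots> = (\<integral>\<^sup>+f. ennreal ((X f - \<psi> (T f))\<^sup>2) \<partial>?M)"
      by (rule nn_integral_eq_integral[symmetric]) (use i in auto)
    finally show ?thesis by (simp add: T_def)
  qed
qed

section \<open>The space of square integrable functions and joint measurability\<close>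

text \<open>The probability measure with density \<open>\<rho> d\<close> on \<open>D d\<close>. The
  indicator sits in the density so that the underlying space stays R^d, and G_d becomes
  \<open>sq_int \<nu>\<close>.\<close>

definition \<nu> :: "pt measure" where
  "\<nu> = density (lebR d) (\<lambda>x. ennreal (\<rho> d x) * indicator (D d) x)"

lemma sets_\<nu>: "sets \<nu> = sets (lebR d)"
  by (simp add: \<nu>_def)

lemma measurable_\<nu>: "borel_measurable \<nu> = borel_measurable (lebR d)"
  by (rule measurable_cong_sets) (simp_all add: sets_\<nu>)

lemma D_sets_lebR: "D d \<in> sets (lebR d)"
proof -
  have "sets (lborelR d) = sets (borelR d)"
    unfolding lborelR_def borelR_def by (rule sets_PiM_cong) auto
  then show ?thesis using D_sets by (simp add: lebR_def)
qed

lemma density_measurable: "(\<lambda>x. ennreal (\<rho> d x) * indicator (D d) x) \<in> borel_measurable (lebR d)"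
  using \<rho>_measurable D_sets_lebR by measurable

sublocale \<nu>: prob_space \<nu>
proof (rule prob_spaceI)
  show "emeasure \<nu> (space \<nu>) = 1"
    unfolding \<nu>_def using \<rho>_integral
    by (simp add: emeasure_density density_measurable cong: nn_integral_cong)
qed

lemma AE_D: "AE x in \<nu>. x \<in> D d"
  unfolding \<nu>_def by (subst AE_density[OF density_measurable]) (auto simp: indicator_def)

lemma Gnorm2_eq:
  assumes g: "g \<in> borel_measurable \<nu>"
  shows "Gnorm2 D \<rho> d g = (\<integral>\<^sup>+x. ennreal ((g x)\<^sup>2) \<partial>\<nu>)"
proof -
  have g': "g \<in> borel_measurable (lebR d)" using g by (simp add: measurable_\<nu>)
  have "(\<integral>\<^sup>+x. ennreal ((g x)\<^sup>2) \<partial>\<nu>)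
      = (\<integral>\<^sup>+x. (ennreal (\<rho> d x) * indicator (D d) x) * ennreal ((g x)\<^sup>2) \<partial>lebR d)"
    unfolding \<nu>_def by (rule nn_integral_density[OF density_measurable]) (use g' in auto)
  also have "\<dots> = Gnorm2 D \<rho> d g"
    unfolding Gnorm2_def using \<rho>_nonneg
    by (intro nn_integral_cong) (auto simp: indicator_def ennreal_mult' mult.commute)
  finally show ?thesis by simp
qed

lemma Gnorm2_ip:
  assumes g: "g \<in> sq_int \<nu>"
  shows "Gnorm2 D \<rho> d g = ennreal (ip \<nu> g g)"
  unfolding Gnorm2_eq[OF sq_int_measurable[OF g]] ip_self
  by (rule nn_integral_eq_integral) (use sq_int_square[OF g] in auto)

lemma Gspace_eq: "Gspace D \<rho> d = sq_int \<nu>"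
proof (intro equalityI subsetI)
  fix g assume "g \<in> Gspace D \<rho> d"
  then have g: "g \<in> borel_measurable \<nu>" and fin: "Gnorm2 D \<rho> d g < \<infinity>"
    by (auto simp: Gspace_def measurable_\<nu>)
  have "integrable \<nu> (\<lambda>x. (g x)\<^sup>2)"
    by (rule integrableI_nonneg) (use g fin in \<open>simp_all add: Gnorm2_eq[OF g]\<close>)
  then show "g \<in> sq_int \<nu>" using g by (simp add: sq_int_def)
next
  fix g assume g: "g \<in> sq_int \<nu>"
  then show "g \<in> Gspace D \<rho> d"
    using Gnorm2_ip[OF g] sq_int_measurable[OF g] by (simp add: Gspace_def measurable_\<nu>)
qed

lemma F_sq_int: "f \<in> F d \<Longrightarrow> f \<in> sq_int \<nu>"
  using F_Gspace Gspace_eq by auto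

lemma embedding_const: "\<exists>C\<ge>0. \<forall>f\<in>F d. ip \<nu> f f \<le> (C * nF d f)\<^sup>2"
proof -
  obtain C where C: "\<forall>f\<in>F d. Gnorm2 D \<rho> d f \<le> ennreal ((C * nF d f)\<^sup>2)" using embedded by blast
  have "ip \<nu> f f \<le> (\<bar>C\<bar> * nF d f)\<^sup>2" if f: "f \<in> F d" for f
    using bspec[OF C f] by (simp add: Gnorm2_ip[OF F_sq_int[OF f]] ennreal_le_iff power_mult_distrib)
  then show ?thesis by (intro exI[of _ "\<bar>C\<bar>"]) auto
qed

text \<open>Through the continuous embedding, coefficients of \<open>f\<close> with respect to
  vectors of G_d are continuous functionals on \<open>F d\<close>, and hence Gaussian.\<close>

lemma Lall_ip:
  assumes q: "q \<in> sq_int \<nu>"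
  shows "(\<lambda>f. ip \<nu> f q) \<in> Lall F nF d"
proof -
  obtain C where C: "C \<ge> 0" "\<forall>f\<in>F d. ip \<nu> f f \<le> (C * nF d f)\<^sup>2" using embedding_const by blast
  have "\<bar>ip \<nu> f q\<bar> \<le> (C * sqrt (ip \<nu> q q)) * nF d f" if f: "f \<in> F d" for f
  proof (rule power2_le_imp_le)
    have "\<bar>ip \<nu> f q\<bar>\<^sup>2 \<le> ip \<nu> f f * ip \<nu> q q"
      using ip_Cauchy_Schwarz[OF F_sq_int[OF f] q] by simp
    also have "\<dots> \<le> (C * nF d f)\<^sup>2 * ip \<nu> q q"
      using C f ip_nonneg by (intro mult_right_mono) auto
    also have "\<dots> = ((C * sqrt (ip \<nu> q q)) * nF d f)\<^sup>2"
      using ip_nonneg[of \<nu> q] by (simp add: power_mult_distrib)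
    finally show "\<bar>ip \<nu> f q\<bar>\<^sup>2 \<le> ((C * sqrt (ip \<nu> q q)) * nF d f)\<^sup>2" .
    show "0 \<le> (C * sqrt (ip \<nu> q q)) * nF d f"
      using C nF_nonneg[OF f] ip_nonneg[of \<nu> q] by simp
  qed
  then show ?thesis
    unfolding Lall_def using ip_lin[OF F_sq_int F_sq_int q] by blast
qed

lemma dense_sequence:
  obtains s :: "nat \<Rightarrow> fn" where "\<And>j. s j \<in> F d" "\<And>f e. f \<in> F d \<Longrightarrow> e > 0 \<Longrightarrow> \<exists>j. nF d (\<lambda>x. f x - s j x) < e"
proof -
  obtain S where S: "countable S" "S \<subseteq> F d" "\<And>f e. f \<in> F d \<Longrightarrow> e > 0 \<Longrightarrow> \<exists>s\<in>S. nF d (\<lambda>x. f x - s x) < e"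
    using separable by blast
  have ne: "S \<noteq> {}" using S(3)[OF F_zero, of 1] by auto
  have r: "range (from_nat_into S) = S" by (rule range_from_nat_into[OF ne S(1)])
  show ?thesis
  proof (rule that[of "from_nat_into S"])
    show "from_nat_into S j \<in> F d" for j using from_nat_into[OF ne] S(2) by auto
    show "\<exists>j. nF d (\<lambda>x. f x - from_nat_into S j x) < e" if "f \<in> F d" "e > 0" for f e
      using S(3)[OF that] r by (metis rangeE)
  qed
qed

text \<open>Evaluation is continuous in \<open>f\<close> and measurable in \<open>x\<close>; separability of \<open>F d\<close> makes it the
  pointwise limit of maps that depend on \<open>f\<close> only through a countably valued measurable function.\<close>

lemma eval_measurable [measurable]: "(\<lambda>p. fst p (snd p)) \<in> borel_measurable (\<mu> d \<Otimes>\<^sub>M \<nu>)"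
proof -
  obtain s :: "nat \<Rightarrow> fn" where s: "\<And>j. s j \<in> F d"
    and dense: "\<And>f e. f \<in> F d \<Longrightarrow> e > 0 \<Longrightarrow> \<exists>j. nF d (\<lambda>x. f x - s j x) < e"
    by (rule dense_sequence) blast
  \<comment> \<open>Index of the first member of the dense sequence within
    \<open>1 / (k + 1)\<close> of \<open>f\<close>; taking the least index makes the selection
    measurable.\<close>
  define J where "J = (\<lambda>k f. LEAST j. nF d (\<lambda>x. f x - s j x) < inverse (real (Suc k)))"
  have J: "nF d (\<lambda>x. f x - s (J k f) x) < inverse (real (Suc k))" if "f \<in> F d" for f k
    unfolding J_def by (rule LeastI_ex) (use dense[OF that, of "inverse (real (Suc k))"] in auto)
  have Jm: "J k \<in> measurable (\<mu> d) (count_space UNIV)" for k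
    unfolding J_def
  proof (rule measurable_Least)
    fix j
    show "(\<lambda>f. nF d (\<lambda>x. f x - s j x) < inverse (real (Suc k))) \<in> measurable (\<mu> d) (count_space UNIV)"
      using ball_measurable[OF s] by (subst pred_def) (simp add: space_\<mu>)
  qed
  have sm: "s j \<in> borel_measurable \<nu>" for j using sq_int_measurable[OF F_sq_int[OF s]] .
  show ?thesis
  proof (rule borel_measurable_LIMSEQ_real)
    show "(\<lambda>p. s (J k (fst p)) (snd p)) \<in> borel_measurable (\<mu> d \<Otimes>\<^sub>M \<nu>)" for k
    proof (rule measurable_compose_countable[where f = "\<lambda>j p. s j (snd p)"])
      show "(\<lambda>p. s j (snd p)) \<in> borel_measurable (\<mu> d \<Otimes>\<^sub>M \<nu>)" for j
        using sm[of j] by measurable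
      show "(\<lambda>p. J k (fst p)) \<in> measurable (\<mu> d \<Otimes>\<^sub>M \<nu>) (count_space UNIV)"
        using Jm[of k] by measurable
    qed
    fix p assume p: "p \<in> space (\<mu> d \<Otimes>\<^sub>M \<nu>)"
    obtain f x where fx: "p = (f, x)" by (cases p)
    then have f: "f \<in> F d" using p by (auto simp: space_pair_measure space_\<mu>)
    obtain C where C: "\<forall>f\<in>F d. \<bar>f x\<bar> \<le> C * nF d f" using point_bounded by blast
    have le: "\<bar>s (J k f) x - f x\<bar> \<le> \<bar>C\<bar> * inverse (real (Suc k))" for k
    proof -
      have h: "(\<lambda>x. f x - s (J k f) x) \<in> F d" by (rule F_diff[OF f s])
      have "\<bar>s (J k f) x - f x\<bar> \<le> C * nF d (\<lambda>x. f x - s (J k f) x)"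
        using bspec[OF C h] by (simp add: abs_minus_commute)
      also have "\<dots> \<le> \<bar>C\<bar> * inverse (real (Suc k))"
        using J[OF f, of k] nF_nonneg[OF h] by (intro mult_mono) auto
      finally show ?thesis .
    qed
    have "(\<lambda>k. s (J k f) x - f x) \<longlonglongrightarrow> 0"
    proof (rule Lim_null_comparison)
      show "\<forall>\<^sub>F k in sequentially. norm (s (J k f) x - f x) \<le> \<bar>C\<bar> * inverse (real (Suc k))"
        using le by simp
      show "(\<lambda>k. \<bar>C\<bar> * inverse (real (Suc k))) \<longlonglongrightarrow> 0"
        using tendsto_mult_right_zero[OF LIMSEQ_inverse_real_of_nat] .
    qed
    then show "(\<lambda>k. s (J k (fst p)) (snd p)) \<longlonglongrightarrow> fst p (snd p)"
      by (simp add: fx LIM_zero_iff)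
  qed
qed

lemma eval_measurable' [measurable]: "(\<lambda>p. snd p (fst p)) \<in> borel_measurable (\<nu> \<Otimes>\<^sub>M \<mu> d)"
  using measurable_compose[OF measurable_pair_swap' eval_measurable] by (simp add: split_beta)

section \<open>The second moment is finite\<close>

sublocale P: pair_sigma_finite "\<mu> d" \<nu> ..

text \<open>The covariance kernel of the Gaussian process \<open>f x\<close> on the diagonal; its
  integral over \<nu> is the mean squared norm.\<close>

definition K :: "pt \<Rightarrow> real" where
  "K x = (\<integral>f. (f x)\<^sup>2 \<partial>\<mu> d)"

lemma K_nonneg: "0 \<le> K x"
  by (simp add: K_def)

lemma ennreal_K: "ennreal (K x) = (\<integral>\<^sup>+f. ennreal ((f x)\<^sup>2) \<partial>\<mu> d)"
  unfolding K_def by (rule nn_integral_eq_integral[symmetric]) (use Lall_moments(1)[OF Lall_point] in auto)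

lemma K_measurable [measurable]: "K \<in> borel_measurable \<nu>"
  unfolding K_def by measurable

text \<open>Cauchy-Schwarz for the squares, with the Gaussian identity that a fourth moment is three
  times the squared variance. Integrated over \<open>x\<close> and \<open>y\<close>, it bounds the
  second moment of a truncated squared norm.\<close>

lemma fourth_moment_bound:
  "(\<integral>\<^sup>+f. ennreal ((f x)\<^sup>2) * ennreal ((f y)\<^sup>2) \<partial>\<mu> d) \<le> 3 * ennreal (K x) * ennreal (K y)"
proof -
  have s: "(\<lambda>f. (f x)\<^sup>2) \<in> sq_int (\<mu> d)" for x
    using Lall_moments(2)[OF Lall_point[of x]] Lall_measurable[OF Lall_point[of x]]
    by (simp add: sq_int_def power_mult[symmetric])
  have e: "ip (\<mu> d) (\<lambda>f. (f x)\<^sup>2) (\<lambda>f. (f x)\<^sup>2) = 3 * (K x)\<^sup>2" for x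
    using Lall_moments(3)[OF Lall_point[of x]] by (simp add: ip_self K_def power_mult[symmetric])
  have "(ip (\<mu> d) (\<lambda>f. (f x)\<^sup>2) (\<lambda>f. (f y)\<^sup>2))\<^sup>2 \<le> (3 * K x * K y)\<^sup>2"
    using ip_Cauchy_Schwarz[OF s s, of x y] by (simp add: e power_mult_distrib algebra_simps)
  then have le: "ip (\<mu> d) (\<lambda>f. (f x)\<^sup>2) (\<lambda>f. (f y)\<^sup>2) \<le> 3 * K x * K y"
    by (rule power2_le_imp_le) (simp add: K_nonneg)
  have "(\<integral>\<^sup>+f. ennreal ((f x)\<^sup>2) * ennreal ((f y)\<^sup>2) \<partial>\<mu> d) = (\<integral>\<^sup>+f. ennreal ((f x)\<^sup>2 * (f y)\<^sup>2) \<partial>\<mu> d)"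
    by (simp add: ennreal_mult')
  also have "\<dots> = ennreal (ip (\<mu> d) (\<lambda>f. (f x)\<^sup>2) (\<lambda>f. (f y)\<^sup>2))"
    unfolding ip_def by (rule nn_integral_eq_integral) (use sq_int_mult[OF s s] in auto)
  also have "\<dots> \<le> ennreal (3 * K x * K y)" by (rule ennreal_leI[OF le])
  also have "\<dots> = 3 * ennreal (K x) * ennreal (K y)" by (simp add: ennreal_mult' K_nonneg ennreal_mult'')
  finally show ?thesis .
qed

lemma norm2_measurable [measurable]: "(\<lambda>f. ip \<nu> f f) \<in> borel_measurable (\<mu> d)"
  unfolding ip_def by measurable

text \<open>Each single \<open>f\<close> has finite norm, so the tail events decrease to the empty
  set. The level 1/12 is small enough for the tail term in \<open>K_integral_bounded\<close> to be
  absorbed.\<close>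

lemma norm2_tail: "\<exists>R::nat. emeasure (\<mu> d) {f \<in> space (\<mu> d). real R < ip \<nu> f f} \<le> ennreal (1 / 12)"
proof -
  define A where "A = (\<lambda>n::nat. {f \<in> space (\<mu> d). real n < ip \<nu> f f})"
  have "(\<lambda>n. measure (\<mu> d) (A n)) \<longlonglongrightarrow> measure (\<mu> d) (\<Inter>n. A n)"
  proof (rule \<mu>.finite_Lim_measure_decseq)
    show "range A \<subseteq> sets (\<mu> d)" unfolding A_def by auto
    show "decseq A" unfolding A_def decseq_def by force
  qed
  moreover have "(\<Inter>n. A n) = {}"
  proof -
    have "f \<notin> (\<Inter>n. A n)" for f
    proof -
      obtain n :: nat where "ip \<nu> f f \<le> real n" using real_arch_simple by blast
      then have "f \<notin> A n" by (simp add: A_def)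
      then show ?thesis by blast
    qed
    then show ?thesis by blast
  qed
  ultimately have "(\<lambda>n. measure (\<mu> d) (A n)) \<longlonglongrightarrow> 0" by simp
  then have "\<forall>\<^sub>F n in sequentially. measure (\<mu> d) (A n) < 1 / 12" by (rule order_tendstoD) simp
  then obtain n where "measure (\<mu> d) (A n) < 1 / 12" by (auto simp: eventually_sequentially)
  then show ?thesis
    by (intro exI[of _ n]) (simp add: \<mu>.emeasure_eq_measure A_def ennreal_leI)
qed

text \<open>A Paley--Zygmund argument: truncating to \<open>{x. K x \<le> c}\<close> makes the mean finite, the second moment
  is at most three times the squared mean, and the tails are controlled since \<open>\<parallel>f\<parallel> < \<infinity>\<close> for all \<open>f\<close>.\<close>

lemma K_integral_bounded:
  assumes R: "emeasure (\<mu> d) {f \<in> space (\<mu> d). real R < ip \<nu> f f} \<le> ennreal (1 / 12)"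
  shows "(\<integral>\<^sup>+x. ennreal (K x) \<partial>\<nu>) \<le> ennreal (2 * real R)"
proof -
  have trunc: "(\<integral>\<^sup>+x. ennreal (K x) * indicator {x. K x \<le> real c} x \<partial>\<nu>) \<le> ennreal (2 * real R)" for c :: nat
  proof -
    let ?I = "\<lambda>x. indicator {x. K x \<le> real c} x :: ennreal"
    have [measurable]: "Measurable.pred \<nu> (\<lambda>x. K x \<le> real c)" by measurable
    have I[measurable]: "?I \<in> borel_measurable \<nu>" by measurable
    define X where "X = (\<lambda>f. \<integral>\<^sup>+x. ennreal ((f x)\<^sup>2) * ?I x \<partial>\<nu>)"
    have X[measurable]: "X \<in> borel_measurable (\<mu> d)" unfolding X_def by measurable
    define m where "m = (\<integral>\<^sup>+x. ennreal (K x) * ?I x \<partial>\<nu>)"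
    have mean: "(\<integral>\<^sup>+f. X f \<partial>\<mu> d) = m"
    proof -
      have "(\<integral>\<^sup>+f. X f \<partial>\<mu> d) = (\<integral>\<^sup>+x. \<integral>\<^sup>+f. ennreal ((f x)\<^sup>2) * ?I x \<partial>\<mu> d \<partial>\<nu>)"
        unfolding X_def by (rule P.Fubini'[symmetric]) measurable
      also have "\<dots> = m" unfolding m_def ennreal_K
        using Lall_measurable[OF Lall_point] by (intro nn_integral_cong nn_integral_multc) measurable
      finally show ?thesis .
    qed
    have second: "(\<integral>\<^sup>+f. X f * X f \<partial>\<mu> d) \<le> 3 * m * m"
    proof -
      have "(\<integral>\<^sup>+f. X f * X f \<partial>\<mu> d)
         = (\<integral>\<^sup>+f. \<integral>\<^sup>+x. X f * (ennreal ((f x)\<^sup>2) * ?I x) \<partial>\<nu> \<partial>\<mu> d)"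
        unfolding X_def by (intro nn_integral_cong nn_integral_cmult[symmetric]) (measurable; simp add: space_\<mu> F_sq_int sq_int_measurable)
      also have "\<dots> = (\<integral>\<^sup>+x. \<integral>\<^sup>+f. X f * (ennreal ((f x)\<^sup>2) * ?I x) \<partial>\<mu> d \<partial>\<nu>)"
        by (rule P.Fubini'[symmetric]) measurable
      also have "\<dots> \<le> (\<integral>\<^sup>+x. (3 * m) * (ennreal (K x) * ?I x) \<partial>\<nu>)"
      proof (rule nn_integral_mono)
        fix x assume x: "x \<in> space \<nu>"
        have [measurable]: "(\<lambda>f. f x) \<in> borel_measurable (\<mu> d)" by (rule Lall_measurable[OF Lall_point])
        have "(\<integral>\<^sup>+f. X f * (ennreal ((f x)\<^sup>2) * ?I x) \<partial>\<mu> d)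
           = (\<integral>\<^sup>+f. \<integral>\<^sup>+y. (ennreal ((f x)\<^sup>2) * ?I x) * (ennreal ((f y)\<^sup>2) * ?I y) \<partial>\<nu> \<partial>\<mu> d)"
          unfolding X_def
          by (intro nn_integral_cong, subst nn_integral_cmult)
            (auto simp: space_\<mu> mult.commute intro!: borel_measurable_times_ennreal sq_int_measurable F_sq_int measurable_compose[OF _ measurable_ennreal] borel_measurable_power)
        also have "\<dots> = (\<integral>\<^sup>+y. \<integral>\<^sup>+f. (ennreal ((f x)\<^sup>2) * ?I x) * (ennreal ((f y)\<^sup>2) * ?I y) \<partial>\<mu> d \<partial>\<nu>)"
          by (rule P.Fubini'[symmetric]) measurable
        also have "\<dots> \<le> (\<integral>\<^sup>+y. (3 * ennreal (K x) * ?I x) * (ennreal (K y) * ?I y) \<partial>\<nu>)"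
        proof (rule nn_integral_mono)
          fix y
          have [measurable]: "(\<lambda>f. f y) \<in> borel_measurable (\<mu> d)" by (rule Lall_measurable[OF Lall_point])
          have "(\<integral>\<^sup>+f. (ennreal ((f x)\<^sup>2) * ?I x) * (ennreal ((f y)\<^sup>2) * ?I y) \<partial>\<mu> d)
            = (\<integral>\<^sup>+f. (?I x * ?I y) * (ennreal ((f x)\<^sup>2) * ennreal ((f y)\<^sup>2)) \<partial>\<mu> d)"
            by (simp add: mult_ac)
          also have "\<dots> = (?I x * ?I y) * (\<integral>\<^sup>+f. ennreal ((f x)\<^sup>2) * ennreal ((f y)\<^sup>2) \<partial>\<mu> d)"
            by (rule nn_integral_cmult) measurable
          also have "\<dots> \<le> (?I x * ?I y) * (3 * ennreal (K x) * ennreal (K y))"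
            by (rule mult_left_mono[OF fourth_moment_bound]) simp
          finally show "(\<integral>\<^sup>+f. (ennreal ((f x)\<^sup>2) * ?I x) * (ennreal ((f y)\<^sup>2) * ?I y) \<partial>\<mu> d)
            \<le> (3 * ennreal (K x) * ?I x) * (ennreal (K y) * ?I y)" by (simp add: mult_ac)
        qed
        also have "\<dots> = (3 * ennreal (K x) * ?I x) * m"
          unfolding m_def by (rule nn_integral_cmult) measurable
        finally show "(\<integral>\<^sup>+f. X f * (ennreal ((f x)\<^sup>2) * ?I x) \<partial>\<mu> d) \<le> (3 * m) * (ennreal (K x) * ?I x)"
          by (simp add: mult_ac)
      qed
      also have "\<dots> = 3 * m * m" by (subst nn_integral_cmult) (simp_all add: m_def)
      finally show ?thesis .
    qed
    \<comment> \<open>Truncation makes the mean \<open>m\<close> finite, which is what allows half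
      of it to be subtracted at the end.\<close>
    have "m \<le> (\<integral>\<^sup>+x. ennreal (real c) \<partial>\<nu>)" unfolding m_def
      by (rule nn_integral_mono) (auto simp: indicator_def intro: ennreal_leI)
    also have "\<dots> = ennreal (real c)" by (simp add: \<nu>.emeasure_space_1)
    finally have "m \<noteq> \<infinity>" by (auto simp: top_unique)
    then obtain a where a: "a \<ge> 0" "m = ennreal a" by (cases m) auto
    have "a \<le> 2 * real R"
    proof (cases "a = 0")
      case False
      then have a0: "a > 0" using a by simp
      let ?T = "{f \<in> space (\<mu> d). real R < ip \<nu> f f}"
      \<comment> \<open>Off the tail event, \<open>X f\<close> is at most \<open>R\<close>. On it,
        \<open>(r - 6 * a)^2 \<ge> 0\<close> gives \<open>r \<le> r^2 / (12 * a) + 3 * a\<close>.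
        After integration the last two terms contribute at most \<open>a / 4\<close> each, so
        \<open>a \<le> R + a / 2\<close>.\<close>
      have pw: "X f \<le> ennreal (real R) + ennreal (1 / (12 * a)) * (X f * X f) + ennreal (3 * a) * indicator ?T f"
        if f: "f \<in> space (\<mu> d)" for f
      proof -
        have f2: "f \<in> sq_int \<nu>" using f F_sq_int by (simp add: space_\<mu>)
        have "X f \<le> (\<integral>\<^sup>+x. ennreal ((f x)\<^sup>2) \<partial>\<nu>)"
          unfolding X_def by (rule nn_integral_mono) (auto simp: indicator_def)
        also have "\<dots> = ennreal (ip \<nu> f f)"
          unfolding ip_self by (rule nn_integral_eq_integral) (use sq_int_square[OF f2] in auto)
        finally have le: "X f \<le> ennreal (ip \<nu> f f)" .
        then obtain r where r: "r \<ge> 0" "X f = ennreal r" by (cases "X f") (auto simp: top_unique)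
        then have rle: "r \<le> ip \<nu> f f" using le by (simp add: ennreal_le_iff ip_nonneg)
        have "r \<le> real R + 1 / (12 * a) * (r * r) + 3 * a * indicator ?T f"
        proof (cases "f \<in> ?T")
          case True
          have "0 \<le> (r - 6 * a)\<^sup>2 / (12 * a)" using a0 by simp
          also have "(r - 6 * a)\<^sup>2 / (12 * a) = 1 / (12 * a) * (r * r) - r + 3 * a"
            using a0 by (simp add: power2_eq_square field_simps)
          finally show ?thesis using True by simp
        next
          case False
          then have "r \<le> real R" using f rle by auto
          moreover have "0 \<le> 1 / (12 * a) * (r * r)" using a0 r by simp
          ultimately show ?thesis using False by simp
        qed
        then have "ennreal r \<le> ennreal (real R + 1 / (12 * a) * (r * r) + 3 * a * indicator ?T f)"
          by (rule ennreal_leI)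
        also have "\<dots> = ennreal (real R) + ennreal (1 / (12 * a)) * (ennreal r * ennreal r) + ennreal (3 * a) * indicator ?T f"
        proof -
          have "ennreal (1 / (12 * a) * (r * r)) = ennreal (1 / (12 * a)) * (ennreal r * ennreal r)"
            using a0 r by (subst ennreal_mult, simp, simp, subst ennreal_mult) auto
          moreover have "ennreal (3 * a * indicator ?T f) = ennreal (3 * a) * indicator ?T f"
            using a0 by (subst ennreal_mult) (auto simp: ennreal_indicator)
          moreover have "0 \<le> 1 / (12 * a) * (r * r)" "0 \<le> 3 * a * indicator ?T f" using a0 r by auto
          ultimately show ?thesis by (simp only: ennreal_plus add_nonneg_nonneg of_nat_0_le_iff)
        qed
        finally show ?thesis by (simp add: r)
      qed
      have "m \<le> (\<integral>\<^sup>+f. ennreal (real R) + ennreal (1 / (12 * a)) * (X f * X f) + ennreal (3 * a) * indicator ?T f \<partial>\<mu> d)"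
        unfolding mean[symmetric] by (rule nn_integral_mono[OF pw])
      also have "\<dots> = ennreal (real R) + ennreal (1 / (12 * a)) * (\<integral>\<^sup>+f. X f * X f \<partial>\<mu> d) + ennreal (3 * a) * emeasure (\<mu> d) ?T"
      proof -
        have T: "?T \<in> sets (\<mu> d)" by measurable
        have "(\<integral>\<^sup>+f. ennreal (1 / (12 * a)) * (X f * X f) \<partial>\<mu> d) = ennreal (1 / (12 * a)) * (\<integral>\<^sup>+f. X f * X f \<partial>\<mu> d)"
          by (rule nn_integral_cmult) measurable
        moreover have "(\<integral>\<^sup>+f. ennreal (3 * a) * indicator ?T f \<partial>\<mu> d) = ennreal (3 * a) * emeasure (\<mu> d) ?T"
          by (rule nn_integral_cmult_indicator[OF T])
        ultimately show ?thesis
          using T by (subst nn_integral_add, measurable, subst nn_integral_add, measurable)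
            (simp only: nn_integral_const \<mu>.emeasure_space_1 mult_1_right)
      qed
      also have "\<dots> \<le> ennreal (real R) + ennreal (1 / (12 * a)) * (3 * m * m) + ennreal (3 * a) * ennreal (1 / 12)"
        by (intro add_mono mult_left_mono second R order_refl) auto
      also have "\<dots> = ennreal (real R + 1 / (12 * a) * (3 * a * a) + 3 * a * (1 / 12))"
      proof -
        have "ennreal (1 / (12 * a) * (3 * a * a)) = ennreal (1 / (12 * a)) * (3 * ennreal a * ennreal a)"
          using a0 by (subst ennreal_mult, simp, simp, subst ennreal_mult, simp, simp, subst ennreal_mult) auto
        moreover have "ennreal (3 * a * (1 / 12)) = ennreal (3 * a) * ennreal (1 / 12)"
          using a0 by (subst ennreal_mult) auto
        moreover have "0 \<le> 1 / (12 * a) * (3 * a * a)" "0 \<le> 3 * a * (1 / 12)" using a0 by auto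
        ultimately show ?thesis unfolding a
          by (simp only: ennreal_plus add_nonneg_nonneg of_nat_0_le_iff)
      qed
      also have "real R + 1 / (12 * a) * (3 * a * a) + 3 * a * (1 / 12) = real R + a / 2"
        using a0 by (simp add: field_simps)
      finally have "a \<le> real R + a / 2"
        using a0 unfolding a by (subst (asm) ennreal_le_iff) auto
      then show ?thesis by simp
    qed simp
    then show ?thesis using a by (simp add: m_def[symmetric] ennreal_leI)
  qed
  \<comment> \<open>The bound is uniform in the truncation level, so monotone convergence removes
    it.\<close>
  have "(\<integral>\<^sup>+x. ennreal (K x) \<partial>\<nu>) = (\<integral>\<^sup>+x. (SUP c::nat. ennreal (K x) * indicator {x. K x \<le> real c} x) \<partial>\<nu>)"
  proof (rule nn_integral_cong)
    fix x
    obtain c :: nat where c: "K x \<le> real c" using real_arch_simple by blast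
    show "ennreal (K x) = (SUP c::nat. ennreal (K x) * indicator {x. K x \<le> real c} x)"
    proof (rule antisym)
      show "ennreal (K x) \<le> (SUP c::nat. ennreal (K x) * indicator {x. K x \<le> real c} x)"
        by (rule SUP_upper2[of c]) (use c in auto)
      show "(SUP c::nat. ennreal (K x) * indicator {x. K x \<le> real c} x) \<le> ennreal (K x)"
        by (rule SUP_least) (auto simp: indicator_def)
    qed
  qed
  also have "\<dots> = (SUP c::nat. \<integral>\<^sup>+x. ennreal (K x) * indicator {x. K x \<le> real c} x \<partial>\<nu>)"
  proof (rule nn_integral_monotone_convergence_SUP)
    show "incseq (\<lambda>(c::nat) x. ennreal (K x) * indicator {x. K x \<le> real c} x)"
      by (auto simp: incseq_def le_fun_def indicator_def)
    show "(\<lambda>x. ennreal (K x) * indicator {x. K x \<le> real c} x) \<in> borel_measurable \<nu>" for c :: nat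
      by measurable
  qed
  also have "\<dots> \<le> ennreal (2 * real R)" by (rule SUP_least[OF trunc])
  finally show ?thesis .
qed

text \<open>By Tonelli the mean squared norm is the integral of \<open>K\<close>. This weak form of
  Fernique's theorem supplies the integrable majorant for all residuals below.\<close>

lemma norm2_integrable: "integrable (\<mu> d) (\<lambda>f. ip \<nu> f f)"
proof -
  obtain R where R: "emeasure (\<mu> d) {f \<in> space (\<mu> d). real R < ip \<nu> f f} \<le> ennreal (1 / 12)"
    using norm2_tail by blast
  have "(\<integral>\<^sup>+f. ennreal (ip \<nu> f f) \<partial>\<mu> d) = (\<integral>\<^sup>+f. \<integral>\<^sup>+x. ennreal ((f x)\<^sup>2) \<partial>\<nu> \<partial>\<mu> d)"
    unfolding ip_self
    by (intro nn_integral_cong nn_integral_eq_integral[symmetric]) (auto simp: space_\<mu> intro: sq_int_square F_sq_int)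
  also have "\<dots> = (\<integral>\<^sup>+x. \<integral>\<^sup>+f. ennreal ((f x)\<^sup>2) \<partial>\<mu> d \<partial>\<nu>)"
    by (rule P.Fubini'[symmetric]) measurable
  also have "\<dots> \<le> ennreal (2 * real R)"
    using K_integral_bounded[OF R] by (simp add: ennreal_K)
  also have "\<dots> < \<infinity>" by simp
  finally have "(\<integral>\<^sup>+f. ennreal (ip \<nu> f f) \<partial>\<mu> d) < \<infinity>" .
  then show ?thesis
    by (intro integrableI_nonneg) (simp_all add: ip_nonneg)
qed

section \<open>Reduction to a subspace of dimension n\<close>

text \<open>By \<open>orthonormal_dist\<close> this difference is the squared distance of
  \<open>f\<close> to the span of the \<open>u k\<close>. In this form its measurability in
  \<open>f\<close> is immediate.\<close>

lemma residual_bounds: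
  assumes u: "orthonormal \<nu> u m" and f: "f \<in> F d"
  shows "0 \<le> ip \<nu> f f - (\<Sum>k<m. (ip \<nu> f (u k))\<^sup>2)"
    and "ip \<nu> f f - (\<Sum>k<m. (ip \<nu> f (u k))\<^sup>2) \<le> ip \<nu> f f"
  using orthonormal_Bessel[OF u F_sq_int[OF f]] by (auto intro!: sum_nonneg)

lemma residual_measurable:
  assumes u: "orthonormal \<nu> u m"
  shows "(\<lambda>f. ip \<nu> f f - (\<Sum>k<m. (ip \<nu> f (u k))\<^sup>2)) \<in> borel_measurable (\<mu> d)"
proof -
  have "(\<lambda>f. ip \<nu> f (u k)) \<in> borel_measurable (\<mu> d)" if "k < m" for k
    using u that by (intro Lall_measurable Lall_ip) (auto simp: orthonormal_def)
  then show ?thesis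
    by (intro borel_measurable_diff norm2_measurable borel_measurable_sum borel_measurable_power) auto
qed

lemma residual_integrable:
  assumes u: "orthonormal \<nu> u m"
  shows "integrable (\<mu> d) (\<lambda>f. ip \<nu> f f - (\<Sum>k<m. (ip \<nu> f (u k))\<^sup>2))"
  by (rule Bochner_Integration.integrable_bound[OF norm2_integrable residual_measurable[OF u]])
    (use residual_bounds[OF u] in \<open>auto simp: space_\<mu> abs_of_nonneg[OF ip_nonneg] intro!: AE_I2\<close>)

text \<open>The spans of the first \<open>J\<close> members of a dense sequence exhaust
  \<open>F d\<close>, and the embedding carries this over to the norm of G_d. Dominated convergence
  with majorant \<open>ip \<nu> f f\<close> passes to the mean.\<close>

lemma finite_rank_approx:
  assumes \<delta>: "\<delta> > 0"
  obtains r u where "orthonormal \<nu> u r"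
    "(\<integral>f. ip \<nu> f f - (\<Sum>k<r. (ip \<nu> f (u k))\<^sup>2) \<partial>\<mu> d) \<le> \<delta>"
proof -
  obtain s :: "nat \<Rightarrow> fn" where s: "\<And>j. s j \<in> F d"
    and dense: "\<And>f e. f \<in> F d \<Longrightarrow> e > 0 \<Longrightarrow> \<exists>j. nF d (\<lambda>x. f x - s j x) < e"
    by (rule dense_sequence) blast
  have "\<forall>J. \<exists>m u. orthonormal \<nu> u m \<and>
      (\<forall>g i. g \<in> sq_int \<nu> \<longrightarrow> (\<forall>k<m. ip \<nu> g (u k) = 0) \<longrightarrow> i < J \<longrightarrow> ip \<nu> g (s i) = 0)"
  proof
    fix J
    obtain m u where "orthonormal \<nu> u m"
      "\<And>g i. g \<in> sq_int \<nu> \<Longrightarrow> (\<And>k. k < m \<Longrightarrow> ip \<nu> g (u k) = 0) \<Longrightarrow> i < J \<Longrightarrow> ip \<nu> g (s i) = 0"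
      by (rule orthonormalize[OF lin_closed_sq_int order_refl, of J s \<nu>]) (use s F_sq_int in blast)+
    then show "\<exists>m u. orthonormal \<nu> u m \<and>
      (\<forall>g i. g \<in> sq_int \<nu> \<longrightarrow> (\<forall>k<m. ip \<nu> g (u k) = 0) \<longrightarrow> i < J \<longrightarrow> ip \<nu> g (s i) = 0)" by blast
  qed
  then obtain m u where u: "\<And>J. orthonormal \<nu> (u J) (m J)"
    and sp: "\<And>J g i. g \<in> sq_int \<nu> \<Longrightarrow> (\<And>k. k < m J \<Longrightarrow> ip \<nu> g (u J k) = 0) \<Longrightarrow> i < J \<Longrightarrow> ip \<nu> g (s i) = 0"
    by metis
  define e where "e = (\<lambda>J f. ip \<nu> f f - (\<Sum>k<m J. (ip \<nu> f (u J k))\<^sup>2))"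
  obtain C where C: "C \<ge> 0" "\<forall>f\<in>F d. ip \<nu> f f \<le> (C * nF d f)\<^sup>2" using embedding_const by blast
  have lim: "(\<lambda>J. e J f) \<longlonglongrightarrow> 0" if f: "f \<in> F d" for f
  proof (rule LIMSEQ_I)
    fix t :: real assume t: "t > 0"
    \<comment> \<open>Any \<open>t'\<close> with \<open>C * t' < sqrt t\<close> works; adding 1 to
      \<open>C\<close> covers \<open>C = 0\<close>.\<close>
    define t' where "t' = sqrt t / (C + 1)"
    have t': "t' > 0" using t C by (simp add: t'_def)
    obtain j where j: "nF d (\<lambda>x. f x - s j x) < t'" using dense[OF f t'] by blast
    have h: "(\<lambda>x. f x - s j x) \<in> F d" by (rule F_diff[OF f s])
    have "norm (e J f - 0) < t" if J: "J \<ge> Suc j" for J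
    proof -
      \<comment> \<open>The competitor is the single vector \<open>s j\<close> with coefficient
        1.\<close>
      have "e J f \<le> ip \<nu> (\<lambda>x. f x - (\<Sum>i\<in>{j}. 1 * s i x)) (\<lambda>x. f x - (\<Sum>i\<in>{j}. 1 * s i x))"
        unfolding e_def
      proof (rule orthonormal_best_approx[OF u F_sq_int[OF f]])
        show "ip \<nu> g (s i) = 0" if "g \<in> sq_int \<nu>" "\<And>k. k < m J \<Longrightarrow> ip \<nu> g (u J k) = 0" "i \<in> {j}" for g i
          using J that(3) by (intro sp[OF that(1,2)]) auto
      qed (use s F_sq_int in auto)
      also have "\<dots> \<le> (C * nF d (\<lambda>x. f x - s j x))\<^sup>2" using bspec[OF C(2) h] by simp
      also have "\<dots> < (sqrt t)\<^sup>2"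
      proof (rule power_strict_mono)
        have "C * nF d (\<lambda>x. f x - s j x) \<le> C * t'" using C j by (intro mult_left_mono) auto
        also have "\<dots> < (C + 1) * t'" using t' by simp
        also have "\<dots> = sqrt t" using C by (simp add: t'_def)
        finally show "C * nF d (\<lambda>x. f x - s j x) < sqrt t" .
      qed (use C nF_nonneg[OF h] in auto)
      finally show ?thesis using residual_bounds(1)[OF u f, of J] t by (simp add: e_def)
    qed
    then show "\<exists>no. \<forall>n\<ge>no. norm (e n f - 0) < t" by blast
  qed
  have "(\<lambda>J. \<integral>f. e J f \<partial>\<mu> d) \<longlonglongrightarrow> (\<integral>f. 0 \<partial>\<mu> d)"
  proof (rule integral_dominated_convergence[where w = "\<lambda>f. ip \<nu> f f"])
    show "e J \<in> borel_measurable (\<mu> d)" for J unfolding e_def by (rule residual_measurable[OF u])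
    show "AE f in \<mu> d. (\<lambda>J. e J f) \<longlonglongrightarrow> 0" using lim by (intro AE_I2) (simp add: space_\<mu>)
    show "AE f in \<mu> d. norm (e J f) \<le> ip \<nu> f f" for J
      using residual_bounds[OF u] by (intro AE_I2) (auto simp: space_\<mu> e_def)
  qed (use norm2_integrable in auto)
  then have "\<forall>\<^sub>F J in sequentially. (\<integral>f. e J f \<partial>\<mu> d) < \<delta>"
    using \<delta> by (intro order_tendstoD(2)[of _ "\<integral>f. 0 \<partial>\<mu> d"]) auto
  then obtain J where "(\<integral>f. e J f \<partial>\<mu> d) < \<delta>" by (auto simp: eventually_sequentially)
  then show ?thesis using that[OF u[of J]] by (simp add: e_def)
qed

text \<open>Makes each coefficient of the output of an algorithm a measurable scalar estimator, the
  form that \<open>regression_lower_bound\<close> requires.\<close>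

lemma algs_coefficient_measurable:
  assumes A: "(L, \<phi>) \<in> algs D \<rho> Lam d n" and q: "q \<in> sq_int \<nu>"
  shows "(\<lambda>y. ip \<nu> (\<phi> y) q) \<in> borel_measurable (borelR n)"
proof -
  have \<phi>: "\<phi> y \<in> sq_int \<nu>" for y using A by (auto simp: algs_def Gspace_eq)
  have G: "(\<lambda>y. ip \<nu> (\<lambda>x. \<phi> y x - g x) (\<lambda>x. \<phi> y x - g x)) \<in> borel_measurable (borelR n)"
    if g: "g \<in> sq_int \<nu>" for g
  proof -
    have [measurable]: "(\<lambda>y. Gnorm2 D \<rho> d (\<lambda>x. \<phi> y x - g x)) \<in> borel_measurable (borelR n)"
    proof (rule borel_measurableI_less)
      fix r :: ennreal
      show "{y \<in> space (borelR n). Gnorm2 D \<rho> d (\<lambda>x. \<phi> y x - g x) < r} \<in> sets (borelR n)"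
        using A g by (auto simp: algs_def Gspace_eq)
    qed
    have "(\<lambda>y. ip \<nu> (\<lambda>x. \<phi> y x - g x) (\<lambda>x. \<phi> y x - g x))
        = (\<lambda>y. enn2real (Gnorm2 D \<rho> d (\<lambda>x. \<phi> y x - g x)))"
      by (rule ext) (simp add: Gnorm2_ip[OF sq_int_diff[OF \<phi> g]] ip_nonneg)
    then show ?thesis by simp
  qed
  have "(\<lambda>x. - q x) \<in> sq_int \<nu>" using sq_int_scale[OF q, of "-1"] by simp
  from G[OF this] G[OF q] show ?thesis
    unfolding ip_polarization[OF \<phi> q] by measurable
qed

text \<open>Fix finitely many \<open>u k\<close> that capture \<open>f\<close> up to \<delta>. For
  each coefficient \<open>X k\<close>, linear regression on the information is at least as good as
  the estimate made by the algorithm. Summing over \<open>k\<close>, Bessel's inequality bounds the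
  total regression error by the error of the algorithm, however large \<open>r\<close> is.\<close>

lemma linear_reduction:
  assumes A: "(L, \<phi>) \<in> algs D \<rho> (Lall F nF) d n"
    and err: "err2 D \<rho> \<mu> d n L \<phi> \<le> ennreal E" and E: "E \<ge> 0" and \<delta>: "\<delta> > 0"
  obtains m w where "m \<le> n" "orthonormal \<nu> w m"
    "(\<integral>f. ip \<nu> f f - (\<Sum>j<m. (ip \<nu> f (w j))\<^sup>2) \<partial>\<mu> d) \<le> E + \<delta>"
proof -
  have L: "\<And>i. i < n \<Longrightarrow> L i \<in> Lall F nF d" using A by (auto simp: algs_def)
  have \<phi>: "\<phi> y \<in> sq_int \<nu>" for y using A by (auto simp: algs_def Gspace_eq)
  obtain r u where u: "orthonormal \<nu> u r"
    and u\<delta>: "(\<integral>f. ip \<nu> f f - (\<Sum>k<r. (ip \<nu> f (u k))\<^sup>2) \<partial>\<mu> d) \<le> \<delta>"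
    by (rule finite_rank_approx[OF \<delta>])
  have u2: "\<And>k. k < r \<Longrightarrow> u k \<in> sq_int \<nu>" using u by (simp add: orthonormal_def)
  define X where "X = (\<lambda>k f. ip \<nu> f (u k))"
  have XL: "\<And>k. k < r \<Longrightarrow> X k \<in> Lall F nF d" unfolding X_def by (rule Lall_ip[OF u2])
  have X2: "\<And>k. k < r \<Longrightarrow> X k \<in> sq_int (\<mu> d)" using XL Lall_sq_int by blast
  \<comment> \<open>An orthonormal system for the information, in the space of random variables;
    \<open>w\<close> below is orthonormal in G_d instead. The count \<open>q\<close> is below
    \<open>n\<close> if some functionals are redundant.\<close>
  obtain q U where q: "q \<le> n" and U: "orthonormal (\<mu> d) U q" and UL: "\<And>l. l < q \<Longrightarrow> U l \<in> Lall F nF d"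
    and sp: "\<And>g i. g \<in> sq_int (\<mu> d) \<Longrightarrow> (\<And>l. l < q \<Longrightarrow> ip (\<mu> d) g (U l) = 0) \<Longrightarrow> i < n \<Longrightarrow> ip (\<mu> d) g (L i) = 0"
    by (rule orthonormalize[OF Lall_lin Lall_sq_int, of n L]) (use L in blast)+
  define T where "T = (\<lambda>f. restrict (\<lambda>i. L i f) {..<n})"
  have T[measurable]: "T \<in> measurable (\<mu> d) (PiM {..<n} (\<lambda>_. borel))"
    unfolding T_def by (rule measurable_restrict) (use L in \<open>auto intro: Lall_measurable\<close>)
  define \<psi> where "\<psi> = (\<lambda>k y. ip \<nu> (\<phi> y) (u k))"
  have \<psi>: "\<psi> k \<in> borel_measurable (PiM {..<n} (\<lambda>_. borel))" if "k < r" for k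
    using algs_coefficient_measurable[OF A u2[OF that]] by (simp add: \<psi>_def borelR_def)
  define V where "V = (\<lambda>k. ip (\<mu> d) (X k) (X k) - (\<Sum>l<q. (ip (\<mu> d) (X k) (U l))\<^sup>2))"
  have V0: "0 \<le> V k" if "k < r" for k
    unfolding V_def using orthonormal_Bessel[OF U X2[OF that]] by simp
  have "ennreal (\<Sum>k<r. V k) = (\<Sum>k<r. ennreal (V k))" using V0 by (intro sum_ennreal[symmetric]) auto
  also have "\<dots> \<le> (\<Sum>k<r. \<integral>\<^sup>+f. ennreal ((X k f - \<psi> k (T f))\<^sup>2) \<partial>\<mu> d)"
    unfolding V_def T_def
    by (intro sum_mono regression_lower_bound[OF L U UL sp]) (auto intro: XL \<psi>)
  also have "\<dots> = (\<integral>\<^sup>+f. (\<Sum>k<r. ennreal ((X k f - \<psi> k (T f))\<^sup>2)) \<partial>\<mu> d)"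
  proof (rule nn_integral_sum[symmetric])
    fix k assume "k \<in> {..<r}"
    then have [measurable]: "X k \<in> borel_measurable (\<mu> d)" "\<psi> k \<in> borel_measurable (PiM {..<n} (\<lambda>_. borel))"
      using \<psi> Lall_measurable[OF XL] by auto
    show "(\<lambda>f. ennreal ((X k f - \<psi> k (T f))\<^sup>2)) \<in> borel_measurable (\<mu> d)" by measurable
  qed
  also have "\<dots> \<le> err2 D \<rho> \<mu> d n L \<phi>"
    unfolding err2_def
  proof (rule nn_integral_mono)
    fix f assume "f \<in> space (\<mu> d)"
    then have f2: "f \<in> sq_int \<nu>" by (simp add: space_\<mu> F_sq_int)
    have h: "(\<lambda>x. f x - \<phi> (T f) x) \<in> sq_int \<nu>" by (rule sq_int_diff[OF f2 \<phi>])
    have "(\<Sum>k<r. ennreal ((X k f - \<psi> k (T f))\<^sup>2)) = ennreal (\<Sum>k<r. (ip \<nu> (\<lambda>x. f x - \<phi> (T f) x) (u k))\<^sup>2)"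
      using ip_diff[OF f2 \<phi> u2] by (simp add: sum_ennreal X_def \<psi>_def)
    also have "\<dots> \<le> ennreal (ip \<nu> (\<lambda>x. f x - \<phi> (T f) x) (\<lambda>x. f x - \<phi> (T f) x))"
      by (rule ennreal_leI[OF orthonormal_Bessel[OF u h]])
    finally show "(\<Sum>k<r. ennreal ((X k f - \<psi> k (T f))\<^sup>2)) \<le> Gnorm2 D \<rho> d (\<lambda>x. f x - \<phi> (restrict (\<lambda>i. L i f) {..<n}) x)"
      using Gnorm2_ip[OF h] by (simp add: T_def)
  qed
  finally have VE: "(\<Sum>k<r. V k) \<le> E" using err E by (metis ennreal_le_iff order_trans)
  define c where "c = (\<lambda>k f. \<Sum>l<q. ip (\<mu> d) (X k) (U l) * U l f)"
  have c2: "c k \<in> sq_int (\<mu> d)" for k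
    unfolding c_def by (rule sq_int_sum) (use UL Lall_sq_int in auto)
  have Vc: "integrable (\<mu> d) (\<lambda>f. (X k f - c k f)\<^sup>2)" "(\<integral>f. (X k f - c k f)\<^sup>2 \<partial>\<mu> d) = V k" if "k < r" for k
    using orthonormal_dist[OF U X2[OF that], of "\<lambda>l. ip (\<mu> d) (X k) (U l)"] sq_int_square[OF sq_int_diff[OF X2[OF that] c2]]
    by (simp_all add: ip_self c_def V_def)
  \<comment> \<open>Exchanging the two sums rewrites the regression estimate, the sum of
    \<open>c k f * u k\<close>, as the sum of \<open>U l f * g l\<close>. All estimates thus lie in
    the span of \<open>q\<close> functions, whatever the value of \<open>r\<close>.\<close>
  define g where "g = (\<lambda>l x. \<Sum>k<r. ip (\<mu> d) (X k) (U l) * u k x)"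
  have g2: "g l \<in> sq_int \<nu>" for l unfolding g_def by (rule sq_int_sum) (use u2 in auto)
  obtain m w where m: "m \<le> q" and w: "orthonormal \<nu> w m"
    and spw: "\<And>h l. h \<in> sq_int \<nu> \<Longrightarrow> (\<And>j. j < m \<Longrightarrow> ip \<nu> h (w j) = 0) \<Longrightarrow> l < q \<Longrightarrow> ip \<nu> h (g l) = 0"
    by (rule orthonormalize[OF lin_closed_sq_int order_refl, of q g \<nu>]) (use g2 in blast)+
  have pw: "ip \<nu> f f - (\<Sum>j<m. (ip \<nu> f (w j))\<^sup>2)
      \<le> (ip \<nu> f f - (\<Sum>k<r. (ip \<nu> f (u k))\<^sup>2)) + (\<Sum>k<r. (X k f - c k f)\<^sup>2)" if f: "f \<in> F d" for f
  proof -
    have f2: "f \<in> sq_int \<nu>" by (rule F_sq_int[OF f])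
    have "ip \<nu> f f - (\<Sum>j<m. (ip \<nu> f (w j))\<^sup>2)
       \<le> ip \<nu> (\<lambda>x. f x - (\<Sum>l<q. U l f * g l x)) (\<lambda>x. f x - (\<Sum>l<q. U l f * g l x))"
      by (rule orthonormal_best_approx[OF w f2]) (use g2 spw in auto)
    also have "(\<lambda>x. f x - (\<Sum>l<q. U l f * g l x)) = (\<lambda>x. f x - (\<Sum>k<r. c k f * u k x))"
      unfolding g_def c_def sum_distrib_left sum_distrib_right
      by (subst sum.swap) (simp add: mult_ac)
    also have "ip \<nu> \<dots> \<dots> = (ip \<nu> f f - (\<Sum>k<r. (ip \<nu> f (u k))\<^sup>2)) + (\<Sum>k<r. (X k f - c k f)\<^sup>2)"
      unfolding orthonormal_dist[OF u f2] by (simp add: X_def)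
    finally show ?thesis .
  qed
  have "(\<integral>f. ip \<nu> f f - (\<Sum>j<m. (ip \<nu> f (w j))\<^sup>2) \<partial>\<mu> d)
     \<le> (\<integral>f. (ip \<nu> f f - (\<Sum>k<r. (ip \<nu> f (u k))\<^sup>2)) + (\<Sum>k<r. (X k f - c k f)\<^sup>2) \<partial>\<mu> d)"
    using residual_integrable[OF w] residual_integrable[OF u] Vc(1) pw
    by (intro integral_mono Bochner_Integration.integrable_add Bochner_Integration.integrable_sum) (auto simp: space_\<mu>)
  also have "\<dots> = (\<integral>f. ip \<nu> f f - (\<Sum>k<r. (ip \<nu> f (u k))\<^sup>2) \<partial>\<mu> d) + (\<Sum>k<r. V k)"
    using residual_integrable[OF u] Vc
    by (subst Bochner_Integration.integral_add) (auto simp: Bochner_Integration.integral_sum)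
  also have "\<dots> \<le> E + \<delta>" using u\<delta> VE by simp
  finally show ?thesis using that m q w by (meson order_trans)
qed

end

section \<open>Selection of sample points\<close>

text \<open>Each new point is chosen so that the functional is at most its conditional expectation;
  the mixed terms vanish because the \<open>Y j\<close> have mean zero.\<close>

lemma (in prob_space) select_points:
  fixes Y :: "'j \<Rightarrow> 'a \<Rightarrow> real"
  assumes J: "finite J"
    and Y: "\<And>j. j \<in> J \<Longrightarrow> Y j \<in> sq_int M" and Y0: "\<And>j. j \<in> J \<Longrightarrow> expectation (Y j) = 0"
    and Y2: "(\<Sum>j\<in>J. expectation (\<lambda>x. (Y j x)\<^sup>2)) \<le> 1"
    and \<kappa>: "integrable M \<kappa>" "expectation \<kappa> \<le> 1"
    and G: "AE x in M. x \<in> G"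
  shows "\<exists>x. (\<forall>i<N. x i \<in> G) \<and>
    (\<Sum>j\<in>J. (\<Sum>i<N. Y j (x i))\<^sup>2) + (\<Sum>i<N. \<kappa> (x i)) \<le> 2 * real N"
proof (induction N)
  case 0
  show ?case by simp
next
  case (Suc N)
  then obtain x where x: "\<forall>i<N. x i \<in> G"
    "(\<Sum>j\<in>J. (\<Sum>i<N. Y j (x i))\<^sup>2) + (\<Sum>i<N. \<kappa> (x i)) \<le> 2 * real N" by blast
  define S where "S = (\<lambda>j. \<Sum>i<N. Y j (x i))"
  \<comment> \<open>The new first sum plus the new \<kappa> term, as functions of the added point
    \<open>y\<close>; the mean exceeds the old first sum by at most 2.\<close>
  define k where "k = (\<lambda>y. (\<Sum>j\<in>J. (S j)\<^sup>2 + 2 * S j * Y j y + (Y j y)\<^sup>2) + \<kappa> y)"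
  have Y1: "integrable M (Y j)" if "j \<in> J" for j
    using sq_int_mult[OF Y[OF that], of "\<lambda>_. 1"] by (simp add: sq_int_def)
  have i: "integrable M k" unfolding k_def
    using Y1 sq_int_square[OF Y] \<kappa> by auto
  have e: "expectation (\<lambda>y. (S j)\<^sup>2 + 2 * S j * Y j y + (Y j y)\<^sup>2) = (S j)\<^sup>2 + expectation (\<lambda>x. (Y j x)\<^sup>2)"
    if "j \<in> J" for j
    using Y1[OF that] sq_int_square[OF Y[OF that]] Y0[OF that] by (simp add: prob_space)
  have "expectation k = (\<Sum>j\<in>J. (S j)\<^sup>2) + (\<Sum>j\<in>J. expectation (\<lambda>x. (Y j x)\<^sup>2)) + expectation \<kappa>"
  proof -
    have "expectation (\<lambda>y. \<Sum>j\<in>J. (S j)\<^sup>2 + 2 * S j * Y j y + (Y j y)\<^sup>2)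
        = (\<Sum>j\<in>J. (S j)\<^sup>2 + expectation (\<lambda>x. (Y j x)\<^sup>2))"
      using Y1 sq_int_square[OF Y]
      by (subst Bochner_Integration.integral_sum) (simp, intro sum.cong refl e)
    then show ?thesis unfolding k_def using Y1 sq_int_square[OF Y] \<kappa>
      by (subst Bochner_Integration.integral_add) (simp_all add: sum.distrib)
  qed
  then have ek: "expectation k \<le> (\<Sum>j\<in>J. (S j)\<^sup>2) + 2" using Y2 \<kappa> by linarith
  \<comment> \<open>An integrable function cannot exceed its mean almost everywhere, and
    \<open>G\<close> has full measure.\<close>
  have "\<exists>y\<in>G. k y \<le> expectation k"
  proof (rule ccontr)
    assume "\<not> ?thesis"
    then have "AE y in M. expectation k < k y" using G by (auto simp: not_le)
    from expectation_greater[OF i this] show False by simp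
  qed
  then obtain y where y: "y \<in> G" "k y \<le> (\<Sum>j\<in>J. (S j)\<^sup>2) + 2" using ek by force
  define x' where "x' = x(N := y)"
  have s: "(\<Sum>i<Suc N. h (x' i)) = (\<Sum>i<N. h (x i)) + h y" for h :: "'a \<Rightarrow> real"
    by (simp add: x'_def)
  have "(\<Sum>j\<in>J. (\<Sum>i<Suc N. Y j (x' i))\<^sup>2) + (\<Sum>i<Suc N. \<kappa> (x' i))
      = (\<Sum>j\<in>J. (S j + Y j y)\<^sup>2) + ((\<Sum>i<N. \<kappa> (x i)) + \<kappa> y)"
    unfolding s by (simp add: S_def)
  also have "\<dots> = k y + (\<Sum>i<N. \<kappa> (x i))"
    by (simp add: k_def power2_sum mult_ac add_ac)
  also have "\<dots> \<le> 2 * real (Suc N)" using y x(2) by (simp add: S_def)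
  finally show ?case using x(1) y(1) by (intro exI[of _ x']) (auto simp: x'_def less_Suc_eq)
qed

section \<open>Stable reconstruction from finitely many values\<close>

text \<open>Euclidean space R^N is treated as the square integrable functions on a counting measure,
  so that the projection lemmas apply to vectors of data.\<close>

lemma sq_int_count_space [simp]: "a \<in> sq_int (count_space {..<N::nat})"
  by (simp add: sq_int_def integrable_count_space)

lemma ip_count_space: "ip (count_space {..<N::nat}) a b = (\<Sum>i<N. a i * b i)"
  by (simp add: ip_def lebesgue_integral_count_space_finite)

text \<open>\<open>B\<close> is the least squares solution operator of the system with matrix \<open>\<phi>\<close>.\<close>

lemma stable_left_inverse:
  fixes \<phi> :: "nat \<Rightarrow> nat \<Rightarrow> real"
  assumes a: "a > 0"
    and stable: "\<And>c. a * (\<Sum>j<m. (c j)\<^sup>2) \<le> (\<Sum>i<N. (\<Sum>j<m. c j * \<phi> i j)\<^sup>2)"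
  obtains B :: "nat \<Rightarrow> nat \<Rightarrow> real" where
    "\<And>c j. j < m \<Longrightarrow> (\<Sum>i<N. B j i * (\<Sum>k<m. c k * \<phi> i k)) = c j"
    "\<And>y. a * (\<Sum>j<m. (\<Sum>i<N. B j i * y i)\<^sup>2) \<le> (\<Sum>i<N. (y i)\<^sup>2)"
proof -
  let ?M = "count_space {..<N}"
  define H where "H = {v. \<exists>c. v = (\<lambda>i. \<Sum>j<m. c j * \<phi> i j)}"
  have H: "lin_closed H"
    unfolding lin_closed_def
  proof (intro conjI ballI allI)
    show "(\<lambda>i. 0) \<in> H" unfolding H_def by (auto intro!: exI[of _ "\<lambda>_. 0"])
    fix v w s t assume "v \<in> H" "w \<in> H"
    then obtain c c' where "v = (\<lambda>i. \<Sum>j<m. c j * \<phi> i j)" "w = (\<lambda>i. \<Sum>j<m. c' j * \<phi> i j)"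
      by (auto simp: H_def)
    then show "(\<lambda>i. s * v i + t * w i) \<in> H" unfolding H_def
      by (auto intro!: exI[of _ "\<lambda>j. s * c j + t * c' j"] simp: sum_distrib_left sum.distrib algebra_simps)
  qed
  have vH: "(\<lambda>i. \<phi> i j) \<in> H" if "j < m" for j
  proof -
    have "(\<lambda>i. \<phi> i j) = (\<lambda>i. \<Sum>k<m. (if k = j then 1 else 0) * \<phi> i k)"
      using that by (auto simp: if_distrib if_distribR cong: if_cong)
    then show ?thesis unfolding H_def mem_Collect_eq
      by (rule exI[of _ "\<lambda>k. if k = j then 1 else 0"])
  qed
  obtain r u where u: "orthonormal ?M u r" and uH: "\<And>k. k < r \<Longrightarrow> u k \<in> H"
    and sp: "\<And>g j. g \<in> sq_int ?M \<Longrightarrow> (\<And>k. k < r \<Longrightarrow> ip ?M g (u k) = 0) \<Longrightarrow> j < m \<Longrightarrow> ip ?M g (\<lambda>i. \<phi> i j) = 0"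
    by (rule orthonormalize[OF H, of ?M m "\<lambda>j i. \<phi> i j"]) (use vH in auto)
  obtain A where A: "\<And>k. k < r \<Longrightarrow> u k = (\<lambda>i. \<Sum>j<m. A k j * \<phi> i j)"
    using uH unfolding H_def by (simp, metis)
  \<comment> \<open>Project onto the column space by means of the \<open>u k\<close>, then read off
    coefficients with \<open>A\<close>.\<close>
  define B where "B = (\<lambda>j i. \<Sum>k<r. u k i * A k j)"
  define b where "b = (\<lambda>y j. \<Sum>i<N. B j i * y i)"
  have b: "b y j = (\<Sum>k<r. ip ?M y (u k) * A k j)" for y j
    unfolding b_def B_def ip_count_space sum_distrib_right by (subst sum.swap) (simp add: mult_ac)
  have proj: "(\<Sum>j<m. b y j * \<phi> i j) = (\<Sum>k<r. ip ?M y (u k) * u k i)" for y i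
  proof -
    have "(\<Sum>j<m. b y j * \<phi> i j) = (\<Sum>k<r. ip ?M y (u k) * (\<Sum>j<m. A k j * \<phi> i j))"
      unfolding b sum_distrib_right sum_distrib_left by (subst sum.swap) (simp add: mult_ac)
    also have "\<dots> = (\<Sum>k<r. ip ?M y (u k) * u k i)"
      by (intro sum.cong) (auto simp: A)
    finally show ?thesis .
  qed
  let ?P = "\<lambda>y i. \<Sum>k<r. ip ?M y (u k) * u k i"
  have res: "ip ?M (\<lambda>i. y i - ?P y i) (\<lambda>i. y i - ?P y i) = ip ?M y y - (\<Sum>k<r. (ip ?M y (u k))\<^sup>2)" for y
    unfolding orthonormal_dist[OF u sq_int_count_space] by simp
  show ?thesis
  proof (rule that[of B])
    fix y
    have "a * (\<Sum>j<m. (b y j)\<^sup>2) \<le> (\<Sum>i<N. (?P y i)\<^sup>2)"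
      using stable[of "b y"] unfolding proj .
    also have "\<dots> = ip ?M (?P y) (?P y)" by (simp add: ip_count_space power2_eq_square)
    also have "\<dots> = (\<Sum>k<r. (ip ?M y (u k))\<^sup>2)"
    proof -
      have "ip ?M (?P y) (u k) = ip ?M y (u k)" if "k < r" for k
        using orthonormal_residual[OF u _ that, of y] ip_diff[of y ?M "?P y" "u k"] by simp
      then show ?thesis
        by (subst ip_sum) (auto simp: ip_commute[of _ "u _" "?P y"] power2_eq_square)
    qed
    also have "\<dots> \<le> ip ?M y y" by (rule orthonormal_Bessel[OF u]) simp
    also have "\<dots> = (\<Sum>i<N. (y i)\<^sup>2)" by (simp add: ip_count_space power2_eq_square)
    finally show "a * (\<Sum>j<m. (\<Sum>i<N. B j i * y i)\<^sup>2) \<le> (\<Sum>i<N. (y i)\<^sup>2)" by (simp add: b_def)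
  next
    fix c j assume j: "j < m"
    define y where "y = (\<lambda>i. \<Sum>k<m. c k * \<phi> i k)"
    define z where "z = (\<lambda>i. y i - ?P y i)"
    have zu: "ip ?M z (u k) = 0" if "k < r" for k
      unfolding z_def using orthonormal_residual[OF u _ that] by simp
    have z\<phi>: "ip ?M z (\<lambda>i. \<phi> i j) = 0" if "j < m" for j by (rule sp[OF _ zu that]) simp
    \<comment> \<open>The vector \<open>z\<close> lies in the column space and is orthogonal to
      every column, so its norm is zero. Stability then forces the coefficients to agree.\<close>
    have zc: "z i = (\<Sum>j<m. (c j - b y j) * \<phi> i j)" for i
      unfolding z_def proj[symmetric] by (simp add: y_def left_diff_distrib sum_subtractf)
    have "(\<Sum>i<N. (\<Sum>j<m. (c j - b y j) * \<phi> i j)\<^sup>2) = ip ?M z z"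
      by (simp add: ip_count_space zc power2_eq_square)
    also have "\<dots> = ip ?M (\<lambda>i. \<Sum>j<m. (c j - b y j) * \<phi> i j) z" by (simp add: zc[abs_def])
    also have "\<dots> = 0" by (subst ip_sum) (use z\<phi> in \<open>auto simp: ip_commute\<close>)
    finally have "a * (\<Sum>j<m. (c j - b y j)\<^sup>2) \<le> 0" using stable[of "\<lambda>j. c j - b y j"] by simp
    then have "(\<Sum>j<m. (c j - b y j)\<^sup>2) \<le> 0" using a by (simp add: mult_le_0_iff)
    then have "(\<Sum>j<m. (c j - b y j)\<^sup>2) = 0" by (intro antisym sum_nonneg) auto
    then have "c j - b y j = 0" using j by (subst (asm) sum_nonneg_eq_0_iff) auto
    then show "(\<Sum>i<N. B j i * (\<Sum>k<m. c k * \<phi> i k)) = c j" by (simp add: b_def y_def)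
  qed
qed

lemma sum_diagonal:
  fixes g :: "nat \<Rightarrow> nat \<Rightarrow> real"
  shows "(\<Sum>p\<in>{..<m}\<times>{..<m}. g (fst p) (snd p) * of_bool (fst p = snd p)) = (\<Sum>j<m. g j j)"
proof -
  have "(\<Sum>p\<in>{..<m}\<times>{..<m}. g (fst p) (snd p) * of_bool (fst p = snd p))
      = (\<Sum>j<m. \<Sum>k<m. g j k * of_bool (j = k))"
    by (simp only: sum.cartesian_product case_prod_unfold)
  also have "\<dots> = (\<Sum>j<m. g j j)"
    unfolding of_bool_def by (intro sum.cong refl) (simp add: if_distrib cong: if_cong)
  finally show ?thesis .
qed

text \<open>The Frobenius norm dominates the operator norm: the deviation \<open>\<Delta>\<close> of
  the Gram matrix from \<open>N\<close> times the identity changes the quadratic form by at most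
  \<open>N / 2\<close> times the squared norm of \<open>c\<close>.\<close>

lemma gram_stable:
  fixes \<phi> :: "nat \<Rightarrow> nat \<Rightarrow> real"
  assumes close: "(\<Sum>p\<in>{..<m}\<times>{..<m}. ((\<Sum>i<N. \<phi> i (fst p) * \<phi> i (snd p)) - real N * of_bool (fst p = snd p))\<^sup>2) \<le> (real N / 2)\<^sup>2"
  shows "real N / 2 * (\<Sum>j<m. (c j)\<^sup>2) \<le> (\<Sum>i<N. (\<Sum>j<m. c j * \<phi> i j)\<^sup>2)"
proof -
  let ?J = "{..<m} \<times> {..<m}"
  define \<Delta> where "\<Delta> = (\<lambda>p. (\<Sum>i<N. \<phi> i (fst p) * \<phi> i (snd p)) - real N * of_bool (fst p = snd p))"
  define q where "q = (\<lambda>p. c (fst p) * c (snd p))"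
  define s where "s = (\<Sum>j<m. (c j)\<^sup>2)"
  have s0: "0 \<le> s" unfolding s_def by (rule sum_nonneg) simp
  have q2: "(\<Sum>p\<in>?J. (q p)\<^sup>2) = s\<^sup>2"
    by (simp add: q_def s_def power2_eq_square sum_product sum.cartesian_product split_beta mult_ac)
  have "(\<Sum>i<N. (\<Sum>j<m. c j * \<phi> i j)\<^sup>2) = (\<Sum>i<N. \<Sum>p\<in>?J. q p * (\<phi> i (fst p) * \<phi> i (snd p)))"
    by (simp add: q_def power2_eq_square sum_product sum.cartesian_product split_beta mult_ac)
  also have "\<dots> = (\<Sum>p\<in>?J. q p * (\<Sum>i<N. \<phi> i (fst p) * \<phi> i (snd p)))"
    by (subst sum.swap) (simp add: sum_distrib_left)
  also have "\<dots> = (\<Sum>p\<in>?J. q p * \<Delta> p) + real N * (\<Sum>p\<in>?J. q p * of_bool (fst p = snd p))"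
  proof -
    have "q p * (\<Sum>i<N. \<phi> i (fst p) * \<phi> i (snd p)) = q p * \<Delta> p + real N * (q p * of_bool (fst p = snd p))" for p
      unfolding \<Delta>_def right_diff_distrib by (simp only: mult.left_commute diff_add_cancel)
    then show ?thesis by (simp only: sum.distrib sum_distrib_left)
  qed
  also have "(\<Sum>p\<in>?J. q p * of_bool (fst p = snd p)) = s"
    using sum_diagonal[of "\<lambda>j k. c j * c k" m] by (simp add: q_def s_def power2_eq_square)
  finally have eq: "(\<Sum>i<N. (\<Sum>j<m. c j * \<phi> i j)\<^sup>2) = (\<Sum>p\<in>?J. q p * \<Delta> p) + real N * s" .
  have "(\<Sum>p\<in>?J. q p * \<Delta> p)\<^sup>2 \<le> (\<Sum>p\<in>?J. (q p)\<^sup>2) * (\<Sum>p\<in>?J. (\<Delta> p)\<^sup>2)"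
    by (rule Cauchy_Schwarz_ineq_sum)
  also have "\<dots> \<le> s\<^sup>2 * (real N / 2)\<^sup>2"
    unfolding q2 using close by (intro mult_left_mono) (auto simp: \<Delta>_def)
  finally have "\<bar>\<Sum>p\<in>?J. q p * \<Delta> p\<bar>\<^sup>2 \<le> (real N / 2 * s)\<^sup>2" by (simp only: power2_abs power_mult_distrib mult.commute)
  then have "\<bar>\<Sum>p\<in>?J. q p * \<Delta> p\<bar> \<le> real N / 2 * s" by (rule power2_le_imp_le) (use s0 in simp)
  then show ?thesis unfolding eq s_def[symmetric] by linarith
qed

section \<open>Least squares from function values\<close>

context avg_approx
begin

text \<open>The function values are the exact coefficients of the projection seen through the
  weighted design matrix, plus residual values. Least squares reproduces the first part exactly, so
  only the residuals, weighted by \<open>1 / \<omega>\<close>, enter the extra error.\<close>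

lemma sampling:
  assumes w: "orthonormal \<nu> w m" and B: "B > 0"
    and res: "(\<integral>f. ip \<nu> f f - (\<Sum>j<m. (ip \<nu> f (w j))\<^sup>2) \<partial>\<mu> d) \<le> B"
    and N: "8 * m\<^sup>2 \<le> N"
  obtains x :: "nat \<Rightarrow> pt" and h :: "nat \<Rightarrow> fn" where
    "\<And>i. i < N \<Longrightarrow> x i \<in> D d" "\<And>i. h i \<in> sq_int \<nu>"
    "(\<integral>\<^sup>+f. Gnorm2 D \<rho> d (\<lambda>z. f z - (\<Sum>i<N. f (x i) * h i z)) \<partial>\<mu> d) \<le> ennreal (5 * B)"
proof (cases "m = 0")
  \<comment> \<open>The sampling density is undefined for \<open>m = 0\<close>. Here the zero
    reconstruction suffices, with one point of \<open>D d\<close> repeated.\<close>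
  case True
  obtain x0 where x0: "x0 \<in> D d"
  proof -
    have "\<exists>x. x \<in> D d"
    proof (rule ccontr)
      assume "\<nexists>x. x \<in> D d"
      then show False using AE_D \<nu>.AE_False by simp
    qed
    then show ?thesis using that by blast
  qed
  have "(\<integral>\<^sup>+f. Gnorm2 D \<rho> d (\<lambda>z. f z - (\<Sum>i<N. f x0 * 0)) \<partial>\<mu> d) = (\<integral>\<^sup>+f. ennreal (ip \<nu> f f) \<partial>\<mu> d)"
    by (intro nn_integral_cong) (simp add: Gnorm2_ip F_sq_int space_\<mu>)
  also have "\<dots> = ennreal (\<integral>f. ip \<nu> f f \<partial>\<mu> d)"
    by (rule nn_integral_eq_integral[OF norm2_integrable]) (simp add: ip_nonneg)
  also have "\<dots> \<le> ennreal (5 * B)" using res True B by (intro ennreal_leI) simp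
  finally show ?thesis
    using x0 by (intro that[of "\<lambda>_. x0" "\<lambda>_ _. 0"]) (auto simp: sq_int_def)
next
  case False
  then have m: "m > 0" by simp
  then have N0: "N > 0" using N by (metis gr_zeroI mult_eq_0_iff power_not_zero le_zero_eq zero_neq_numeral neq0_conv)
  let ?J = "{..<m} \<times> {..<m}"
  have w2: "\<And>j. j < m \<Longrightarrow> w j \<in> sq_int \<nu>" using w by (simp add: orthonormal_def)
  have wm: "\<And>j. j < m \<Longrightarrow> w j \<in> borel_measurable \<nu>" using w2 sq_int_measurable by blast
  \<comment> \<open>The normalized reciprocal of the Christoffel function. It bounds every
    one-sample Gram matrix uniformly in \<open>x\<close>, without any bound on the
    \<open>w j\<close> themselves.\<close>
  define \<omega> where "\<omega> = (\<lambda>x. (\<Sum>j<m. (w j x)\<^sup>2) / real m)"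
  have W: "(\<Sum>j<m. (w j x)\<^sup>2) = real m * \<omega> x" for x using m by (simp add: \<omega>_def)
  have \<omega>0: "0 \<le> \<omega> x" for x unfolding \<omega>_def by (intro divide_nonneg_nonneg sum_nonneg) auto
  have w\<omega>: "w j x = 0" if "\<omega> x = 0" "j < m" for j x
  proof -
    have "(\<Sum>j<m. (w j x)\<^sup>2) = 0" using W[of x] that by simp
    then show ?thesis using that(2) by (subst (asm) sum_nonneg_eq_0_iff) auto
  qed
  have i\<omega>: "integrable \<nu> \<omega>" unfolding \<omega>_def
    by (intro integrable_divide_zero Bochner_Integration.integrable_sum sq_int_square w2) auto
  have \<omega>m[measurable]: "\<omega> \<in> borel_measurable \<nu>" using i\<omega> by (rule borel_measurable_integrable)
  have \<omega>1: "(\<integral>x. \<omega> x \<partial>\<nu>) = 1"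
  proof -
    have "(\<integral>x. \<omega> x \<partial>\<nu>) = (\<Sum>j<m. ip \<nu> (w j) (w j)) / real m"
      unfolding \<omega>_def ip_self integral_divide_zero
      by (subst Bochner_Integration.integral_sum) (auto intro: sq_int_square w2)
    also have "(\<Sum>j<m. ip \<nu> (w j) (w j)) = (\<Sum>j<m. 1)" using w by (intro sum.cong) (auto simp: orthonormal_def)
    finally show ?thesis using m by simp
  qed
  define Q where "Q = density \<nu> (\<lambda>x. ennreal (\<omega> x))"
  interpret Q: prob_space Q
  proof (rule prob_spaceI)
    have "emeasure Q (space Q) = (\<integral>\<^sup>+x. ennreal (\<omega> x) \<partial>\<nu>)"
      unfolding Q_def by (simp add: emeasure_density cong: nn_integral_cong)
    also have "\<dots> = ennreal 1" unfolding \<omega>1[symmetric]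
      by (rule nn_integral_eq_integral[OF i\<omega>]) (simp add: \<omega>0)
    finally show "emeasure Q (space Q) = 1" by simp
  qed
  have Q_int: "integrable Q h \<longleftrightarrow> integrable \<nu> (\<lambda>x. \<omega> x * h x)" "(\<integral>x. h x \<partial>Q) = (\<integral>x. \<omega> x * h x \<partial>\<nu>)"
    if "h \<in> borel_measurable \<nu>" for h :: "pt \<Rightarrow> real"
    unfolding Q_def using that \<omega>0 by (simp_all add: integrable_density integral_density)

  define r where "r = (\<lambda>f x. f x - (\<Sum>j<m. ip \<nu> f (w j) * w j x))"
  have rL: "(\<lambda>f. r f x) \<in> Lall F nF d" for x
  proof -
    have "(\<lambda>f. \<Sum>j<m. w j x * ip \<nu> f (w j)) \<in> Lall F nF d"
      by (rule lin_closed_sum[OF Lall_lin]) (use Lall_ip w2 in auto)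
    from lin_closed_diff[OF Lall_lin Lall_point this] show ?thesis
      by (simp add: r_def mult.commute)
  qed
  have rm: "(\<lambda>p. r (fst p) (snd p)) \<in> borel_measurable (\<mu> d \<Otimes>\<^sub>M \<nu>)"
  proof -
    have "(\<lambda>p. ip \<nu> (fst p) (w j) * w j (snd p)) \<in> borel_measurable (\<mu> d \<Otimes>\<^sub>M \<nu>)" if "j < m" for j
    proof -
      have [measurable]: "(\<lambda>f. ip \<nu> f (w j)) \<in> borel_measurable (\<mu> d)" "w j \<in> borel_measurable \<nu>"
        using that w2 wm Lall_measurable[OF Lall_ip] by auto
      show ?thesis by measurable
    qed
    then show ?thesis unfolding r_def
      by (intro borel_measurable_diff borel_measurable_sum eval_measurable) auto
  qed
  have rm': "(\<lambda>p. r (snd p) (fst p)) \<in> borel_measurable (\<nu> \<Otimes>\<^sub>M \<mu> d)"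
    using measurable_compose[OF measurable_pair_swap' rm] by (simp add: split_beta)
  note [measurable] = rm rm'
  \<comment> \<open>Averaging over \<open>f\<close> leaves a function of the point only; by Tonelli
    its integral is the mean squared distance to the span of \<open>w\<close>.\<close>
  define \<Gamma> where "\<Gamma> = (\<lambda>x. \<integral>f. (r f x)\<^sup>2 \<partial>\<mu> d)"
  have \<Gamma>0: "0 \<le> \<Gamma> x" for x by (simp add: \<Gamma>_def)
  have \<Gamma>m[measurable]: "\<Gamma> \<in> borel_measurable \<nu>" unfolding \<Gamma>_def by measurable
  have "(\<integral>\<^sup>+x. ennreal (\<Gamma> x) \<partial>\<nu>) = (\<integral>\<^sup>+x. \<integral>\<^sup>+f. ennreal ((r f x)\<^sup>2) \<partial>\<mu> d \<partial>\<nu>)"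
    unfolding \<Gamma>_def using Lall_moments(1)[OF rL]
    by (intro nn_integral_cong nn_integral_eq_integral[symmetric]) auto
  also have "\<dots> = (\<integral>\<^sup>+f. \<integral>\<^sup>+x. ennreal ((r f x)\<^sup>2) \<partial>\<nu> \<partial>\<mu> d)"
    by (rule P.Fubini') measurable
  also have "\<dots> = (\<integral>\<^sup>+f. ennreal (ip \<nu> f f - (\<Sum>j<m. (ip \<nu> f (w j))\<^sup>2)) \<partial>\<mu> d)"
  proof (rule nn_integral_cong)
    fix f assume "f \<in> space (\<mu> d)"
    then have f2: "f \<in> sq_int \<nu>" by (simp add: F_sq_int space_\<mu>)
    have "r f \<in> sq_int \<nu>" unfolding r_def by (intro sq_int_diff f2 sq_int_sum) (use w2 in auto)
    then have "(\<integral>\<^sup>+x. ennreal ((r f x)\<^sup>2) \<partial>\<nu>) = ennreal (ip \<nu> (r f) (r f))"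
      unfolding ip_self by (intro nn_integral_eq_integral sq_int_square) auto
    also have "ip \<nu> (r f) (r f) = ip \<nu> f f - (\<Sum>j<m. (ip \<nu> f (w j))\<^sup>2)"
      unfolding r_def orthonormal_dist[OF w f2] by simp
    finally show "(\<integral>\<^sup>+x. ennreal ((r f x)\<^sup>2) \<partial>\<nu>) = ennreal (ip \<nu> f f - (\<Sum>j<m. (ip \<nu> f (w j))\<^sup>2))" .
  qed
  also have "\<dots> = ennreal (\<integral>f. ip \<nu> f f - (\<Sum>j<m. (ip \<nu> f (w j))\<^sup>2) \<partial>\<mu> d)"
    by (rule nn_integral_eq_integral[OF residual_integrable[OF w]])
      (use residual_bounds(1)[OF w] in \<open>auto simp: space_\<mu> intro!: AE_I2\<close>)
  also have "\<dots> \<le> ennreal B" by (rule ennreal_leI[OF res])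
  finally have \<Gamma>B: "(\<integral>\<^sup>+x. ennreal (\<Gamma> x) \<partial>\<nu>) \<le> ennreal B" .
  have i\<Gamma>: "integrable \<nu> \<Gamma>"
    by (rule integrableI_nonneg) (use \<Gamma>0 \<Gamma>B in \<open>auto simp: le_less_trans[OF \<Gamma>B]\<close>)
  have \<Gamma>_le: "(\<integral>x. \<Gamma> x \<partial>\<nu>) \<le> B"
    using \<Gamma>B B nn_integral_eq_integral[OF i\<Gamma>] \<Gamma>0 by (simp add: ennreal_le_iff)

  \<comment> \<open>Scaled to have mean at most 1 under \<open>Q\<close>. Where
    \<open>\<omega>\<close> vanishes the quotient is 0 by convention, and the bound on
    \<open>\<omega> x * \<kappa> x\<close> persists.\<close>
  define \<kappa> where "\<kappa> = (\<lambda>x. \<Gamma> x / (\<omega> x * B))"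
  have \<kappa>0: "0 \<le> \<kappa> x" for x using \<Gamma>0 \<omega>0 B by (simp add: \<kappa>_def)
  have \<kappa>m[measurable]: "\<kappa> \<in> borel_measurable \<nu>" unfolding \<kappa>_def by measurable
  have \<omega>\<kappa>: "\<omega> x * \<kappa> x \<le> \<Gamma> x / B" "0 \<le> \<omega> x * \<kappa> x" for x
    using \<Gamma>0[of x] \<omega>0[of x] B by (auto simp: \<kappa>_def)
  have i\<omega>\<kappa>: "integrable \<nu> (\<lambda>x. \<omega> x * \<kappa> x)"
    by (rule Bochner_Integration.integrable_bound[of _ "\<lambda>x. \<Gamma> x / B"])
      (use i\<Gamma> \<omega>\<kappa> \<Gamma>0 B in \<open>auto intro!: AE_I2\<close>)
  have i\<kappa>: "integrable Q \<kappa>" using i\<omega>\<kappa> by (simp add: Q_int)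
  have e\<kappa>: "(\<integral>x. \<kappa> x \<partial>Q) \<le> 1"
  proof -
    have "(\<integral>x. \<kappa> x \<partial>Q) \<le> (\<integral>x. \<Gamma> x / B \<partial>\<nu>)"
      unfolding Q_int(2)[OF \<kappa>m] using i\<omega>\<kappa> i\<Gamma> \<omega>\<kappa> by (intro integral_mono) auto
    also have "\<dots> \<le> 1" using \<Gamma>_le B by simp
    finally show ?thesis .
  qed

  \<comment> \<open>Entries of the one-sample Gram matrix minus the identity, divided by
    \<open>m\<close> so that their second moments sum to at most 1.\<close>
  define Y where "Y = (\<lambda>p x. (w (fst p) x * w (snd p) x / \<omega> x - of_bool (fst p = snd p)) / real m)"
  have Ym: "Y p \<in> borel_measurable \<nu>" if "p \<in> ?J" for p
  proof -
    have [measurable]: "w (fst p) \<in> borel_measurable \<nu>" "w (snd p) \<in> borel_measurable \<nu>" using that wm by auto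
    show ?thesis unfolding Y_def by measurable
  qed
  \<comment> \<open>Off the zeros of \<open>\<omega>\<close> the sum equals
    \<open>1 - 1 / m\<close>: the squared products contribute \<open>m^2\<close>, the diagonal
    correction \<open>- m\<close>, and everything is divided by \<open>m^2\<close>.\<close>
  have Y2: "\<omega> x * (\<Sum>p\<in>?J. (Y p x)\<^sup>2) \<le> \<omega> x" for x
  proof (cases "\<omega> x = 0")
    case False
    let ?t = "\<lambda>j. w j x"
    have "(\<Sum>p\<in>?J. (Y p x)\<^sup>2) = (\<Sum>p\<in>?J. ((?t (fst p))\<^sup>2 * (?t (snd p))\<^sup>2 / (\<omega> x)\<^sup>2
        + (1 - 2 * (?t (fst p) * ?t (snd p)) / \<omega> x) * of_bool (fst p = snd p)) / (real m)\<^sup>2)"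
      by (intro sum.cong refl) (simp add: Y_def power_divide power2_diff power_mult_distrib algebra_simps)
    also have "\<dots> = ((\<Sum>p\<in>?J. (?t (fst p))\<^sup>2 * (?t (snd p))\<^sup>2) / (\<omega> x)\<^sup>2
        + (\<Sum>p\<in>?J. (1 - 2 * (?t (fst p) * ?t (snd p)) / \<omega> x) * of_bool (fst p = snd p))) / (real m)\<^sup>2"
      by (simp only: sum_divide_distrib[symmetric] sum.distrib)
    also have "(\<Sum>p\<in>?J. (?t (fst p))\<^sup>2 * (?t (snd p))\<^sup>2) = (real m * \<omega> x)\<^sup>2"
      unfolding W[symmetric] by (simp only: power2_eq_square[of "sum _ _"] sum_product sum.cartesian_product case_prod_unfold)
    also have "(\<Sum>p\<in>?J. (1 - 2 * (?t (fst p) * ?t (snd p)) / \<omega> x) * of_bool (fst p = snd p))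
        = (\<Sum>j<m. 1 - 2 * (?t j * ?t j) / \<omega> x)" by (rule sum_diagonal)
    also have "\<dots> = real m - 2 * (\<Sum>j<m. (?t j)\<^sup>2) / \<omega> x"
      by (simp add: sum_subtractf sum_divide_distrib sum_distrib_left power2_eq_square)
    also have "\<dots> = - real m" using False by (simp add: W)
    also have "((real m * \<omega> x)\<^sup>2 / (\<omega> x)\<^sup>2 + - real m) / (real m)\<^sup>2 \<le> 1"
      using False m by (simp add: power_mult_distrib field_simps)
    finally show ?thesis using \<omega>0[of x] by (simp add: mult_left_le)
  qed simp
  have Y2p: "\<omega> x * (Y p x)\<^sup>2 \<le> \<omega> x" if "p \<in> ?J" for p x
  proof -
    have "(Y p x)\<^sup>2 \<le> (\<Sum>p\<in>?J. (Y p x)\<^sup>2)" by (rule member_le_sum[OF that]) auto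
    then show ?thesis using Y2[of x] \<omega>0[of x] by (meson mult_left_mono order_trans)
  qed
  have iY2: "integrable \<nu> (\<lambda>x. \<omega> x * (Y p x)\<^sup>2)" if "p \<in> ?J" for p
  proof (rule Bochner_Integration.integrable_bound[OF i\<omega>])
    show "(\<lambda>x. \<omega> x * (Y p x)\<^sup>2) \<in> borel_measurable \<nu>" using Ym[OF that] by measurable
    show "AE x in \<nu>. norm (\<omega> x * (Y p x)\<^sup>2) \<le> norm (\<omega> x)"
      using Y2p[OF that] \<omega>0 by (intro AE_I2) simp
  qed
  have YQ: "Y p \<in> sq_int Q" if "p \<in> ?J" for p
  proof -
    have "Y p \<in> borel_measurable Q" using Ym[OF that] by (simp add: Q_def)
    moreover have "(\<lambda>x. (Y p x)\<^sup>2) \<in> borel_measurable \<nu>" using Ym[OF that] by measurable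
    ultimately show ?thesis using iY2[OF that] by (simp add: sq_int_def Q_int)
  qed
  have eY: "(\<integral>x. Y p x \<partial>Q) = 0" if "p \<in> ?J" for p
  proof -
    have p: "fst p < m" "snd p < m" using that by auto
    have "\<omega> x * Y p x = (w (fst p) x * w (snd p) x - of_bool (fst p = snd p) * \<omega> x) / real m" for x
      using w\<omega>[of x "fst p"] p by (cases "\<omega> x = 0") (simp_all add: Y_def field_simps)
    then have "(\<integral>x. Y p x \<partial>Q) = (ip \<nu> (w (fst p)) (w (snd p)) - of_bool (fst p = snd p) * (\<integral>x. \<omega> x \<partial>\<nu>)) / real m"
      unfolding Q_int(2)[OF Ym[OF that]] using sq_int_mult[OF w2 w2] p i\<omega> by (simp add: ip_def)
    also have "\<dots> = 0" using w p by (simp add: \<omega>1 orthonormal_def)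
    finally show ?thesis .
  qed
  have eY2: "(\<Sum>p\<in>?J. (\<integral>x. (Y p x)\<^sup>2 \<partial>Q)) \<le> 1"
  proof -
    have "(\<integral>x. (Y p x)\<^sup>2 \<partial>Q) = (\<integral>x. \<omega> x * (Y p x)\<^sup>2 \<partial>\<nu>)" if "p \<in> ?J" for p
      by (rule Q_int(2)) (use Ym[OF that] in measurable)
    then have "(\<Sum>p\<in>?J. (\<integral>x. (Y p x)\<^sup>2 \<partial>Q)) = (\<Sum>p\<in>?J. (\<integral>x. \<omega> x * (Y p x)\<^sup>2 \<partial>\<nu>))"
      by (rule sum.cong[OF refl])
    also have "\<dots> = (\<integral>x. \<omega> x * (\<Sum>p\<in>?J. (Y p x)\<^sup>2) \<partial>\<nu>)"
      unfolding sum_distrib_left by (rule Bochner_Integration.integral_sum[symmetric]) (rule iY2)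
    also have "\<dots> \<le> (\<integral>x. \<omega> x \<partial>\<nu>)"
    proof (rule integral_mono)
      show "integrable \<nu> (\<lambda>x. \<omega> x * (\<Sum>p\<in>?J. (Y p x)\<^sup>2))"
        unfolding sum_distrib_left by (rule Bochner_Integration.integrable_sum) (rule iY2)
    qed (use i\<omega> Y2 in auto)
    finally show ?thesis by (simp add: \<omega>1)
  qed
  \<comment> \<open>Points with \<open>\<omega> x = 0\<close> have \<open>Q\<close>-measure zero;
    avoiding them makes the weights \<open>1 / sqrt (\<omega> (x i))\<close> meaningful.\<close>
  have GQ: "AE x in Q. x \<in> {x \<in> D d. \<omega> x > 0}"
    unfolding Q_def using AE_D by (subst AE_density) (auto elim!: eventually_mono)
  obtain x where x: "\<And>i. i < N \<Longrightarrow> x i \<in> D d" "\<And>i. i < N \<Longrightarrow> \<omega> (x i) > 0"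
    and sel: "(\<Sum>p\<in>?J. (\<Sum>i<N. Y p (x i))\<^sup>2) + (\<Sum>i<N. \<kappa> (x i)) \<le> 2 * real N"
  proof -
    have "\<exists>x. (\<forall>i<N. x i \<in> {x \<in> D d. \<omega> x > 0}) \<and>
        (\<Sum>p\<in>?J. (\<Sum>i<N. Y p (x i))\<^sup>2) + (\<Sum>i<N. \<kappa> (x i)) \<le> 2 * real N"
      by (rule Q.select_points[OF _ YQ eY eY2 i\<kappa> e\<kappa> GQ]) simp
    then show ?thesis using that by blast
  qed
  have sel1: "(\<Sum>p\<in>?J. (\<Sum>i<N. Y p (x i))\<^sup>2) \<le> 2 * real N"
    using sel sum_nonneg[of "{..<N}" "\<lambda>i. \<kappa> (x i)"] \<kappa>0 by simp
  have sel2: "(\<Sum>i<N. \<kappa> (x i)) \<le> 2 * real N"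
    using sel sum_nonneg[of ?J "\<lambda>p. (\<Sum>i<N. Y p (x i))\<^sup>2"] by simp
  \<comment> \<open>Rows carry the importance weight of sampling from \<open>Q\<close>, so that the
    expected Gram matrix is \<open>N\<close> times the identity.\<close>
  define \<phi> where "\<phi> = (\<lambda>i j. w j (x i) / sqrt (\<omega> (x i)))"
  have "(\<Sum>i<N. \<phi> i (fst p) * \<phi> i (snd p)) - real N * of_bool (fst p = snd p) = real m * (\<Sum>i<N. Y p (x i))" for p
  proof -
    have "\<phi> i (fst p) * \<phi> i (snd p) = w (fst p) (x i) * w (snd p) (x i) / \<omega> (x i)" for i
      using \<omega>0[of "x i"] by (simp add: \<phi>_def)
    moreover have "real m * (\<Sum>i<N. Y p (x i)) = (\<Sum>i<N. w (fst p) (x i) * w (snd p) (x i) / \<omega> (x i) - of_bool (fst p = snd p))"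
      unfolding Y_def sum_divide_distrib[symmetric] using m by simp
    ultimately show ?thesis by (simp add: sum_subtractf)
  qed
  then have "(\<Sum>p\<in>?J. ((\<Sum>i<N. \<phi> i (fst p) * \<phi> i (snd p)) - real N * of_bool (fst p = snd p))\<^sup>2)
      = (real m)\<^sup>2 * (\<Sum>p\<in>?J. (\<Sum>i<N. Y p (x i))\<^sup>2)"
    by (simp only: power_mult_distrib sum_distrib_left[symmetric])
  also have "\<dots> \<le> (real m)\<^sup>2 * (2 * real N)" by (rule mult_left_mono[OF sel1]) simp
  \<comment> \<open>This inequality is the origin of the factor 8 in the sample size.\<close>
  also have "\<dots> \<le> (real N / 2)\<^sup>2"
  proof -
    have "8 * (real m)\<^sup>2 \<le> real N" using N by (metis of_nat_le_iff of_nat_mult of_nat_numeral of_nat_power)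
    then have "8 * (real m)\<^sup>2 * real N \<le> real N * real N" by (rule mult_right_mono) simp
    then show ?thesis by (simp add: power2_eq_square)
  qed
  finally have stable: "\<And>c. real N / 2 * (\<Sum>j<m. (c j)\<^sup>2) \<le> (\<Sum>i<N. (\<Sum>j<m. c j * \<phi> i j)\<^sup>2)"
    by (rule gram_stable)
  obtain A :: "nat \<Rightarrow> nat \<Rightarrow> real" where
    A1: "\<And>c j. j < m \<Longrightarrow> (\<Sum>i<N. A j i * (\<Sum>k<m. c k * \<phi> i k)) = c j"
    and A2: "\<And>y. real N / 2 * (\<Sum>j<m. (\<Sum>i<N. A j i * y i)\<^sup>2) \<le> (\<Sum>i<N. (y i)\<^sup>2)"
    by (rule stable_left_inverse[where a = "real N / 2" and m = m and N = N and \<phi> = \<phi>]) (use N0 stable in auto)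
  define h where "h = (\<lambda>i z. \<Sum>j<m. (A j i / sqrt (\<omega> (x i))) * w j z)"
  have h2: "h i \<in> sq_int \<nu>" for i unfolding h_def by (rule sq_int_sum) (use w2 in auto)
  have pw: "Gnorm2 D \<rho> d (\<lambda>z. f z - (\<Sum>i<N. f (x i) * h i z))
      \<le> ennreal ((ip \<nu> f f - (\<Sum>j<m. (ip \<nu> f (w j))\<^sup>2)) + 2 / real N * (\<Sum>i<N. (r f (x i))\<^sup>2 / \<omega> (x i)))"
    if f: "f \<in> F d" for f
  proof -
    have f2: "f \<in> sq_int \<nu>" by (rule F_sq_int[OF f])
    define y where "y = (\<lambda>i. f (x i) / sqrt (\<omega> (x i)))"
    define z where "z = (\<lambda>i. r f (x i) / sqrt (\<omega> (x i)))"
    define b where "b = (\<lambda>j. \<Sum>i<N. A j i * y i)"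
    \<comment> \<open>Exact coefficients plus noise \<open>z\<close>: the left inverse
      \<open>A\<close> reproduces the first part, and the coefficient error is \<open>A\<close>
      applied to \<open>z\<close>.\<close>
    have y: "y i = (\<Sum>k<m. ip \<nu> f (w k) * \<phi> i k) + z i" for i
      by (simp add: y_def z_def r_def \<phi>_def diff_divide_distrib sum_divide_distrib)
    have b: "ip \<nu> f (w j) - b j = - (\<Sum>i<N. A j i * z i)" if "j < m" for j
      using A1[OF that, of "\<lambda>k. ip \<nu> f (w k)"] unfolding b_def y by (simp add: distrib_left sum.distrib)
    have eq: "(\<lambda>v. f v - (\<Sum>i<N. f (x i) * h i v)) = (\<lambda>v. f v - (\<Sum>j<m. b j * w j v))"
      unfolding h_def b_def y_def sum_distrib_left sum_distrib_right
      by (subst sum.swap) (simp add: mult_ac)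
    have "ip \<nu> (\<lambda>v. f v - (\<Sum>j<m. b j * w j v)) (\<lambda>v. f v - (\<Sum>j<m. b j * w j v))
      = (ip \<nu> f f - (\<Sum>j<m. (ip \<nu> f (w j))\<^sup>2)) + (\<Sum>j<m. (\<Sum>i<N. A j i * z i)\<^sup>2)"
      unfolding orthonormal_dist[OF w f2] using b by simp
    also have "(\<Sum>j<m. (\<Sum>i<N. A j i * z i)\<^sup>2) \<le> 2 / real N * (\<Sum>i<N. (z i)\<^sup>2)"
      using A2[of z] N0 by (simp add: field_simps)
    also have "(\<Sum>i<N. (z i)\<^sup>2) = (\<Sum>i<N. (r f (x i))\<^sup>2 / \<omega> (x i))"
      using \<omega>0 by (simp add: z_def power_divide)
    finally have "ip \<nu> (\<lambda>v. f v - (\<Sum>j<m. b j * w j v)) (\<lambda>v. f v - (\<Sum>j<m. b j * w j v))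
      \<le> (ip \<nu> f f - (\<Sum>j<m. (ip \<nu> f (w j))\<^sup>2)) + 2 / real N * (\<Sum>i<N. (r f (x i))\<^sup>2 / \<omega> (x i))"
      by simp
    moreover have "(\<lambda>v. f v - (\<Sum>j<m. b j * w j v)) \<in> sq_int \<nu>"
      by (intro sq_int_diff f2 sq_int_sum) (use w2 in auto)
    ultimately show ?thesis unfolding eq by (simp add: Gnorm2_ip ennreal_leI)
  qed
  have iR: "integrable (\<mu> d) (\<lambda>f. 2 / real N * (\<Sum>i<N. (r f (x i))\<^sup>2 / \<omega> (x i)))"
    using Lall_moments(1)[OF rL] by auto
  have "(\<integral>\<^sup>+f. Gnorm2 D \<rho> d (\<lambda>z. f z - (\<Sum>i<N. f (x i) * h i z)) \<partial>\<mu> d)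
    \<le> (\<integral>\<^sup>+f. ennreal ((ip \<nu> f f - (\<Sum>j<m. (ip \<nu> f (w j))\<^sup>2)) + 2 / real N * (\<Sum>i<N. (r f (x i))\<^sup>2 / \<omega> (x i))) \<partial>\<mu> d)"
    by (rule nn_integral_mono) (use pw in \<open>simp add: space_\<mu>\<close>)
  also have "\<dots> = ennreal (\<integral>f. (ip \<nu> f f - (\<Sum>j<m. (ip \<nu> f (w j))\<^sup>2)) + 2 / real N * (\<Sum>i<N. (r f (x i))\<^sup>2 / \<omega> (x i)) \<partial>\<mu> d)"
  proof (rule nn_integral_eq_integral)
    show "AE f in \<mu> d. 0 \<le> (ip \<nu> f f - (\<Sum>j<m. (ip \<nu> f (w j))\<^sup>2)) + 2 / real N * (\<Sum>i<N. (r f (x i))\<^sup>2 / \<omega> (x i))"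
      using residual_bounds(1)[OF w] \<omega>0 by (intro AE_I2 add_nonneg_nonneg mult_nonneg_nonneg sum_nonneg) (auto simp: space_\<mu>)
  qed (intro Bochner_Integration.integrable_add residual_integrable[OF w] iR)
  also have "\<dots> \<le> ennreal (5 * B)"
  proof (rule ennreal_leI)
    \<comment> \<open>The mean of the noise term is \<open>2 / N\<close> times \<open>B\<close>
      times the \<kappa> sum, hence at most \<open>4 * B\<close>; the projection error adds another
      \<open>B\<close>.\<close>
    have "(\<integral>f. 2 / real N * (\<Sum>i<N. (r f (x i))\<^sup>2 / \<omega> (x i)) \<partial>\<mu> d) = 2 / real N * (\<Sum>i<N. \<Gamma> (x i) / \<omega> (x i))"
      using Lall_moments(1)[OF rL] by (simp add: Bochner_Integration.integral_sum \<Gamma>_def)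
    also have "(\<Sum>i<N. \<Gamma> (x i) / \<omega> (x i)) = B * (\<Sum>i<N. \<kappa> (x i))"
      using B by (simp add: \<kappa>_def sum_distrib_left)
    also have "2 / real N * (B * (\<Sum>i<N. \<kappa> (x i))) \<le> 2 / real N * (B * (2 * real N))"
      using sel2 B by (intro mult_left_mono) auto
    also have "\<dots> = 4 * B" using N0 by simp
    finally show "(\<integral>f. (ip \<nu> f f - (\<Sum>j<m. (ip \<nu> f (w j))\<^sup>2)) + 2 / real N * (\<Sum>i<N. (r f (x i))\<^sup>2 / \<omega> (x i)) \<partial>\<mu> d) \<le> 5 * B"
      using res by (subst Bochner_Integration.integral_add[OF residual_integrable[OF w] iR]) linarith
  qed
  finally show ?thesis using that x(1) h2 by blast
qed

section \<open>Information complexity\<close>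

text \<open>Preimages of balls are measurable because the squared distance is a parameter integral
  of a function jointly measurable in the data and the point.\<close>

lemma std_algorithm:
  assumes x: "\<And>i. i < N \<Longrightarrow> x i \<in> D d" and h: "\<And>i. h i \<in> sq_int \<nu>" and N: "N > 0"
  shows "(\<lambda>i f. f (x i), \<lambda>y z. \<Sum>i<N. y i * h i z) \<in> algs D \<rho> (Lstd D) d N"
  unfolding algs_def mem_Collect_eq case_prod_conv
proof (intro conjI allI impI ballI)
  show "(\<lambda>f. f (x i)) \<in> Lstd D d" if "i < N" for i using x[OF that] by (auto simp: Lstd_def)
  show \<phi>: "(\<lambda>z. \<Sum>i<N. y i * h i z) \<in> Gspace D \<rho> d" for y
    unfolding Gspace_eq by (rule sq_int_sum) (use h in auto)
  fix g r assume "g \<in> Gspace D \<rho> d"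
  then have g: "g \<in> sq_int \<nu>" by (simp add: Gspace_eq)
  have hm: "h i \<in> borel_measurable \<nu>" for i using h sq_int_measurable by blast
  have [measurable]: "(\<lambda>p. (\<Sum>i<N. fst p i * h i (snd p)) - g (snd p)) \<in> borel_measurable (borelR N \<Otimes>\<^sub>M \<nu>)"
  proof -
    have [measurable]: "g \<in> borel_measurable \<nu>" by (rule sq_int_measurable[OF g])
    have "(\<lambda>p. fst p i * h i (snd p)) \<in> borel_measurable (borelR N \<Otimes>\<^sub>M \<nu>)" if "i < N" for i
    proof -
      have [measurable]: "(\<lambda>y. y i) \<in> borel_measurable (borelR N)" "h i \<in> borel_measurable \<nu>"
        using hm that unfolding borelR_def by (auto intro: measurable_component_singleton)
      show ?thesis by measurable
    qed
    then show ?thesis by (intro borel_measurable_diff borel_measurable_sum) (auto, measurable)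
  qed
  have "(\<lambda>y. \<integral>\<^sup>+z. ennreal (((\<Sum>i<N. y i * h i z) - g z)\<^sup>2) \<partial>\<nu>) \<in> borel_measurable (borelR N)"
    by measurable
  moreover have "Gnorm2 D \<rho> d (\<lambda>z. (\<Sum>i<N. y i * h i z) - g z) = (\<integral>\<^sup>+z. ennreal (((\<Sum>i<N. y i * h i z) - g z)\<^sup>2) \<partial>\<nu>)" for y
    by (rule Gnorm2_eq) (use hm sq_int_measurable[OF g] in measurable)
  ultimately have [measurable]: "(\<lambda>y. Gnorm2 D \<rho> d (\<lambda>z. (\<Sum>i<N. y i * h i z) - g z)) \<in> borel_measurable (borelR N)"
    by simp
  show "{y \<in> space (borelR N). Gnorm2 D \<rho> d (\<lambda>z. (\<Sum>i<N. y i * h i z) - g z) < r} \<in> sets (borelR N)"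
    by measurable
qed (use N in auto)

text \<open>The infimum need not be attained, so an algorithm with squared error below
  \<open>\<epsilon>^2 / 8\<close> is taken instead of \<open>\<epsilon>^2 / 16\<close>. With
  \<delta> equal to \<open>\<epsilon>^2 / 16\<close>, the subspace error is at most
  \<open>3/16 \<le> 1/5\<close> of \<open>\<epsilon>^2\<close>, which compensates the factor 5 of
  \<open>sampling\<close>.\<close>

lemma std_error_bound:
  assumes n: "n > 0" and \<epsilon>: "\<epsilon> > 0" and all: "eavg2 D \<rho> \<mu> (Lall F nF) n d \<le> ennreal ((\<epsilon> / 4)\<^sup>2)"
  shows "eavg2 D \<rho> \<mu> (Lstd D) (8 * n\<^sup>2) d \<le> ennreal (\<epsilon>\<^sup>2)"
proof -
  have "ennreal ((\<epsilon> / 4)\<^sup>2) < ennreal (\<epsilon>\<^sup>2 / 8)"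
    using \<epsilon> by (subst ennreal_less_iff) (auto simp: power_divide)
  with all have "eavg2 D \<rho> \<mu> (Lall F nF) n d < ennreal (\<epsilon>\<^sup>2 / 8)" by simp
  then obtain L \<phi> where A: "(L, \<phi>) \<in> algs D \<rho> (Lall F nF) d n"
    and e: "err2 D \<rho> \<mu> d n L \<phi> < ennreal (\<epsilon>\<^sup>2 / 8)"
    unfolding eavg2_def INF_less_iff by auto
  obtain m w where m: "m \<le> n" and w: "orthonormal \<nu> w m"
    and res: "(\<integral>f. ip \<nu> f f - (\<Sum>j<m. (ip \<nu> f (w j))\<^sup>2) \<partial>\<mu> d) \<le> \<epsilon>\<^sup>2 / 8 + \<epsilon>\<^sup>2 / 16"
    by (rule linear_reduction[OF A less_imp_le[OF e], of "\<epsilon>\<^sup>2 / 16"]) (use \<epsilon> in auto)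
  have N: "8 * m\<^sup>2 \<le> 8 * n\<^sup>2" using m by (simp add: power_mono)
  have res': "(\<integral>f. ip \<nu> f f - (\<Sum>j<m. (ip \<nu> f (w j))\<^sup>2) \<partial>\<mu> d) \<le> \<epsilon>\<^sup>2 / 5"
  proof -
    have "\<epsilon>\<^sup>2 / 8 + \<epsilon>\<^sup>2 / 16 \<le> \<epsilon>\<^sup>2 / 5" using zero_le_power2[of \<epsilon>] by linarith
    then show ?thesis using res by linarith
  qed
  obtain x h where x: "\<And>i. i < 8 * n\<^sup>2 \<Longrightarrow> x i \<in> D d" and h: "\<And>i. h i \<in> sq_int \<nu>"
    and err: "(\<integral>\<^sup>+f. Gnorm2 D \<rho> d (\<lambda>z. f z - (\<Sum>i<8 * n\<^sup>2. f (x i) * h i z)) \<partial>\<mu> d) \<le> ennreal (5 * (\<epsilon>\<^sup>2 / 5))"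
    by (rule sampling[OF w _ res' N]) (use \<epsilon> in auto)
  have "eavg2 D \<rho> \<mu> (Lstd D) (8 * n\<^sup>2) d
      \<le> err2 D \<rho> \<mu> d (8 * n\<^sup>2) (\<lambda>i f. f (x i)) (\<lambda>y z. \<Sum>i<8 * n\<^sup>2. y i * h i z)"
    unfolding eavg2_def
    by (rule INF_lower2[OF std_algorithm[of "8 * n\<^sup>2" x h]]) (use x h n in auto)
  also have "\<dots> = (\<integral>\<^sup>+f. Gnorm2 D \<rho> d (\<lambda>z. f z - (\<Sum>i<8 * n\<^sup>2. f (x i) * h i z)) \<partial>\<mu> d)"
    unfolding err2_def by simp
  also have "\<dots> \<le> ennreal (\<epsilon>\<^sup>2)" using err by simp
  finally show ?thesis .
qed

lemma Lstd_subset_Lall: "Lstd D d \<subseteq> Lall F nF d"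
  using Lall_point by (auto simp: Lstd_def)

lemma eavg2_all_le_std: "eavg2 D \<rho> \<mu> (Lall F nF) n d \<le> eavg2 D \<rho> \<mu> (Lstd D) n d"
  unfolding eavg2_def using Lstd_subset_Lall
  by (intro INF_superset_mono order_refl) (auto simp: algs_def)

end

section \<open>Transfer of the limit condition between the two classes of functionals\<close>

lemma nABS_le: "eavg2 D \<rho> \<mu> Lam m d \<le> ennreal (\<epsilon>\<^sup>2) \<Longrightarrow> nABS D \<rho> \<mu> Lam \<epsilon> d \<le> enat m"
  unfolding nABS_def by (rule Inf_lower) auto

lemma nABS_attained:
  assumes "nABS D \<rho> \<mu> Lam \<epsilon> d \<noteq> \<infinity>"
  obtains m where "nABS D \<rho> \<mu> Lam \<epsilon> d = enat m" "eavg2 D \<rho> \<mu> Lam m d \<le> ennreal (\<epsilon>\<^sup>2)"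
proof -
  let ?S = "{n::enat. \<exists>m. n = enat m \<and> eavg2 D \<rho> \<mu> Lam m d \<le> ennreal (\<epsilon>\<^sup>2)}"
  have ne: "?S \<noteq> {}"
  proof
    assume "?S = {}"
    then have "nABS D \<rho> \<mu> Lam \<epsilon> d = \<infinity>" unfolding nABS_def by (simp add: Inf_enat_def)
    then show False using assms by simp
  qed
  then have "Inf ?S \<in> ?S" unfolding Inf_enat_def by (metis (mono_tags, lifting) LeastI ex_in_conv)
  then show ?thesis using that by (auto simp: nABS_def)
qed

text \<open>The case \<open>m = 0\<close> is covered by the convention \<open>ln 0 = 0\<close>,
  because \<open>ln (real n)\<close> is nonnegative for \<open>n > 0\<close>.\<close>

lemma ln_real_mono: "m \<le> n \<Longrightarrow> ln (real m) \<le> ln (real n)" if "n > 0" for m n :: nat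
  using that by (cases "m = 0") auto

lemma ALG_WT_std_imp_all:
  assumes s: "avg_setting D \<rho> F nF \<mu>" and std: "ALG_WT D \<rho> \<mu> (Lstd D)"
  shows "ALG_WT D \<rho> \<mu> (Lall F nF)"
  unfolding ALG_WT_def
proof (intro allI impI)
  fix \<eta> :: real assume "\<eta> > 0"
  then obtain M where M: "\<And>d \<epsilon>. d \<ge> 1 \<Longrightarrow> 0 < \<epsilon> \<and> \<epsilon> < 1 \<and> 1 / \<epsilon> + real d > M \<Longrightarrow>
      nABS D \<rho> \<mu> (Lstd D) \<epsilon> d \<noteq> \<infinity> \<and>
      ln (real (the_enat (nABS D \<rho> \<mu> (Lstd D) \<epsilon> d))) / (1 / \<epsilon> + real d) < \<eta>"
    using std unfolding ALG_WT_def by metis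
  have "nABS D \<rho> \<mu> (Lall F nF) \<epsilon> d \<noteq> \<infinity> \<and>
      ln (real (the_enat (nABS D \<rho> \<mu> (Lall F nF) \<epsilon> d))) / (1 / \<epsilon> + real d) < \<eta>"
    if d: "d \<ge> 1" and \<epsilon>: "0 < \<epsilon> \<and> \<epsilon> < 1 \<and> 1 / \<epsilon> + real d > M" for d \<epsilon>
  proof -
    interpret avg_approx D \<rho> F nF \<mu> d using s d by unfold_locales (simp add: avg_setting_def)
    obtain m where m: "nABS D \<rho> \<mu> (Lstd D) \<epsilon> d = enat m" "eavg2 D \<rho> \<mu> (Lstd D) m d \<le> ennreal (\<epsilon>\<^sup>2)"
      by (rule nABS_attained) (use M[OF d \<epsilon>] in auto)
    have "nABS D \<rho> \<mu> (Lall F nF) \<epsilon> d \<le> enat m"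
      by (rule nABS_le) (use m(2) eavg2_all_le_std[of m] in \<open>rule order_trans[rotated]\<close>)
    then obtain k where k: "nABS D \<rho> \<mu> (Lall F nF) \<epsilon> d = enat k" "k \<le> m"
      by (cases "nABS D \<rho> \<mu> (Lall F nF) \<epsilon> d") auto
    have "ln (real k) \<le> ln (real m)" using k(2) ln_real_mono[of m k] by (cases "m = 0") auto
    then have "ln (real k) / (1 / \<epsilon> + real d) \<le> ln (real m) / (1 / \<epsilon> + real d)"
      using \<epsilon> by (intro divide_right_mono) auto
    then show ?thesis using M[OF d \<epsilon>] m(1) k(1) by simp
  qed
  then show "\<exists>M. \<forall>d\<ge>1. \<forall>\<epsilon>. 0 < \<epsilon> \<and> \<epsilon> < 1 \<and> 1 / \<epsilon> + real d > M \<longrightarrow>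
      nABS D \<rho> \<mu> (Lall F nF) \<epsilon> d \<noteq> \<infinity> \<and>
      ln (real (the_enat (nABS D \<rho> \<mu> (Lall F nF) \<epsilon> d))) / (1 / \<epsilon> + real d) < \<eta>"
    by blast
qed

lemma ALG_WT_all_imp_std:
  assumes s: "avg_setting D \<rho> F nF \<mu>" and all: "ALG_WT D \<rho> \<mu> (Lall F nF)"
  shows "ALG_WT D \<rho> \<mu> (Lstd D)"
  unfolding ALG_WT_def
proof (intro allI impI)
  fix \<eta> :: real assume \<eta>: "\<eta> > 0"
  \<comment> \<open>With \<open>t = 1 / \<epsilon> + d\<close>, the denominator at
    \<open>\<epsilon> / 4\<close> is at most \<open>4 * t\<close>, so \<open>ln n\<close> is below
    \<open>\<eta> / 4 * t\<close>. Squaring \<open>n\<close> doubles this, and half of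
    \<open>\<eta> * t\<close> remains for \<open>ln 8\<close>.\<close>
  then have "\<eta> / 16 > 0" by simp
  then obtain M where M: "\<And>d \<epsilon>. d \<ge> 1 \<Longrightarrow> 0 < \<epsilon> \<and> \<epsilon> < 1 \<and> 1 / \<epsilon> + real d > M \<Longrightarrow>
      nABS D \<rho> \<mu> (Lall F nF) \<epsilon> d \<noteq> \<infinity> \<and>
      ln (real (the_enat (nABS D \<rho> \<mu> (Lall F nF) \<epsilon> d))) / (1 / \<epsilon> + real d) < \<eta> / 16"
    using all unfolding ALG_WT_def by metis
  \<comment> \<open>The second entry of the maximum is there to make
    \<open>ln 8 < \<eta> / 2 * t\<close>.\<close>
  have "nABS D \<rho> \<mu> (Lstd D) \<epsilon> d \<noteq> \<infinity> \<and>
      ln (real (the_enat (nABS D \<rho> \<mu> (Lstd D) \<epsilon> d))) / (1 / \<epsilon> + real d) < \<eta>"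
    if d: "d \<ge> 1" and \<epsilon>: "0 < \<epsilon>" "\<epsilon> < 1" "1 / \<epsilon> + real d > max M (2 * ln 8 / \<eta>)" for d \<epsilon>
  proof -
    interpret avg_approx D \<rho> F nF \<mu> d using s d by unfold_locales (simp add: avg_setting_def)
    define t where "t = 1 / \<epsilon> + real d"
    have t: "t > 0" "t > M" "2 * ln 8 / \<eta> < t" using \<epsilon> d by (auto simp: t_def add_pos_pos)
    have t4: "1 / (\<epsilon> / 4) + real d \<le> 4 * t" "t \<le> 1 / (\<epsilon> / 4) + real d"
      using \<epsilon> by (auto simp: t_def field_simps)
    have \<epsilon>4: "0 < \<epsilon> / 4 \<and> \<epsilon> / 4 < 1 \<and> 1 / (\<epsilon> / 4) + real d > M" using \<epsilon> t t4 by auto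
    obtain n where n: "nABS D \<rho> \<mu> (Lall F nF) (\<epsilon> / 4) d = enat n"
      "eavg2 D \<rho> \<mu> (Lall F nF) n d \<le> ennreal ((\<epsilon> / 4)\<^sup>2)"
      by (rule nABS_attained) (use M[OF d \<epsilon>4] in auto)
    have "ln (real n) / (1 / (\<epsilon> / 4) + real d) < \<eta> / 16" using M[OF d \<epsilon>4] n(1) by simp
    then have "ln (real n) < \<eta> / 16 * (1 / (\<epsilon> / 4) + real d)"
      using t t4 by (simp add: pos_divide_less_eq)
    also have "\<dots> \<le> \<eta> / 16 * (4 * t)" using t4 \<eta> by (intro mult_left_mono) auto
    finally have lnn: "ln (real n) < \<eta> / 4 * t" by simp
    have ln8: "ln 8 < \<eta> / 2 * t" using t(3) \<eta> by (simp add: field_simps)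
    have "eavg2 D \<rho> \<mu> (Lstd D) (8 * n\<^sup>2) d \<le> ennreal (\<epsilon>\<^sup>2)"
    proof (cases "n = 0")
      \<comment> \<open>With no information both classes admit only the zero algorithm, and
        \<open>8 * n^2\<close> is 0 as well.\<close>
      case True
      have "algs D \<rho> (Lstd D) d 0 = algs D \<rho> (Lall F nF) d 0" by (simp add: algs_def)
      then have "eavg2 D \<rho> \<mu> (Lstd D) 0 d = eavg2 D \<rho> \<mu> (Lall F nF) 0 d" by (simp add: eavg2_def)
      also have "\<dots> \<le> ennreal ((\<epsilon> / 4)\<^sup>2)" using n(2) True by simp
      also have "\<dots> \<le> ennreal (\<epsilon>\<^sup>2)" using \<epsilon> by (intro ennreal_leI power_mono) auto
      finally show ?thesis using True by simp
    next
      case False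
      then show ?thesis using std_error_bound[OF _ \<epsilon>(1) n(2)] by simp
    qed
    from nABS_le[OF this] obtain k where k: "nABS D \<rho> \<mu> (Lstd D) \<epsilon> d = enat k" "k \<le> 8 * n\<^sup>2"
      by (cases "nABS D \<rho> \<mu> (Lstd D) \<epsilon> d") auto
    have "ln (real k) < \<eta> * t"
    proof (cases "k = 0")
      case True
      then show ?thesis using \<eta> t by simp
    next
      case False
      then have n0: "n > 0" using k(2) by (cases n) auto
      have "ln (real k) \<le> ln (real (8 * n\<^sup>2))" using ln_real_mono[OF _ k(2)] n0 by simp
      also have "\<dots> = ln 8 + 2 * ln (real n)" using n0 by (simp add: ln_mult ln_realpow)
      also have "\<dots> < \<eta> * t" using lnn ln8 by (simp add: field_simps)
      finally show ?thesis .
    qed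
    then have "ln (real k) / t < \<eta>" using t(1) by (simp add: pos_divide_less_eq)
    then show ?thesis using k(1) by (simp add: t_def)
  qed
  then show "\<exists>M. \<forall>d\<ge>1. \<forall>\<epsilon>. 0 < \<epsilon> \<and> \<epsilon> < 1 \<and> 1 / \<epsilon> + real d > M \<longrightarrow>
      nABS D \<rho> \<mu> (Lstd D) \<epsilon> d \<noteq> \<infinity> \<and>
      ln (real (the_enat (nABS D \<rho> \<mu> (Lstd D) \<epsilon> d))) / (1 / \<epsilon> + real d) < \<eta>"
    by (intro exI[of _ "max M (2 * ln 8 / \<eta>)"]) blast
qed

theorem theorem4p3:
  assumes "avg_setting D \<rho> F nF \<mu>"
  shows "ALG_WT D \<rho> \<mu> (Lall F nF) \<longleftrightarrow> ALG_WT D \<rho> \<mu> (Lstd D)"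
  using ALG_WT_all_imp_std[OF assms] ALG_WT_std_imp_all[OF assms] by blast

end
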